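(* Let $d\ge 2$ and $j\in\{0,1\}$, and let $D_j$ be a set of $2d-j$ distinct points in $\mathbb P^2$ lying on the conic $C=\{x_1^2-x_0x_2=0\}$. Let $I_{D_j}$ be its defining ideal, which can be represented as $$I_{D_0}=\langle x_1^2-x_0x_2\rangle+\langle x_1(x_0^{d-1}-x_2^{d-1})\rangle \quad\text{if } j=0,$$ $$I_{D_1}=\langle x_1^2-x_0x_2\rangle+\langle x_1(x_0^{d-1}-x_2^{d-1}),\; x_0(x_0^{d-1}-x_2^{d-1})\rangle \quad\text{if } j=1.$$ If $r\ge 2$, then (1) $\operatorname{reg}(I_{D_0}^r)=rd+1$; (2) $\operatorname{reg}(I_{D_1}^r)=rd$.
   Context: $K$ is an algebraically closed field, $S=K[x_0,x_1,x_2]$ is the graded polynomial ring, and $\mathbb P^2$ is the projective plane over $K$ with coordinates $x_0,x_1,x_2$. The conic $C$ is the rational normal curve in $\mathbb P^2$, the image of $[s:t]\mapsto[s^2:st:t^2]$. For a homogeneous ideal $J\subset S$, $\operatorname{reg}(J)=\max\{k-i:\beta_{i,k}(J)\neq 0\}$ is the Castelnuovo–Mumford regularity, where $\beta_{i,k}(J)=\dim_K\operatorname{Tor}_i^S(J,K)_k$. $J^r$ denotes the ordinary $r$-th power of $J$. *)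

theory Defs
  imports "HOL-Analysis.Analysis" "HOL-Library.Poly_Mapping" "HOL-Library.Set_Algebras" "HOL-Library.Function_Algebras"
    "HOL-Computational_Algebra.Polynomial"
begin

section \<open>The graded polynomial ring in three variables\<close>

text \<open>The variables are indexed by the three-element type \<^typ>\<open>3\<close>, whose elements are
  \<open>0\<close>, \<open>1\<close>, \<open>2\<close>.\<close>

type_synonym 'a poly3 = "(3 \<Rightarrow>\<^sub>0 nat) \<Rightarrow>\<^sub>0 'a"

definition X :: "3 \<Rightarrow> 'a::comm_ring_1 poly3"
  where "X i = Poly_Mapping.single (Poly_Mapping.single i 1) 1"

definition mon_degree :: "(3 \<Rightarrow>\<^sub>0 nat) \<Rightarrow> nat"
  where "mon_degree m = (\<Sum>i\<in>UNIV. Poly_Mapping.lookup m i)"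

text \<open>The degree is an integer, so that twisted free modules can be handled; the zero polynomial is
  homogeneous of every degree and is the only one that is homogeneous of a negative degree.\<close>

definition homogeneous :: "'a::zero poly3 \<Rightarrow> int \<Rightarrow> bool"
  where "homogeneous f k \<longleftrightarrow> (\<forall>m\<in>Poly_Mapping.keys f. int (mon_degree m) = k)"

definition eval_poly :: "'a::comm_ring_1 poly3 \<Rightarrow> 'a ^ 3 \<Rightarrow> 'a"
  where "eval_poly f v = (\<Sum>m\<in>Poly_Mapping.keys f. Poly_Mapping.lookup f m * (\<Prod>i\<in>UNIV. (v $ i) ^ Poly_Mapping.lookup m i))"

text \<open>Reduction modulo the irrelevant ideal \<open>\<langle>x\<^sub>0, x\<^sub>1, x\<^sub>2\<rangle>\<close>, i.e. the map \<open>S \<rightarrow> K\<close>.\<close>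

definition const_coeff :: "'a::zero poly3 \<Rightarrow> 'a"
  where "const_coeff f = Poly_Mapping.lookup f 0"


section \<open>Ideals\<close>

abbreviation ideal_span :: "'r::comm_ring_1 set \<Rightarrow> 'r set"
  where "ideal_span \<equiv> module.span (*)"

definition ideal_mult :: "'r::comm_ring_1 set \<Rightarrow> 'r set \<Rightarrow> 'r set"
  where "ideal_mult I J = ideal_span {a * b | a b. a \<in> I \<and> b \<in> J}"

primrec ideal_power :: "'r::comm_ring_1 set \<Rightarrow> nat \<Rightarrow> 'r set"
  where
    "ideal_power I 0 = UNIV"
  | "ideal_power I (Suc n) = ideal_mult I (ideal_power I n)"


section \<open>The projective plane\<close>

text \<open>A point is the set of all its homogeneous coordinate vectors.\<close>

definition proportional :: "(('a::field ^ 3) \<times> ('a ^ 3)) set"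
  where "proportional = {(v, w). v \<noteq> 0 \<and> w \<noteq> 0 \<and> (\<exists>c. w = c *s v)}"

definition proj_plane :: "('a::field ^ 3) set set"
  where "proj_plane = (UNIV - {0}) // proportional"

definition plane_conic :: "('a::field ^ 3) set set"
  where "plane_conic = {p \<in> proj_plane. \<forall>v\<in>p. eval_poly (X 1 ^ 2 - X 0 * X 2) v = 0}"

definition vanishing_ideal :: "('a::field ^ 3) set set \<Rightarrow> 'a poly3 set"
  where "vanishing_ideal D =
    ideal_span {f. (\<exists>k. homogeneous f k) \<and> (\<forall>p\<in>D. \<forall>v\<in>p. eval_poly f v = 0)}"


section \<open>Graded free resolutions, Tor and regularity\<close>

text \<open>The record describes a complex \<open>\<dots> \<rightarrow> F\<^sub>2 \<rightarrow> F\<^sub>1 \<rightarrow> F\<^sub>0 \<rightarrow> S\<close> of graded free modules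
  \<open>F\<^sub>i = \<Oplus>\<^bsub>l < frank i\<^esub> S(- fshift i l)\<close>, so \<open>fshift i l\<close> is the degree of the \<open>l\<close>-th basis
  element of \<open>F\<^sub>i\<close>. The map \<open>F\<^sub>0 \<rightarrow> S\<close> has the row matrix \<open>augm\<close>, and \<open>F\<^bsub>i+1\<^esub> \<rightarrow> F\<^sub>i\<close> has the matrix
  \<open>diff i\<close>, whose first index is the row. The free module of rank \<open>n\<close> consists of the
  functions on \<^typ>\<open>nat\<close> that vanish outside \<open>{..<n}\<close>.\<close>

record 'r free_complex =
  frank :: "nat \<Rightarrow> nat"
  fshift :: "nat \<Rightarrow> nat \<Rightarrow> int"
  augm :: "nat \<Rightarrow> 'r"
  diff :: "nat \<Rightarrow> nat \<Rightarrow> nat \<Rightarrow> 'r"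

definition free_module :: "nat \<Rightarrow> (nat \<Rightarrow> 'r::zero) set"
  where "free_module n = {v. \<forall>l\<ge>n. v l = 0}"

definition mat_app :: "nat \<Rightarrow> nat \<Rightarrow> (nat \<Rightarrow> nat \<Rightarrow> 'r::comm_ring_1) \<Rightarrow> (nat \<Rightarrow> 'r) \<Rightarrow> nat \<Rightarrow> 'r"
  where "mat_app m n A v = (\<lambda>p. if p < m then (\<Sum>q<n. A p q * v q) else 0)"

definition augm_map :: "'a::field poly3 free_complex \<Rightarrow> (nat \<Rightarrow> 'a poly3) \<Rightarrow> 'a poly3"
  where "augm_map F v = (\<Sum>q<frank F 0. augm F q * v q)"

definition diff_map :: "'a::field poly3 free_complex \<Rightarrow> nat \<Rightarrow> (nat \<Rightarrow> 'a poly3) \<Rightarrow> nat \<Rightarrow> 'a poly3"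
  where "diff_map F i = mat_app (frank F i) (frank F (Suc i)) (diff F i)"

definition graded_free_resolution :: "'a::field poly3 set \<Rightarrow> 'a poly3 free_complex \<Rightarrow> bool"
  where "graded_free_resolution J F \<longleftrightarrow>
    (\<forall>q<frank F 0. homogeneous (augm F q) (fshift F 0 q)) \<and>
    (\<forall>i. \<forall>p<frank F i. \<forall>q<frank F (Suc i).
       homogeneous (diff F i p q) (fshift F (Suc i) q - fshift F i p)) \<and>
    augm_map F ` free_module (frank F 0) = J \<and>
    {v \<in> free_module (frank F 0). augm_map F v = 0}
      = diff_map F 0 ` free_module (frank F 1) \<and>
    (\<forall>i. {v \<in> free_module (frank F (Suc i)). diff_map F i v = 0}
      = diff_map F (Suc i) ` free_module (frank F (Suc (Suc i))))"

text \<open>The complex \<open>F \<otimes>\<^sub>S K\<close> of graded \<open>K\<close>-vector spaces: the module \<open>F\<^sub>i \<otimes>\<^sub>S K\<close> has the basis of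
  \<open>F\<^sub>i\<close>, with the same degrees, and the matrices are reduced modulo the irrelevant ideal. The
  augmentation is dropped.\<close>

definition tensor_part :: "'a::field poly3 free_complex \<Rightarrow> nat \<Rightarrow> int \<Rightarrow> (nat \<Rightarrow> 'a) set"
  where "tensor_part F i k = {v \<in> free_module (frank F i). \<forall>l. v l \<noteq> 0 \<longrightarrow> fshift F i l = k}"

definition tensor_map :: "'a::field poly3 free_complex \<Rightarrow> nat \<Rightarrow> (nat \<Rightarrow> 'a) \<Rightarrow> nat \<Rightarrow> 'a"
  where "tensor_map F i =
    mat_app (frank F i) (frank F (Suc i)) (\<lambda>p q. const_coeff (diff F i p q))"

definition tensor_cycles :: "'a::field poly3 free_complex \<Rightarrow> nat \<Rightarrow> int \<Rightarrow> (nat \<Rightarrow> 'a) set"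
  where "tensor_cycles F i k =
    {v \<in> tensor_part F i k. case i of 0 \<Rightarrow> True | Suc j \<Rightarrow> tensor_map F j v = 0}"

definition tensor_boundaries :: "'a::field poly3 free_complex \<Rightarrow> nat \<Rightarrow> int \<Rightarrow> (nat \<Rightarrow> 'a) set"
  where "tensor_boundaries F i k = tensor_map F i ` tensor_part F (Suc i) k"

abbreviation K_dim :: "(nat \<Rightarrow> 'a::field) set \<Rightarrow> nat"
  where "K_dim \<equiv> vector_space.dim (\<lambda>c v l. c * v l)"

text \<open>The dimension of the degree-\<open>k\<close> part of \<open>Tor\<^sub>i(J, K) = H\<^sub>i(F \<otimes>\<^sub>S K)\<close>, for a chosen graded free
  resolution \<open>F\<close> of the homogeneous ideal \<open>J\<close> by modules of finite rank. Such a resolution exists by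
  Hilbert's basis theorem, and the dimension does not depend on the choice. The boundaries lie in
  the finite-dimensional space of cycles, so the subtraction does not truncate.\<close>

definition betti :: "'a::field poly3 set \<Rightarrow> nat \<Rightarrow> int \<Rightarrow> nat"
  where "betti J i k = (let F = (SOME F. graded_free_resolution J F) in
    K_dim (tensor_cycles F i k) - K_dim (tensor_boundaries F i k))"

definition regularity :: "'a::field poly3 set \<Rightarrow> int"
  where "regularity J = Max {k - int i | i k. betti J i k \<noteq> 0}"

end

theory Submission
  imports Defs "HOL-Library.Nat_Bijection"
begin

text \<open>
  The regularity is read off from an explicit minimal graded free resolution of the power, of length one
  for an even and of length two for an odd number of points.

  Parametrise the conic by \<open>(s\<^sup>2 : s t : t\<^sup>2)\<close>, and let \<open>q = x\<^sub>1\<^sup>2 - x\<^sub>0x\<^sub>2\<close>. The restriction of plane forms of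
  degree \<open>n\<close> to the conic has kernel \<open>\<langle>q\<rangle>\<close> and maps onto the binary forms of degree \<open>2n\<close>, so a form vanishes
  on \<open>m\<close> points of the conic if and only if its restriction is a multiple of the binary form \<open>w\<close> of degree
  \<open>m\<close> with these zeros (\<open>vanishing_on_conic_points\<close>). If \<open>m = 2d\<close>, then \<open>w\<close> is the restriction of a form \<open>f\<close> of
  degree \<open>d\<close>, and the ideal is \<open>\<langle>q, f\<rangle>\<close>. If \<open>m = 2d - 1\<close>, then \<open>w = s a + t b\<close> where \<open>a\<close>, \<open>b\<close> are restrictions of
  forms \<open>A\<close>, \<open>B\<close> of degree \<open>d - 1\<close>; the forms \<open>s w\<close> and \<open>t w\<close> are restrictions of \<open>f\<^sub>1 = x\<^sub>0A + x\<^sub>1B\<close> and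
  \<open>f\<^sub>2 = x\<^sub>1A + x\<^sub>2B\<close>, and the ideal is \<open>\<langle>q, f\<^sub>1, f\<^sub>2\<rangle>\<close>. The displayed generators have the same shape: put
  \<open>f = x\<^sub>1(x\<^sub>0\<^bsup>d-1\<^esup> - x\<^sub>2\<^bsup>d-1\<^esup>)\<close>, respectively \<open>A = x\<^sub>0\<^bsup>d-1\<^esup> - x\<^sub>2\<^bsup>d-1\<^esup>\<close> and \<open>B = 0\<close>. In all cases
  \<open>f\<close>, respectively \<open>f\<^sub>1\<close>, is not divisible by the prime \<open>q\<close>; the resolutions below rest on this.

  In the even case \<open>q, f\<close> is a regular sequence. The relations between the products \<open>q\<^sup>kf\<^bsup>r-k\<^esup>\<close> come from
  \<open>f \<cdot> q = q \<cdot> f\<close>: with variables \<open>T\<^sub>0\<close>, \<open>T\<^sub>1\<close> for \<open>q\<close>, \<open>f\<close>, the resolution is multiplication by \<open>f T\<^sub>0 - q T\<^sub>1\<close> from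
  the forms of degree \<open>r - 1\<close> to the forms of degree \<open>r\<close> over \<open>S\<close>. The largest degrees of basis elements are
  \<open>r d\<close> and \<open>r d + 2\<close>, in homological degrees \<open>0\<close> and \<open>1\<close>, so the regularity is \<open>r d + 1\<close>
  (\<open>regularity_complete_intersection_power\<close>).

  In the odd case the generators satisfy two relations, which are linear forms in variables for them,
  \<open>\<rho>\<^sub>1 = x\<^sub>1T\<^sub>1 - x\<^sub>0T\<^sub>2 - B T\<^sub>0\<close> and \<open>\<rho>\<^sub>2 = x\<^sub>2T\<^sub>1 - x\<^sub>1T\<^sub>2 + A T\<^sub>0\<close>.
  They form a regular sequence and define the Rees algebra, so the strand of degree \<open>r\<close> of their Koszul
  complex resolves the \<open>r\<close>-th power. Exactness (\<open>biform_eq_zero\<close>, \<open>relation_syzygies\<close>) is proved by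
  induction on \<open>r\<close>: modulo \<open>T\<^sub>0\<close> the relations become \<open>x\<^sub>1 - x\<^sub>0Y\<close> and \<open>x\<^sub>2 - x\<^sub>1Y\<close>, which express that \<open>Y\<close> is the
  parameter \<open>t / s\<close> of the conic (\<open>eval_at_t_eq_zero\<close>, \<open>line_syzygies\<close>), and what is divisible by \<open>T\<^sub>0\<close> belongs
  to the power \<open>r - 1\<close>. A basis element of homological degree \<open>i\<close> has degree \<open>d (r - k) + 2k + i\<close> with \<open>k \<ge> 0\<close>,
  whence regularity \<open>r d\<close> (\<open>regularity_ideal_power\<close>).

  The Betti numbers are defined by an arbitrary graded free resolution. Comparison maps between two
  resolutions and homotopies show that their vanishing does not depend on it
  (\<open>nonboundary_transfer\<close>), and for a minimal resolution they are read off from the degrees of the bases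
  (\<open>betti_nonzero_iff_minimal\<close>).
\<close>

section \<open>Substitution and grading in the polynomial ring\<close>

lemma three_cases: "i = 0 \<or> i = 1 \<or> i = (2::3)"
proof -
  have "(3::3) = 0" by simp
  then show ?thesis using exhaust_3[of i] by metis
qed

lemma UNIV_three: "(UNIV :: 3 set) = {0, 1, 2}"
  using three_cases by blast

lemma distinct_three: "(0::3) \<noteq> 1" "(0::3) \<noteq> 2" "(1::3) \<noteq> 2"
  by simp_all

lemma sum_UNIV_three: "(\<Sum>i\<in>(UNIV :: 3 set). h i) = h 0 + h 1 + (h 2 :: 'b::comm_monoid_add)"
proof -
  have "(\<Sum>i\<in>{0, 1, 2 :: 3}. h i) = h 0 + (h 1 + h 2)"
    using distinct_three
    by (simp only: sum.insert finite.intros insert_iff empty_iff sum.empty add_0_right simp_thms)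
  then show ?thesis unfolding UNIV_three by (simp only: add.assoc)
qed

lemma prod_UNIV_three: "(\<Prod>i\<in>(UNIV :: 3 set). h i) = h 0 * h 1 * (h 2 :: 'b::comm_monoid_mult)"
proof -
  have "(\<Prod>i\<in>{0, 1, 2 :: 3}. h i) = h 0 * (h 1 * h 2)"
    using distinct_three
    by (simp only: prod.insert finite.intros insert_iff empty_iff prod.empty mult_1_right simp_thms)
  then show ?thesis unfolding UNIV_three by (simp only: mult.assoc)
qed

lemma mon_degree_zero [simp]: "mon_degree 0 = 0"
  by (simp add: mon_degree_def)

lemma mon_degree_add [simp]: "mon_degree (m + n) = mon_degree m + mon_degree n"
  by (simp add: mon_degree_def lookup_add sum.distrib)

lemma mon_degree_single [simp]: "mon_degree (Poly_Mapping.single i n) = n"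
  by (simp add: mon_degree_def lookup_single when_def)

lemma poly_mapping_eq_sum_single:
  "f = (\<Sum>m\<in>Poly_Mapping.keys f. Poly_Mapping.single m (Poly_Mapping.lookup f m))"
proof (rule poly_mapping_eqI)
  fix k
  have "Poly_Mapping.lookup (\<Sum>m\<in>Poly_Mapping.keys f. Poly_Mapping.single m (Poly_Mapping.lookup f m)) k
    = (\<Sum>m\<in>Poly_Mapping.keys f. if k = m then Poly_Mapping.lookup f m else 0)"
    by (auto simp: lookup_sum lookup_single when_def intro!: sum.cong)
  also have "\<dots> = Poly_Mapping.lookup f k"
    by (simp add: sum.delta in_keys_iff)
  finally show "Poly_Mapping.lookup f k
    = Poly_Mapping.lookup (\<Sum>m\<in>Poly_Mapping.keys f. Poly_Mapping.single m (Poly_Mapping.lookup f m)) k" ..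
qed

lemma poly_mapping_additive_induct [case_names zero single add]:
  assumes "P 0" and "\<And>m c. P (Poly_Mapping.single m c)" and "\<And>f g. P f \<Longrightarrow> P g \<Longrightarrow> P (f + g)"
  shows "P (f :: 'k \<Rightarrow>\<^sub>0 'b::comm_monoid_add)"
proof -
  have "P (\<Sum>m\<in>M. Poly_Mapping.single m (Poly_Mapping.lookup f m))" if "finite M" for M
    using that by (induction M) (auto intro: assms)
  then show ?thesis
    by (subst poly_mapping_eq_sum_single) simp
qed

lemma X_power_eq_single: "X i ^ n = Poly_Mapping.single (Poly_Mapping.single i n) (1 :: 'a::comm_ring_1)"
  by (induction n) (simp_all add: X_def mult_single flip: single_add)

lemma monomial_single_eq_product:
  "Poly_Mapping.single m c = Poly_Mapping.single 0 c * (X 0 ^ Poly_Mapping.lookup m 0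
    * X 1 ^ Poly_Mapping.lookup m 1 * X 2 ^ Poly_Mapping.lookup m 2 :: 'a::comm_ring_1 poly3)"
proof -
  have "m = Poly_Mapping.single 0 (Poly_Mapping.lookup m 0) + Poly_Mapping.single 1 (Poly_Mapping.lookup m 1)
      + Poly_Mapping.single 2 (Poly_Mapping.lookup m 2)" (is "m = ?s")
  proof (rule poly_mapping_eqI)
    fix i :: 3
    show "Poly_Mapping.lookup m i = Poly_Mapping.lookup ?s i"
      using three_cases[of i] by (auto simp: lookup_add lookup_single when_def)
  qed
  then show ?thesis
    unfolding X_power_eq_single mult_single by simp
qed

text \<open>All the evaluations that occur below (at a point, along a parametrisation of the conic) are
  ring homomorphisms of the following form.\<close>

definition subst_poly :: "('a \<Rightarrow> 'r) \<Rightarrow> (3 \<Rightarrow> 'r) \<Rightarrow> 'a::comm_ring_1 poly3 \<Rightarrow> 'r::comm_ring_1"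
  where "subst_poly c v f =
    (\<Sum>m\<in>Poly_Mapping.keys f. c (Poly_Mapping.lookup f m) * (\<Prod>i\<in>UNIV. v i ^ Poly_Mapping.lookup m i))"

locale substitution =
  fixes c :: "'a::comm_ring_1 \<Rightarrow> 'r::comm_ring_1" and v :: "3 \<Rightarrow> 'r"
  assumes c_zero: "c 0 = 0" and c_one: "c 1 = 1"
    and c_add: "c (a + b) = c a + c b" and c_mult: "c (a * b) = c a * c b"
begin

lemma subst_superset:
  assumes "finite M" "Poly_Mapping.keys f \<subseteq> M"
  shows "subst_poly c v f =
    (\<Sum>m\<in>M. c (Poly_Mapping.lookup f m) * (\<Prod>i\<in>UNIV. v i ^ Poly_Mapping.lookup m i))"
  unfolding subst_poly_def
  by (rule sum.mono_neutral_left) (use assms in \<open>auto simp: in_keys_iff c_zero\<close>)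

lemma subst_add: "subst_poly c v (f + g) = subst_poly c v f + subst_poly c v g"
proof -
  let ?M = "Poly_Mapping.keys f \<union> Poly_Mapping.keys g"
  have "Poly_Mapping.keys (f + g) \<subseteq> ?M" by (rule keys_add)
  then show ?thesis
    by (simp add: subst_superset[of ?M] lookup_add c_add algebra_simps sum.distrib)
qed

lemma subst_zero: "subst_poly c v 0 = 0"
  by (simp add: subst_poly_def)

lemma subst_single:
  "subst_poly c v (Poly_Mapping.single m a) = c a * (\<Prod>i\<in>UNIV. v i ^ Poly_Mapping.lookup m i)"
  by (subst subst_superset[of "{m}"]) (auto simp: lookup_single)

lemma subst_mult: "subst_poly c v (f * g) = subst_poly c v f * subst_poly c v g"
proof (induction f rule: poly_mapping_additive_induct)
  case (single m a)
  show ?case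
  proof (induction g rule: poly_mapping_additive_induct)
    case (single n b)
    show ?case
      by (simp add: mult_single subst_single c_mult lookup_add power_add prod.distrib mult_ac)
  qed (simp_all add: subst_zero subst_add ring_distribs)
qed (simp_all add: subst_zero subst_add ring_distribs)

lemma subst_one: "subst_poly c v 1 = 1"
  using subst_single[of 0 1] by (simp add: c_one)

lemma subst_uminus: "subst_poly c v (- f) = - subst_poly c v f"
  using subst_add[of f "- f"] by (simp add: subst_zero add_eq_0_iff)

lemma subst_diff: "subst_poly c v (f - g) = subst_poly c v f - subst_poly c v g"
  using subst_add[of f "- g"] by (simp add: subst_uminus)

lemma subst_sum: "subst_poly c v (\<Sum>i\<in>I. f i) = (\<Sum>i\<in>I. subst_poly c v (f i))"
  by (induction I rule: infinite_finite_induct) (simp_all add: subst_zero subst_add)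

lemma subst_power: "subst_poly c v (f ^ n) = subst_poly c v f ^ n"
  by (induction n) (simp_all add: subst_one subst_mult)

lemma subst_X: "subst_poly c v (X i) = v i"
proof -
  have "(\<Prod>j\<in>UNIV. v j ^ Poly_Mapping.lookup (Poly_Mapping.single i 1) j) = (\<Prod>j\<in>UNIV. if j = i then v j else 1)"
    by (rule prod.cong) (auto simp: lookup_single when_def)
  then show ?thesis
    by (simp add: X_def subst_single c_one)
qed

lemmas subst_simps = subst_zero subst_one subst_add subst_uminus subst_diff subst_mult subst_sum
  subst_power subst_X

end

lemma eval_poly_eq_subst: "eval_poly f w = subst_poly (\<lambda>a. a) (\<lambda>i. w $ i) f"
  by (simp add: eval_poly_def subst_poly_def)

interpretation eval: substitution "\<lambda>a. a" "\<lambda>i. w $ i" for w :: "'a::comm_ring_1 ^ 3"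
  by unfold_locales simp_all

text \<open>The constant coefficient is the value at the origin; hence it is multiplicative.\<close>

lemma const_coeff_eq_subst: "const_coeff f = subst_poly (\<lambda>a. a) (\<lambda>i. 0) f"
proof -
  interpret z: substitution "\<lambda>a. a" "\<lambda>i. 0 :: 'a" by unfold_locales simp_all
  show ?thesis
  proof (induction f rule: poly_mapping_additive_induct)
    case (single m a)
    have "(\<Prod>i\<in>UNIV. (0::'a) ^ Poly_Mapping.lookup m i) = (if m = 0 then 1 else 0)"
    proof (cases "m = 0")
      case False
      then obtain i where "Poly_Mapping.lookup m i \<noteq> 0"
        by (metis lookup_zero poly_mapping_eqI)
      then show ?thesis
        using False by (auto intro!: prod_zero bexI[of _ i] simp: zero_power)
    qed simp
    then show ?case
      by (simp add: const_coeff_def z.subst_single lookup_single when_def)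
  qed (simp_all add: z.subst_simps const_coeff_def lookup_add)
qed

interpretation const_coeff: substitution "\<lambda>a. a" "\<lambda>i. 0 :: 'a::comm_ring_1"
  by unfold_locales simp_all

lemma const_coeff_zero [simp]: "const_coeff 0 = 0"
  by (simp add: const_coeff_def)

lemma const_coeff_add: "const_coeff (f + g) = const_coeff f + const_coeff g"
  by (simp add: const_coeff_def lookup_add)

lemma const_coeff_diff: "const_coeff (f - g) = const_coeff f - const_coeff (g :: 'a::comm_ring_1 poly3)"
  by (simp add: const_coeff_def lookup_minus)

lemma const_coeff_mult: "const_coeff (f * g) = const_coeff f * const_coeff g" for f g :: "'a::comm_ring_1 poly3"
  by (simp add: const_coeff_eq_subst const_coeff.subst_simps)

lemma const_coeff_sum: "const_coeff (\<Sum>i\<in>I. f i) = (\<Sum>i\<in>I. const_coeff (f i :: 'a::comm_ring_1 poly3))"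
  by (simp add: const_coeff_eq_subst const_coeff.subst_simps)

lemma const_coeff_single [simp]: "const_coeff (Poly_Mapping.single 0 a) = a"
  by (simp add: const_coeff_def)

lemma homogeneous_zero [simp]: "homogeneous 0 k"
  by (simp add: homogeneous_def)

lemma homogeneous_iff_lookup:
  "homogeneous f k \<longleftrightarrow> (\<forall>m. Poly_Mapping.lookup f m \<noteq> 0 \<longrightarrow> int (mon_degree m) = k)"
  by (auto simp: homogeneous_def in_keys_iff)

lemma homogeneous_add: "homogeneous f k \<Longrightarrow> homogeneous g k \<Longrightarrow> homogeneous (f + g) k"
  unfolding homogeneous_def using keys_add[of f g] by blast

lemma homogeneous_uminus: "homogeneous f k \<Longrightarrow> homogeneous (- f :: 'a::comm_ring_1 poly3) k"
  by (simp add: homogeneous_iff_lookup)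

lemma homogeneous_diff:
  "homogeneous f k \<Longrightarrow> homogeneous g k \<Longrightarrow> homogeneous (f - g :: 'a::comm_ring_1 poly3) k"
  using homogeneous_add[OF _ homogeneous_uminus, of f k g] by simp

lemma homogeneous_sum:
  "(\<And>i. i \<in> I \<Longrightarrow> homogeneous (f i) k) \<Longrightarrow> homogeneous (\<Sum>i\<in>I. f i) k"
  by (induction I rule: infinite_finite_induct) (auto intro: homogeneous_add)

lemma homogeneous_mult:
  "homogeneous f k \<Longrightarrow> homogeneous g l \<Longrightarrow> homogeneous (f * g :: 'a::comm_ring_1 poly3) (k + l)"
  unfolding homogeneous_def
proof
  assume f: "\<forall>m\<in>Poly_Mapping.keys f. int (mon_degree m) = k"
    and g: "\<forall>m\<in>Poly_Mapping.keys g. int (mon_degree m) = l"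
  fix m assume "m \<in> Poly_Mapping.keys (f * g)"
  then obtain a b where "m = a + b" "a \<in> Poly_Mapping.keys f" "b \<in> Poly_Mapping.keys g"
    using keys_mult[of f g] by blast
  then show "int (mon_degree m) = k + l" using f g by simp
qed

lemma homogeneous_one: "homogeneous (1 :: 'a::comm_ring_1 poly3) 0"
  by (auto simp: homogeneous_def)

lemma homogeneous_power:
  "homogeneous f k \<Longrightarrow> homogeneous (f ^ n :: 'a::comm_ring_1 poly3) (int n * k)"
proof (induction n)
  case (Suc n)
  then show ?case
    using homogeneous_mult[of f k "f ^ n" "int n * k"] by (simp add: algebra_simps)
qed (simp add: homogeneous_one)

lemma homogeneous_single: "homogeneous (Poly_Mapping.single m a) (int (mon_degree m))"
  by (auto simp: homogeneous_def)

lemma homogeneous_X: "homogeneous (X i :: 'a::comm_ring_1 poly3) 1"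
  using homogeneous_single[of "Poly_Mapping.single i 1" "1 :: 'a"] by (simp add: X_def)

lemma const_coeff_homogeneous: "homogeneous f k \<Longrightarrow> const_coeff f \<noteq> 0 \<Longrightarrow> k = 0"
  by (force simp: const_coeff_def homogeneous_iff_lookup)

definition homogeneous_part :: "int \<Rightarrow> 'a::zero poly3 \<Rightarrow> 'a poly3"
  where "homogeneous_part k f = Poly_Mapping.mapp (\<lambda>m a. a when int (mon_degree m) = k) f"

lemma lookup_homogeneous_part:
  "Poly_Mapping.lookup (homogeneous_part k f) m = (Poly_Mapping.lookup f m when int (mon_degree m) = k)"
  by (auto simp: homogeneous_part_def lookup_mapp when_def in_keys_iff)

lemma homogeneous_homogeneous_part: "homogeneous (homogeneous_part k f) k"
  by (simp add: homogeneous_iff_lookup lookup_homogeneous_part)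

lemma homogeneous_part_add: "homogeneous_part k (f + g) = homogeneous_part k f + homogeneous_part k g"
  by (rule poly_mapping_eqI) (simp add: lookup_homogeneous_part lookup_add when_def)

lemma homogeneous_part_zero [simp]: "homogeneous_part k 0 = 0"
  by (rule poly_mapping_eqI) (simp add: lookup_homogeneous_part)

lemma homogeneous_part_sum: "homogeneous_part k (\<Sum>i\<in>I. f i) = (\<Sum>i\<in>I. homogeneous_part k (f i))"
  by (induction I rule: infinite_finite_induct) (auto simp: homogeneous_part_add)

lemma homogeneous_part_of_homogeneous: "homogeneous f k \<Longrightarrow> homogeneous_part k f = f"
  by (rule poly_mapping_eqI) (auto simp: lookup_homogeneous_part homogeneous_iff_lookup when_def)

lemma homogeneous_part_of_homogeneous_other: "homogeneous f k \<Longrightarrow> j \<noteq> k \<Longrightarrow> homogeneous_part j f = 0"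
  by (rule poly_mapping_eqI) (auto simp: lookup_homogeneous_part homogeneous_iff_lookup when_def)

text \<open>Multiplication by a homogeneous element shifts degrees, which reduces the components of a matrix
  product to components of the entries of the vector.\<close>

lemma homogeneous_part_mult:
  assumes "homogeneous g j"
  shows "homogeneous_part k (f * g) = homogeneous_part (k - j) f * (g :: 'a::comm_ring_1 poly3)"
proof (induction f rule: poly_mapping_additive_induct)
  case (single m a)
  let ?s = "Poly_Mapping.single m a" and ?e = "int (mon_degree m)"
  have s: "homogeneous ?s ?e" and sg: "homogeneous (?s * g) (?e + j)"
    using homogeneous_single homogeneous_mult[OF _ assms] by blast+
  show ?case
  proof (cases "?e + j = k")
    case True
    then have "homogeneous ?s (k - j)" "homogeneous (?s * g) k" using s sg by auto
    then show ?thesis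
      by (simp add: homogeneous_part_of_homogeneous)
  next
    case False
    then have "k - j \<noteq> ?e" "k \<noteq> ?e + j" by auto
    then show ?thesis
      using s sg by (simp add: homogeneous_part_of_homogeneous_other)
  qed
qed (simp_all add: homogeneous_part_add ring_distribs)


section \<open>Homomorphisms of graded free modules\<close>

definition unit_vec :: "nat \<Rightarrow> nat \<Rightarrow> 'r::zero_neq_one"
  where "unit_vec q = (\<lambda>l. if l = q then 1 else 0)"

lemma unit_vec_in_free_module [simp]: "q < n \<Longrightarrow> unit_vec q \<in> free_module n"
  by (simp add: free_module_def unit_vec_def)

lemma zero_in_free_module [simp]: "0 \<in> free_module n"
  by (simp add: free_module_def)

lemma free_module_add: "v \<in> free_module n \<Longrightarrow> w \<in> free_module n \<Longrightarrow> v + w \<in> free_module n"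
  for v w :: "nat \<Rightarrow> 'r::comm_ring_1"
  by (simp add: free_module_def)

lemma free_module_diff: "v \<in> free_module n \<Longrightarrow> w \<in> free_module n \<Longrightarrow> v - w \<in> free_module n"
  for v w :: "nat \<Rightarrow> 'r::comm_ring_1"
  by (simp add: free_module_def)

lemma free_module_scale: "v \<in> free_module n \<Longrightarrow> (\<lambda>l. c * v l) \<in> free_module n"
  for v :: "nat \<Rightarrow> 'r::comm_ring_1"
  by (simp add: free_module_def)

text \<open>A degree-preserving homomorphism \<open>\<Oplus>\<^bsub>q < n\<^esub> S(- s q) \<rightarrow> \<Oplus>\<^bsub>p < m\<^esub> S(- t p)\<close>. Only the values on
  the free module matter; homogeneity is asked for on the basis, where it says that the matrix
  entries have the right degrees.\<close>

definition graded_hom ::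
  "nat \<Rightarrow> (nat \<Rightarrow> int) \<Rightarrow> nat \<Rightarrow> (nat \<Rightarrow> int) \<Rightarrow> ((nat \<Rightarrow> 'a::comm_ring_1 poly3) \<Rightarrow> nat \<Rightarrow> 'a poly3) \<Rightarrow> bool"
  where "graded_hom n s m t f \<longleftrightarrow>
    (\<forall>v\<in>free_module n. f v \<in> free_module m) \<and>
    (\<forall>v\<in>free_module n. \<forall>w\<in>free_module n. f (v + w) = f v + f w) \<and>
    (\<forall>c. \<forall>v\<in>free_module n. f (\<lambda>l. c * v l) = (\<lambda>l. c * f v l)) \<and>
    (\<forall>q<n. \<forall>p<m. homogeneous (f (unit_vec q) p) (s q - t p))"

lemma graded_homD:
  assumes "graded_hom n s m t f"
  shows "v \<in> free_module n \<Longrightarrow> f v \<in> free_module m"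
    and "v \<in> free_module n \<Longrightarrow> w \<in> free_module n \<Longrightarrow> f (v + w) = f v + f w"
    and "v \<in> free_module n \<Longrightarrow> f (\<lambda>l. c * v l) = (\<lambda>l. c * f v l)"
    and "q < n \<Longrightarrow> p < m \<Longrightarrow> homogeneous (f (unit_vec q) p) (s q - t p)"
  using assms by (auto simp: graded_hom_def)

lemma graded_hom_zero: "graded_hom n s m t f \<Longrightarrow> f 0 = 0"
  using graded_homD(2)[of n s m t f 0 0] by simp

lemma graded_hom_diff:
  assumes "graded_hom n s m t f" "v \<in> free_module n" "w \<in> free_module n"
  shows "f (v - w) = f v - f w"
proof -
  have "f ((v - w) + w) = f (v - w) + f w"
    by (rule graded_homD(2)[OF assms(1)]) (use assms free_module_diff in auto)
  then show ?thesis by simp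
qed

lemma sum_apply: "(\<Sum>i\<in>I. f i) x = (\<Sum>i\<in>I. f i x :: 'b::comm_monoid_add)"
  by (induction I rule: infinite_finite_induct) simp_all

lemma free_module_expand:
  fixes v :: "nat \<Rightarrow> 'r::comm_ring_1"
  assumes "v \<in> free_module n"
  shows "v = (\<Sum>q<n. (\<lambda>l. v q * unit_vec q l))"
proof
  fix l
  have "(\<Sum>q<n. (\<lambda>l. v q * unit_vec q l)) l = (\<Sum>q<n. v q * unit_vec q l)"
    by (simp add: sum_apply)
  also have "\<dots> = (\<Sum>q<n. if l = q then v q else 0)"
    by (intro sum.cong) (auto simp: unit_vec_def)
  also have "\<dots> = v l"
    using assms by (simp add: sum.delta free_module_def)
  finally show "v l = (\<Sum>q<n. (\<lambda>l. v q * unit_vec q l)) l" ..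
qed

lemma graded_hom_expand:
  assumes f: "graded_hom n s m t f" and v: "v \<in> free_module n"
  shows "f v p = (\<Sum>q<n. v q * f (unit_vec q) p)"
proof -
  have *: "f (\<Sum>q\<in>Q. (\<lambda>l. v q * unit_vec q l)) p = (\<Sum>q\<in>Q. v q * f (unit_vec q) p)
      \<and> (\<Sum>q\<in>Q. (\<lambda>l. v q * unit_vec q l)) \<in> free_module n" if "finite Q" "Q \<subseteq> {..<n}" for Q
    using that
  proof (induction Q)
    case empty
    show ?case
      unfolding sum.empty graded_hom_zero[OF f] by (simp add: free_module_def)
  next
    case (insert q Q)
    define a where "a = (\<lambda>l. v q * unit_vec q l)"
    define b where "b = (\<Sum>q\<in>Q. (\<lambda>l. v q * unit_vec q l))"
    have a: "a \<in> free_module n" "f a p = v q * f (unit_vec q) p"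
      unfolding a_def using insert by (auto intro: free_module_scale simp: graded_homD(3)[OF f])
    have b: "b \<in> free_module n" "f b p = (\<Sum>q\<in>Q. v q * f (unit_vec q) p)"
      unfolding b_def using insert by auto
    have "(\<Sum>q\<in>insert q Q. (\<lambda>l. v q * unit_vec q l)) = a + b"
      unfolding a_def b_def by (rule sum.insert[OF insert(1,2)])
    moreover have "f (a + b) p = (\<Sum>q\<in>insert q Q. v q * f (unit_vec q) p)"
      using insert(1,2) by (simp add: graded_homD(2)[OF f a(1) b(1)] a b)
    ultimately show ?case
      using free_module_add[OF a(1) b(1)] by (simp only: simp_thms)
  qed
  show ?thesis
    using *[of "{..<n}"] free_module_expand[OF v] by simp
qed

lemma mat_app_in_free_module: "mat_app m n A v \<in> free_module m"
  by (simp add: mat_app_def free_module_def)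

lemma mat_app_unit_vec: "q < n \<Longrightarrow> p < m \<Longrightarrow> mat_app m n A (unit_vec q) p = A p q"
  by (simp add: mat_app_def unit_vec_def if_distrib[of "\<lambda>x. _ * x"] sum.delta cong: if_cong)

lemma mat_app_add: "mat_app m n A (v + w) = mat_app m n A v + mat_app m n A w"
  by (rule ext) (simp add: mat_app_def ring_distribs sum.distrib)

lemma mat_app_scale: "mat_app m n A (\<lambda>l. c * v l) = (\<lambda>l. c * mat_app m n A v l)"
  by (rule ext) (simp add: mat_app_def sum_distrib_left mult_ac)

lemma graded_hom_mat_app:
  assumes "\<And>p q. p < m \<Longrightarrow> q < n \<Longrightarrow> homogeneous (A p q) (s q - t p)"
  shows "graded_hom n s m t (mat_app m n A)"
  using assms
  by (simp add: graded_hom_def mat_app_in_free_module mat_app_unit_vec mat_app_add mat_app_scale)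

lemma graded_hom_compose:
  assumes f: "graded_hom n s m t f" and g: "graded_hom m t k u g"
  shows "graded_hom n s k u (\<lambda>v. g (f v))"
  unfolding graded_hom_def
proof (intro conjI allI ballI impI)
  fix q p assume q: "q < n" and p: "p < k"
  have "g (f (unit_vec q)) p = (\<Sum>l<m. f (unit_vec q) l * g (unit_vec l) p)"
    using q by (intro graded_hom_expand[OF g] graded_homD[OF f]) simp
  moreover have "homogeneous (f (unit_vec q) l * g (unit_vec l) p) (s q - u p)" if "l < m" for l
    using homogeneous_mult[OF graded_homD(4)[OF f q that] graded_homD(4)[OF g that p]] by simp
  ultimately show "homogeneous (g (f (unit_vec q)) p) (s q - u p)"
    by (auto intro: homogeneous_sum)
qed (simp_all add: graded_homD[OF f] graded_homD[OF g])

lemma graded_hom_minus: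
  assumes f: "graded_hom n s m t f" and g: "graded_hom n s m t g"
  shows "graded_hom n s m t (\<lambda>v. f v - g v)"
  using graded_homD[OF f] graded_homD[OF g]
  by (auto simp: graded_hom_def free_module_diff homogeneous_diff fun_eq_iff algebra_simps)

lemma graded_hom_id: "graded_hom n s n s (\<lambda>v. v)"
  by (auto simp: graded_hom_def unit_vec_def homogeneous_one)

lemma graded_hom_const_zero: "graded_hom n s m t (\<lambda>v. 0)"
  by (auto simp: graded_hom_def fun_eq_iff)

text \<open>This makes homogeneous preimages available, although exactness is only known for the ungraded
  modules.\<close>

lemma graded_hom_homogeneous_part:
  assumes f: "graded_hom n s m t f" and v: "v \<in> free_module n"
  shows "f (\<lambda>l. homogeneous_part (k - s l) (v l)) = (\<lambda>l. homogeneous_part (k - t l) (f v l))"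
proof
  fix p
  have w: "(\<lambda>l. homogeneous_part (k - s l) (v l)) \<in> free_module n"
    using v by (simp add: free_module_def)
  show "f (\<lambda>l. homogeneous_part (k - s l) (v l)) p = homogeneous_part (k - t p) (f v p)"
  proof (cases "p < m")
    case False
    then show ?thesis
      using graded_homD(1)[OF f v] graded_homD(1)[OF f w] by (simp add: free_module_def)
  next
    case True
    have "homogeneous_part (k - t p) (f v p)
      = (\<Sum>q<n. homogeneous_part (k - t p) (v q * f (unit_vec q) p))"
      by (simp add: graded_hom_expand[OF f v] homogeneous_part_sum)
    also have "\<dots> = (\<Sum>q<n. homogeneous_part (k - s q) (v q) * f (unit_vec q) p)"
    proof (rule sum.cong[OF refl])
      fix q assume "q \<in> {..<n}"
      then show "homogeneous_part (k - t p) (v q * f (unit_vec q) p)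
          = homogeneous_part (k - s q) (v q) * f (unit_vec q) p"
        using homogeneous_part_mult[OF graded_homD(4)[OF f, of q p], of "k - t p" "v q"] True
        by (simp add: algebra_simps)
    qed
    finally show ?thesis
      by (simp add: graded_hom_expand[OF f w])
  qed
qed

text \<open>The basis vectors have preimages, and their components of the right degree are again preimages; a
  free module maps to them linearly.\<close>

lemma graded_hom_lift:
  assumes f: "graded_hom n s m t f" and g: "graded_hom k u m t g"
    and sub: "f ` free_module n \<subseteq> g ` free_module k"
  obtains h where "graded_hom n s k u h" "\<And>v. v \<in> free_module n \<Longrightarrow> g (h v) = f v"
proof -
  have "\<exists>w\<in>free_module k. g w = f (unit_vec q) \<and> (\<forall>l<k. homogeneous (w l) (s q - u l))"
    if q: "q < n" for q
  proof -
    obtain w where w: "w \<in> free_module k" "g w = f (unit_vec q)"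
    proof -
      have "f (unit_vec q) \<in> g ` free_module k" using sub q by (intro subsetD[OF sub] imageI) simp
      then show ?thesis using that by auto
    qed
    let ?w = "\<lambda>l. homogeneous_part (s q - u l) (w l)"
    have "g ?w = (\<lambda>l. homogeneous_part (s q - t l) (f (unit_vec q) l))"
      using graded_hom_homogeneous_part[OF g w(1)] w(2) by simp
    also have "\<dots> = f (unit_vec q)"
    proof
      fix l show "homogeneous_part (s q - t l) (f (unit_vec q) l) = f (unit_vec q) l"
      proof (cases "l < m")
        case True
        then show ?thesis using graded_homD(4)[OF f q] by (simp add: homogeneous_part_of_homogeneous)
      next
        case False
        then show ?thesis using graded_homD(1)[OF f unit_vec_in_free_module[OF q]] by (simp add: free_module_def)
      qed
    qed
    finally show ?thesis
      using w(1) by (intro bexI[of _ ?w]) (auto simp: free_module_def homogeneous_homogeneous_part)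
  qed
  then obtain w where w: "\<And>q. q < n \<Longrightarrow> w q \<in> free_module k" "\<And>q. q < n \<Longrightarrow> g (w q) = f (unit_vec q)"
    "\<And>q l. q < n \<Longrightarrow> l < k \<Longrightarrow> homogeneous (w q l) (s q - u l)"
    by metis
  define h where "h = mat_app k n (\<lambda>p q. w q p)"
  have h: "graded_hom n s k u h"
    unfolding h_def by (rule graded_hom_mat_app) (simp add: w)
  have hu: "h (unit_vec q) = w q" if "q < n" for q
  proof
    fix p show "h (unit_vec q) p = w q p"
    proof (cases "p < k")
      case True
      then show ?thesis using that by (simp add: h_def mat_app_unit_vec)
    next
      case False
      then show ?thesis using w(1)[OF that] by (simp add: h_def mat_app_def free_module_def)
    qed
  qed
  have "g (h v) = f v" if "v \<in> free_module n" for v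
  proof
    fix p
    show "g (h v) p = f v p"
      using graded_hom_expand[OF graded_hom_compose[OF h g] that] graded_hom_expand[OF f that]
      by (simp add: hu w)
  qed
  then show ?thesis using h that by blast
qed


section \<open>Comparison of resolutions\<close>

text \<open>The augmented complex, with \<open>S\<close> in position \<open>0\<close> and \<open>F\<^sub>i\<close> in position \<open>i + 1\<close>; this treats the
  augmentation on the same footing as the other maps.\<close>

definition aug_rank :: "'a::field poly3 free_complex \<Rightarrow> nat \<Rightarrow> nat"
  where "aug_rank F i = (case i of 0 \<Rightarrow> 1 | Suc j \<Rightarrow> frank F j)"

definition aug_shift :: "'a::field poly3 free_complex \<Rightarrow> nat \<Rightarrow> nat \<Rightarrow> int"
  where "aug_shift F i = (case i of 0 \<Rightarrow> (\<lambda>l. 0) | Suc j \<Rightarrow> fshift F j)"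

definition aug_map :: "'a::field poly3 free_complex \<Rightarrow> nat \<Rightarrow> (nat \<Rightarrow> 'a poly3) \<Rightarrow> nat \<Rightarrow> 'a poly3"
  where "aug_map F i = (case i of 0 \<Rightarrow> mat_app 1 (frank F 0) (\<lambda>p. augm F) | Suc j \<Rightarrow> diff_map F j)"

abbreviation aug_module :: "'a::field poly3 free_complex \<Rightarrow> nat \<Rightarrow> (nat \<Rightarrow> 'a poly3) set"
  where "aug_module F i \<equiv> free_module (aug_rank F i)"

abbreviation aug_hom ::
  "'a::field poly3 free_complex \<Rightarrow> nat \<Rightarrow> 'a poly3 free_complex \<Rightarrow> nat \<Rightarrow> ((nat \<Rightarrow> 'a poly3) \<Rightarrow> nat \<Rightarrow> 'a poly3) \<Rightarrow> bool"
  where "aug_hom F i G j \<equiv> graded_hom (aug_rank F i) (aug_shift F i) (aug_rank G j) (aug_shift G j)"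

lemma aug_rank_simps [simp]: "aug_rank F 0 = 1" "aug_rank F (Suc i) = frank F i"
  by (simp_all add: aug_rank_def)

lemma aug_shift_Suc [simp]: "aug_shift F (Suc i) = fshift F i"
  by (simp add: aug_shift_def)

lemma aug_map_Suc [simp]: "aug_map F (Suc i) = diff_map F i"
  by (simp add: aug_map_def)

lemma aug_map_zero: "aug_map F 0 v = (\<lambda>p. if p < 1 then augm_map F v else 0)"
  by (auto simp: aug_map_def mat_app_def augm_map_def fun_eq_iff)

context
  fixes J :: "'a::field poly3 set" and F :: "'a poly3 free_complex"
  assumes res: "graded_free_resolution J F"
begin

lemma graded_hom_aug_map:
  "aug_hom F (Suc i) F i (aug_map F i)"
proof (cases i)
  case 0
  have "graded_hom (frank F 0) (fshift F 0) 1 (\<lambda>l. 0) (mat_app 1 (frank F 0) (\<lambda>p. augm F))"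
    using res by (intro graded_hom_mat_app) (simp add: graded_free_resolution_def)
  then show ?thesis by (simp add: 0 aug_map_def aug_shift_def)
next
  case (Suc j)
  have "graded_hom (frank F (Suc j)) (fshift F (Suc j)) (frank F j) (fshift F j) (diff_map F j)"
    unfolding diff_map_def
    using res by (intro graded_hom_mat_app) (simp add: graded_free_resolution_def)
  then show ?thesis by (simp add: Suc)
qed

lemma aug_exact:
  "{v \<in> aug_module F (Suc i). aug_map F i v = 0} = aug_map F (Suc i) ` aug_module F (Suc (Suc i))"
proof (cases i)
  case 0
  have "aug_map F 0 v = 0 \<longleftrightarrow> augm_map F v = 0" for v
    by (auto simp: aug_map_zero fun_eq_iff)
  then show ?thesis using res by (simp add: 0 graded_free_resolution_def)
next
  case (Suc j)
  then show ?thesis using res by (simp add: graded_free_resolution_def)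
qed

lemma aug_map_image: "aug_map F 0 ` aug_module F (Suc 0) = {v. v 0 \<in> J \<and> (\<forall>l\<ge>1. v l = 0)}"
proof -
  have J: "J = augm_map F ` free_module (frank F 0)"
    using res by (simp add: graded_free_resolution_def)
  show ?thesis
  proof (intro set_eqI iffI)
    fix v assume "v \<in> aug_map F 0 ` aug_module F (Suc 0)"
    then show "v \<in> {v. v 0 \<in> J \<and> (\<forall>l\<ge>1. v l = 0)}"
      by (auto simp: J aug_map_zero)
  next
    fix v :: "nat \<Rightarrow> 'a poly3" assume "v \<in> {v. v 0 \<in> J \<and> (\<forall>l\<ge>1. v l = 0)}"
    then obtain w where "w \<in> free_module (frank F 0)" "v 0 = augm_map F w" "\<forall>l\<ge>1. v l = 0"
      by (auto simp: J)
    then show "v \<in> aug_map F 0 ` aug_module F (Suc 0)"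
      by (intro image_eqI[of _ _ w]) (auto simp: aug_map_zero fun_eq_iff not_less)
  qed
qed

lemma aug_map_aug_map: "v \<in> aug_module F (Suc (Suc i)) \<Longrightarrow> aug_map F i (aug_map F (Suc i) v) = 0"
  using aug_exact[of i] by blast

lemma aug_map_mem: "v \<in> aug_module F (Suc i) \<Longrightarrow> aug_map F i v \<in> aug_module F i"
  using graded_homD(1)[OF graded_hom_aug_map] .

text \<open>The homotopy is built degree by degree: if \<open>h\<close> is known up to position \<open>i\<close>, then \<open>\<theta> - h \<partial>\<close> has cycles as
  values in position \<open>i + 1\<close>, and by exactness it lifts along \<open>\<partial>\<close>.\<close>

lemma null_homotopy:
  assumes hom: "\<And>i. aug_hom F i F i (\<theta> i)"
    and zero: "\<And>v. v \<in> aug_module F 0 \<Longrightarrow> \<theta> 0 v = 0"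
    and chain: "\<And>i v. v \<in> aug_module F (Suc i) \<Longrightarrow> aug_map F i (\<theta> (Suc i) v) = \<theta> i (aug_map F i v)"
  shows "\<exists>h.
    (\<forall>i. aug_hom F i F (Suc i) (h i)) \<and>
    (\<forall>v\<in>aug_module F 0. h 0 v = 0) \<and>
    (\<forall>i. \<forall>v\<in>aug_module F (Suc i).
      \<theta> (Suc i) v = aug_map F (Suc i) (h (Suc i) v) + h i (aug_map F i v))"
proof -
  let ?hom = "\<lambda>i. aug_hom F i F (Suc i)"
  define P where "P i g \<longleftrightarrow> ?hom i g \<and> (i = 0 \<longrightarrow> (\<forall>v\<in>aug_module F 0. g v = 0)) \<and>
    (\<forall>v\<in>aug_module F (Suc i). aug_map F i (\<theta> (Suc i) v - g (aug_map F i v)) = 0)" for i g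
  define Q where "Q i g g' \<longleftrightarrow>
    (\<forall>v\<in>aug_module F (Suc i). \<theta> (Suc i) v = aug_map F (Suc i) (g' v) + g (aug_map F i v))" for i g g'
  have "P 0 (\<lambda>v. 0)"
    using zero[OF aug_map_mem[of _ 0]]
    by (simp add: P_def graded_hom_const_zero chain del: aug_rank_simps)
  moreover have "\<exists>g'. P (Suc i) g' \<and> Q i g g'" if P: "P i g" for g i
  proof -
    have g: "?hom i g" using P by (simp add: P_def)
    let ?f = "\<lambda>v. \<theta> (Suc i) v - g (aug_map F i v)"
    have f: "aug_hom F (Suc i) F (Suc i) ?f"
      by (rule graded_hom_minus[OF hom graded_hom_compose[OF graded_hom_aug_map g]])
    have "?f ` aug_module F (Suc i) \<subseteq> aug_map F (Suc i) ` aug_module F (Suc (Suc i))"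
      using P graded_homD(1)[OF f] aug_exact[of i] by (auto simp: P_def)
    then obtain g' where g': "?hom (Suc i) g'"
      "\<And>v. v \<in> aug_module F (Suc i) \<Longrightarrow> aug_map F (Suc i) (g' v) = ?f v"
      using graded_hom_lift[OF f graded_hom_aug_map[of "Suc i"]] by metis
    have "aug_map F (Suc i) (\<theta> (Suc (Suc i)) v - g' (aug_map F (Suc i) v)) = 0"
      if v: "v \<in> aug_module F (Suc (Suc i))" for v
    proof -
      have w: "aug_map F (Suc i) v \<in> aug_module F (Suc i)" using aug_map_mem v .
      have "aug_map F (Suc i) (\<theta> (Suc (Suc i)) v - g' (aug_map F (Suc i) v))
        = aug_map F (Suc i) (\<theta> (Suc (Suc i)) v) - aug_map F (Suc i) (g' (aug_map F (Suc i) v))"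
        by (rule graded_hom_diff[OF graded_hom_aug_map graded_homD(1)[OF hom v] graded_homD(1)[OF g'(1) w]])
      also have "\<dots> = \<theta> (Suc i) (aug_map F (Suc i) v) - ?f (aug_map F (Suc i) v)"
        by (simp only: chain[OF v] g'(2)[OF w])
      also have "\<dots> = g (aug_map F i (aug_map F (Suc i) v))" by simp
      also have "\<dots> = 0"
        using aug_map_aug_map[OF v] graded_hom_zero[OF g] by simp
      finally show ?thesis .
    qed
    then show ?thesis
      using g' by (intro exI[of _ g']) (auto simp: P_def Q_def)
  qed
  ultimately obtain h where "\<And>i. P i (h i) \<and> Q i (h i) (h (Suc i))"
    using dependent_nat_choice[of P Q] by metis
  then show ?thesis
    by (intro exI[of _ h]) (simp add: P_def Q_def)
qed

end

text \<open>A lift of the identity of the resolved ideal. Since the complexes are augmented, it is required to be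
  the identity of \<open>S\<close> in position \<open>0\<close>.\<close>

definition comparison_map ::
  "'a::field poly3 free_complex \<Rightarrow> 'a poly3 free_complex \<Rightarrow> (nat \<Rightarrow> (nat \<Rightarrow> 'a poly3) \<Rightarrow> nat \<Rightarrow> 'a poly3) \<Rightarrow> bool"
  where "comparison_map F G \<phi> \<longleftrightarrow>
    (\<forall>i. aug_hom F i G i (\<phi> i)) \<and>
    (\<forall>v. \<phi> 0 v = v) \<and>
    (\<forall>i. \<forall>v\<in>aug_module F (Suc i). aug_map G i (\<phi> (Suc i) v) = \<phi> i (aug_map F i v))"

lemma comparison_mapD:
  assumes "comparison_map F G \<phi>"
  shows "aug_hom F i G i (\<phi> i)"
    and "\<phi> 0 v = v"
    and "v \<in> aug_module F (Suc i) \<Longrightarrow> aug_map G i (\<phi> (Suc i) v) = \<phi> i (aug_map F i v)"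
  using assms by (auto simp: comparison_map_def)

text \<open>Each component is a lift along the next map of the target. It exists because the previous
  component sends cycles to cycles; in position \<open>0\<close> the two images are the same ideal.\<close>

lemma comparison_map_exists:
  assumes F: "graded_free_resolution J F" and G: "graded_free_resolution J G"
  shows "\<exists>\<phi>. comparison_map F G \<phi>"
proof -
  let ?hom = "\<lambda>i. aug_hom F i G i"
  define P where "P i f \<longleftrightarrow> ?hom i f \<and> (i = 0 \<longrightarrow> (\<forall>v. f v = v)) \<and>
    (\<forall>v\<in>aug_module F (Suc i). f (aug_map F i v) \<in> aug_map G i ` aug_module G (Suc i))" for i f
  define Q where "Q i f f' \<longleftrightarrow>
    (\<forall>v\<in>aug_module F (Suc i). aug_map G i (f' v) = f (aug_map F i v))" for i f f'
  have "P 0 (\<lambda>v. v)"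
    using aug_map_image[OF F] aug_map_image[OF G]
    by (auto simp: P_def aug_shift_def intro: graded_hom_id)
  moreover have "\<exists>f'. P (Suc i) f' \<and> Q i f f'" if P: "P i f" for f i
  proof -
    have f: "?hom i f" using P by (simp add: P_def)
    have fd: "aug_hom F (Suc i) G i (\<lambda>v. f (aug_map F i v))"
      by (rule graded_hom_compose[OF graded_hom_aug_map[OF F] f])
    have "(\<lambda>v. f (aug_map F i v)) ` aug_module F (Suc i) \<subseteq> aug_map G i ` aug_module G (Suc i)"
      using P by (auto simp: P_def)
    then obtain f' where f': "?hom (Suc i) f'"
      "\<And>v. v \<in> aug_module F (Suc i) \<Longrightarrow> aug_map G i (f' v) = f (aug_map F i v)"
      using graded_hom_lift[OF fd graded_hom_aug_map[OF G]] by metis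
    have "f' (aug_map F (Suc i) v) \<in> aug_map G (Suc i) ` aug_module G (Suc (Suc i))"
      if v: "v \<in> aug_module F (Suc (Suc i))" for v
    proof -
      have w: "aug_map F (Suc i) v \<in> aug_module F (Suc i)" using aug_map_mem[OF F] v .
      have "aug_map G i (f' (aug_map F (Suc i) v)) = 0"
        using f'(2)[OF w] aug_map_aug_map[OF F v] graded_hom_zero[OF f] by simp
      then show ?thesis
        using aug_exact[OF G, of i] graded_homD(1)[OF f'(1) w] by blast
    qed
    then show ?thesis
      using f' by (intro exI[of _ f']) (auto simp: P_def Q_def)
  qed
  ultimately obtain \<phi> where "\<And>i. P i (\<phi> i) \<and> Q i (\<phi> i) (\<phi> (Suc i))"
    using dependent_nat_choice[of P Q] by metis
  then show ?thesis
    by (intro exI[of _ \<phi>]) (simp add: comparison_map_def P_def Q_def)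
qed


section \<open>Reduction modulo the irrelevant ideal\<close>

text \<open>The map \<open>f \<otimes> K\<close>, computed by lifting a vector over \<open>K\<close> to constant polynomials.\<close>

definition reduce_hom :: "((nat \<Rightarrow> 'a::comm_ring_1 poly3) \<Rightarrow> nat \<Rightarrow> 'a poly3) \<Rightarrow> (nat \<Rightarrow> 'a) \<Rightarrow> nat \<Rightarrow> 'a"
  where "reduce_hom f v = (\<lambda>l. const_coeff (f (\<lambda>j. Poly_Mapping.single 0 (v j)) l))"

lemma lift_const_in_free_module:
  "v \<in> free_module n \<Longrightarrow> (\<lambda>j. Poly_Mapping.single 0 (v j)) \<in> free_module n"
  by (simp add: free_module_def)

lemma reduce_hom_expand:
  assumes "graded_hom n s m t f" "v \<in> free_module n"
  shows "reduce_hom f v p = (\<Sum>q<n. v q * const_coeff (f (unit_vec q) p))"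
  unfolding reduce_hom_def
  by (simp add: graded_hom_expand[OF assms(1) lift_const_in_free_module[OF assms(2)]]
      const_coeff_sum const_coeff_mult)

lemma reduce_hom_in_free_module:
  assumes "graded_hom n s m t f" "v \<in> free_module n"
  shows "reduce_hom f v \<in> free_module m"
  using graded_homD(1)[OF assms(1) lift_const_in_free_module[OF assms(2)]]
  by (simp add: reduce_hom_def free_module_def)

lemma reduce_hom_add:
  assumes "graded_hom n s m t f" "v \<in> free_module n" "w \<in> free_module n"
  shows "reduce_hom f (v + w) = reduce_hom f v + reduce_hom f w"
  using assms by (auto simp: reduce_hom_expand free_module_add fun_eq_iff algebra_simps sum.distrib)

lemma reduce_hom_zero:
  assumes "graded_hom n s m t f" shows "reduce_hom f 0 = 0"
  using reduce_hom_add[OF assms, of 0 0] by simp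

text \<open>Reduction is functorial because the constant coefficient is multiplicative.\<close>

lemma reduce_hom_compose:
  assumes f: "graded_hom n s m t f" and g: "graded_hom m t k u g" and v: "v \<in> free_module n"
  shows "reduce_hom (\<lambda>v. g (f v)) v = reduce_hom g (reduce_hom f v)"
proof
  fix p
  have u: "const_coeff (g (f (unit_vec q)) p)
      = (\<Sum>l<m. const_coeff (f (unit_vec q) l) * const_coeff (g (unit_vec l) p))" if "q < n" for q
    using graded_hom_expand[OF g graded_homD(1)[OF f]] that
    by (simp add: const_coeff_sum const_coeff_mult)
  have "reduce_hom (\<lambda>v. g (f v)) v p
      = (\<Sum>q<n. \<Sum>l<m. v q * (const_coeff (f (unit_vec q) l) * const_coeff (g (unit_vec l) p)))"
    by (simp add: reduce_hom_expand[OF graded_hom_compose[OF f g] v] u sum_distrib_left)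
  also have "\<dots> = (\<Sum>l<m. \<Sum>q<n. v q * (const_coeff (f (unit_vec q) l) * const_coeff (g (unit_vec l) p)))"
    by (rule sum.swap)
  also have "\<dots> = reduce_hom g (reduce_hom f v) p"
    by (simp add: reduce_hom_expand[OF g reduce_hom_in_free_module[OF f v]] reduce_hom_expand[OF f v]
        sum_distrib_right mult.assoc)
  finally show "reduce_hom (\<lambda>v. g (f v)) v p = reduce_hom g (reduce_hom f v) p" .
qed

lemma reduce_hom_cong:
  assumes "\<And>v. v \<in> free_module n \<Longrightarrow> f v = g v" "v \<in> free_module n"
  shows "reduce_hom f v = reduce_hom g v"
  using assms(1)[OF lift_const_in_free_module[OF assms(2)]] by (simp add: reduce_hom_def)

lemma reduce_hom_plus: "reduce_hom (\<lambda>v. f v + g v) v = reduce_hom f v + reduce_hom g v"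
  by (simp add: reduce_hom_def const_coeff_add fun_eq_iff)

lemma reduce_hom_minus: "reduce_hom (\<lambda>v. f v - g v) v = reduce_hom f v - reduce_hom g v"
  by (simp add: reduce_hom_def const_coeff_diff fun_eq_iff)

lemma reduce_hom_id: "reduce_hom (\<lambda>v. v) v = v"
  by (simp add: reduce_hom_def)

text \<open>The degree-\<open>k\<close> part of the reduction of \<open>\<Oplus>\<^bsub>q < n\<^esub> S(- s q)\<close>.\<close>

definition degree_part :: "nat \<Rightarrow> (nat \<Rightarrow> int) \<Rightarrow> int \<Rightarrow> (nat \<Rightarrow> 'a::comm_ring_1) set"
  where "degree_part n s k = {v \<in> free_module n. \<forall>l. v l \<noteq> 0 \<longrightarrow> s l = k}"

lemma degree_part_subset: "v \<in> degree_part n s k \<Longrightarrow> v \<in> free_module n"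
  by (simp add: degree_part_def)

lemma degree_part_add: "v \<in> degree_part n s k \<Longrightarrow> w \<in> degree_part n s k \<Longrightarrow> v + w \<in> degree_part n s k"
proof -
  assume *: "v \<in> degree_part n s k" "w \<in> degree_part n s k"
  have "s l = k" if "(v + w) l \<noteq> 0" for l
  proof -
    have "v l \<noteq> 0 \<or> w l \<noteq> 0" using that by auto
    then show ?thesis using * by (auto simp: degree_part_def)
  qed
  then show ?thesis using * by (simp add: degree_part_def free_module_add)
qed

lemma reduce_hom_degree_part:
  assumes f: "graded_hom n s m t f" and v: "v \<in> degree_part n s k"
  shows "reduce_hom f v \<in> degree_part m t k"
proof -
  have v': "v \<in> free_module n" using v degree_part_subset by blast
  have "t l = k" if nz: "reduce_hom f v l \<noteq> 0" for l
  proof -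
    have l: "l < m"
    proof (rule ccontr)
      assume "\<not> l < m"
      then show False using reduce_hom_in_free_module[OF f v'] nz by (simp add: free_module_def)
    qed
    obtain q where q: "q < n" "v q * const_coeff (f (unit_vec q) l) \<noteq> 0"
      using sum.not_neutral_contains_not_neutral[OF nz[unfolded reduce_hom_expand[OF f v']]]
      by (metis lessThan_iff)
    then have "v q \<noteq> 0" "const_coeff (f (unit_vec q) l) \<noteq> 0" by auto
    moreover from this have "s q = k" using v by (simp add: degree_part_def)
    ultimately show ?thesis
      using const_coeff_homogeneous[OF graded_homD(4)[OF f q(1) l]] by simp
  qed
  then show ?thesis
    using reduce_hom_in_free_module[OF f v'] by (simp add: degree_part_def)
qed

lemma tensor_part_eq: "tensor_part F i k = degree_part (frank F i) (fshift F i) k"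
  by (simp add: tensor_part_def degree_part_def)

lemma tensor_map_eq: "tensor_map F i = reduce_hom (diff_map F i)"
  by (auto simp: fun_eq_iff tensor_map_def reduce_hom_def diff_map_def mat_app_def const_coeff_sum
      const_coeff_mult)


section \<open>Nonvanishing of Betti numbers\<close>

context
  fixes J :: "'a::field poly3 set" and F :: "'a poly3 free_complex"
  assumes res: "graded_free_resolution J F"
begin

lemma graded_hom_diff_map:
  "graded_hom (frank F (Suc i)) (fshift F (Suc i)) (frank F i) (fshift F i) (diff_map F i)"
  using graded_hom_aug_map[OF res, of "Suc i"] by simp

lemma tensor_map_tensor_map:
  assumes "v \<in> free_module (frank F (Suc (Suc i)))"
  shows "tensor_map F i (tensor_map F (Suc i) v) = 0"
proof -
  have "tensor_map F i (tensor_map F (Suc i) v) = reduce_hom (\<lambda>v. diff_map F i (diff_map F (Suc i) v)) v"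
    unfolding tensor_map_eq
    by (rule reduce_hom_compose[OF graded_hom_diff_map graded_hom_diff_map assms, symmetric])
  also have "\<dots> = reduce_hom (\<lambda>v. 0) v"
    by (rule reduce_hom_cong[OF _ assms]) (use aug_map_aug_map[OF res, of _ "Suc i"] in simp)
  finally show ?thesis by (simp add: reduce_hom_def fun_eq_iff)
qed

lemma tensor_boundaries_subset: "tensor_boundaries F i k \<subseteq> tensor_cycles F i k"
proof
  fix v assume "v \<in> tensor_boundaries F i k"
  then obtain w where w: "w \<in> tensor_part F (Suc i) k" "v = tensor_map F i w"
    by (auto simp: tensor_boundaries_def)
  have "v \<in> tensor_part F i k"
    using w reduce_hom_degree_part[OF graded_hom_diff_map] by (simp add: tensor_part_eq tensor_map_eq)
  moreover have "tensor_map F j v = 0" if "i = Suc j" for j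
    using w tensor_map_tensor_map that by (auto simp: tensor_part_def)
  ultimately show "v \<in> tensor_cycles F i k"
    by (auto simp: tensor_cycles_def split: nat.split)
qed

end

interpretation fun_space: vector_space "\<lambda>c (v :: nat \<Rightarrow> 'a::field) l. c * v l"
  by unfold_locales (auto simp: fun_eq_iff algebra_simps)

lemma tensor_part_subspace: "fun_space.subspace (tensor_part F i k)"
  unfolding fun_space.subspace_def tensor_part_eq
proof (intro conjI ballI allI)
  show "0 \<in> degree_part (frank F i) (fshift F i) k"
    by (simp add: degree_part_def free_module_def)
  show "v + w \<in> degree_part (frank F i) (fshift F i) k"
    if "v \<in> degree_part (frank F i) (fshift F i) k" "w \<in> degree_part (frank F i) (fshift F i) k" for v w
    using that by (rule degree_part_add)
  show "(\<lambda>l. c * v l) \<in> degree_part (frank F i) (fshift F i) k"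
    if "v \<in> degree_part (frank F i) (fshift F i) k" for c v
  proof -
    have "v l \<noteq> 0" if "c * v l \<noteq> 0" for l using that by auto
    then show ?thesis using that by (simp add: degree_part_def free_module_scale)
  qed
qed

lemma tensor_map_add: "tensor_map F i (v + w) = tensor_map F i v + tensor_map F i w"
  by (simp add: tensor_map_def mat_app_add)

lemma tensor_map_scale: "tensor_map F i (\<lambda>l. c * v l) = (\<lambda>l. c * tensor_map F i v l)"
  by (simp add: tensor_map_def mat_app_scale)

lemma tensor_map_zero: "tensor_map F i 0 = 0"
  by (simp add: tensor_map_def mat_app_def fun_eq_iff)

lemma tensor_cycles_subspace: "fun_space.subspace (tensor_cycles F i k)"
  using tensor_part_subspace[of F i k]
  by (auto simp: fun_space.subspace_def tensor_cycles_def tensor_map_add tensor_map_scale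
      tensor_map_zero[unfolded zero_fun_def] zero_fun_def split: nat.split)

lemma tensor_boundaries_subspace: "fun_space.subspace (tensor_boundaries F i k)"
proof -
  have *: "fun_space.subspace (tensor_part F (Suc i) k)" by (rule tensor_part_subspace)
  show ?thesis
    unfolding fun_space.subspace_def tensor_boundaries_def
    using * unfolding fun_space.subspace_def
    by (auto simp: image_iff tensor_map_zero simp flip: tensor_map_add tensor_map_scale)
      (metis tensor_map_zero)
qed

lemma free_module_subset_span: "free_module n \<subseteq> fun_space.span (unit_vec ` {..<n})"
proof
  fix v :: "nat \<Rightarrow> 'a" assume "v \<in> free_module n"
  then have "v = (\<Sum>q<n. (\<lambda>l. v q * unit_vec q l))" by (rule free_module_expand)
  moreover have "(\<Sum>q<n. (\<lambda>l. v q * unit_vec q l)) \<in> fun_space.span (unit_vec ` {..<n})"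
    by (intro fun_space.span_sum fun_space.span_scale fun_space.span_base) auto
  ultimately show "v \<in> fun_space.span (unit_vec ` {..<n})" by simp
qed

text \<open>A basis of the smaller space extends to one of the larger space, and both are finite.\<close>

lemma K_dim_less:
  assumes "fun_space.subspace U" "fun_space.subspace V" "U \<subset> V" "V \<subseteq> free_module n"
  shows "K_dim U < K_dim V"
proof -
  obtain B where B: "B \<subseteq> U" "fun_space.independent B" "U \<subseteq> fun_space.span B" "card B = K_dim U"
    by (rule fun_space.basis_exists)
  obtain C where C: "B \<subseteq> C" "C \<subseteq> V" "fun_space.independent C" "V \<subseteq> fun_space.span C"
    using fun_space.maximal_independent_subset_extend[of B V] B assms(3) by blast
  have "finite C"
    using fun_space.independent_span_bound[of "unit_vec ` {..<n}" C] C assms(4) free_module_subset_span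
    by blast
  moreover have "B \<noteq> C"
  proof
    assume "B = C"
    then have "V \<subseteq> fun_space.span U" using C(4) B(1) fun_space.span_mono by blast
    then show False using assms by (simp add: psubset_eq subset_antisym flip: fun_space.span_eq_iff)
  qed
  ultimately have "card B < card C" using C(1) by (intro psubset_card_mono) auto
  moreover have "K_dim V = card C"
    using C assms(2) by (intro fun_space.dim_eq_card) (metis fun_space.span_eq fun_space.span_mono fun_space.span_superset fun_space.span_subspace)+
  ultimately show ?thesis using B(4) by simp
qed

lemma betti_nonzero_iff_some:
  assumes "\<exists>F. graded_free_resolution J F"
  obtains F where "graded_free_resolution J F"
    "\<And>i k. betti J i k \<noteq> 0 \<longleftrightarrow> \<not> tensor_cycles F i k \<subseteq> tensor_boundaries F i k"
proof
  let ?F = "SOME F. graded_free_resolution J F"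
  show res: "graded_free_resolution J ?F" using assms by (rule someI_ex)
  fix i k
  have sub: "tensor_boundaries ?F i k \<subseteq> tensor_cycles ?F i k"
    by (rule tensor_boundaries_subset[OF res])
  show "betti J i k \<noteq> 0 \<longleftrightarrow> \<not> tensor_cycles ?F i k \<subseteq> tensor_boundaries ?F i k"
  proof
    assume "betti J i k \<noteq> 0"
    then show "\<not> tensor_cycles ?F i k \<subseteq> tensor_boundaries ?F i k"
      using sub by (auto simp: betti_def Let_def dest!: subset_antisym[OF sub])
  next
    assume "\<not> tensor_cycles ?F i k \<subseteq> tensor_boundaries ?F i k"
    then have "tensor_boundaries ?F i k \<subset> tensor_cycles ?F i k" using sub by blast
    then have "K_dim (tensor_boundaries ?F i k) < K_dim (tensor_cycles ?F i k)"
      by (rule K_dim_less[OF tensor_boundaries_subspace tensor_cycles_subspace])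
        (auto simp: tensor_cycles_def tensor_part_def)
    then show "betti J i k \<noteq> 0" by (simp add: betti_def Let_def)
  qed
qed

text \<open>Let \<open>\<phi>\<close> and \<open>\<psi>\<close> be comparison maps in the two directions. For a cycle \<open>z\<close> of \<open>F \<otimes> K\<close> the difference of \<open>z\<close>
  and \<open>\<psi> (\<phi> z)\<close> is a boundary, by the homotopy between \<open>\<psi> \<phi>\<close> and the identity. So if \<open>\<phi> z\<close> is a boundary,
  then \<open>z\<close> is one.\<close>

lemma nonboundary_transfer:
  assumes F: "graded_free_resolution J F" and G: "graded_free_resolution J G"
    and "\<not> tensor_cycles F i k \<subseteq> tensor_boundaries F i k"
  shows "\<not> tensor_cycles G i k \<subseteq> tensor_boundaries G i k"
proof
  assume G_bd: "tensor_cycles G i k \<subseteq> tensor_boundaries G i k"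
  obtain z where z: "z \<in> tensor_cycles F i k" "z \<notin> tensor_boundaries F i k" using assms(3) by blast
  obtain \<phi> where "comparison_map F G \<phi>" using comparison_map_exists[OF F G] by blast
  note \<phi> = comparison_mapD[OF this]
  obtain \<psi> where "comparison_map G F \<psi>" using comparison_map_exists[OF G F] by blast
  note \<psi> = comparison_mapD[OF this]
  define \<theta> where "\<theta> i v = v - \<psi> i (\<phi> i v)" for i v
  have \<psi>\<phi>: "aug_hom F i F i (\<lambda>v. \<psi> i (\<phi> i v))" for i
    by (rule graded_hom_compose[OF \<phi>(1) \<psi>(1)])
  have \<theta>_hom: "aug_hom F i F i (\<theta> i)" for i
    unfolding \<theta>_def by (rule graded_hom_minus[OF graded_hom_id \<psi>\<phi>])
  have \<theta>_chain: "aug_map F i (\<theta> (Suc i) v) = \<theta> i (aug_map F i v)" if v: "v \<in> aug_module F (Suc i)" for i v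
    unfolding \<theta>_def
    using graded_hom_diff[OF graded_hom_aug_map[OF F] v graded_homD(1)[OF \<psi>\<phi> v]]
      \<psi>(3)[OF graded_homD(1)[OF \<phi>(1) v]] \<phi>(3)[OF v] by simp
  have \<theta>_zero: "\<theta> 0 v = 0" for v
    by (simp add: \<theta>_def \<phi> \<psi> fun_eq_iff)
  obtain h where h: "\<And>i. aug_hom F i F (Suc i) (h i)"
    "\<And>v. v \<in> aug_module F 0 \<Longrightarrow> h 0 v = 0"
    "\<And>i v. v \<in> aug_module F (Suc i) \<Longrightarrow>
      \<theta> (Suc i) v = aug_map F (Suc i) (h (Suc i) v) + h i (aug_map F i v)"
    using null_homotopy[OF F \<theta>_hom \<theta>_zero \<theta>_chain] by blast
  have zp: "z \<in> degree_part (frank F i) (fshift F i) k"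
    using z by (simp add: tensor_cycles_def tensor_part_eq)
  then have zf: "z \<in> free_module (frank F i)" by (rule degree_part_subset)
  note hom_F = graded_hom_aug_map[OF F] and hom_G = graded_hom_aug_map[OF G]
  have "reduce_hom (\<phi> (Suc i)) z \<in> tensor_cycles G i k"
  proof -
    have "tensor_map G j (reduce_hom (\<phi> (Suc i)) z) = 0" if i: "i = Suc j" for j
    proof -
      have zf': "z \<in> free_module (aug_rank F (Suc i))" using zf by simp
      have "tensor_map G j (reduce_hom (\<phi> (Suc i)) z) = reduce_hom (\<lambda>v. aug_map G i (\<phi> (Suc i) v)) z"
        using reduce_hom_compose[OF \<phi>(1) hom_G zf'] by (simp add: tensor_map_eq i)
      also have "\<dots> = reduce_hom (\<lambda>v. \<phi> i (aug_map F i v)) z"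
        by (rule reduce_hom_cong[OF \<phi>(3) zf'])
      also have "\<dots> = reduce_hom (\<phi> i) (reduce_hom (aug_map F i) z)"
        by (rule reduce_hom_compose[OF hom_F \<phi>(1) zf'])
      also have "reduce_hom (aug_map F i) z = 0"
        using z by (simp add: i tensor_cycles_def tensor_map_eq)
      finally show ?thesis by (simp only: reduce_hom_zero[OF \<phi>(1)])
    qed
    moreover have "reduce_hom (\<phi> (Suc i)) z \<in> tensor_part G i k"
      using reduce_hom_degree_part[OF \<phi>(1)[of "Suc i"]] zp by (simp add: tensor_part_eq)
    ultimately show ?thesis by (auto simp: tensor_cycles_def split: nat.split)
  qed
  then obtain w where w: "w \<in> degree_part (frank G (Suc i)) (fshift G (Suc i)) k"
    "reduce_hom (\<phi> (Suc i)) z = tensor_map G i w"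
    using G_bd by (auto simp: tensor_boundaries_def tensor_part_eq)
  let ?w' = "reduce_hom (\<psi> (Suc (Suc i))) w" and ?h = "reduce_hom (h (Suc i)) z"
  have w': "?w' \<in> degree_part (frank F (Suc i)) (fshift F (Suc i)) k"
    using reduce_hom_degree_part[OF \<psi>(1)[of "Suc (Suc i)"]] w(1) by simp
  have h': "?h \<in> degree_part (frank F (Suc i)) (fshift F (Suc i)) k"
    using reduce_hom_degree_part[OF h(1)[of "Suc i"]] zp by simp
  have zf: "z \<in> free_module (aug_rank F (Suc i))" using zf by simp
  have wf: "w \<in> free_module (aug_rank G (Suc (Suc i)))" using degree_part_subset[OF w(1)] by simp
  have "reduce_hom (\<lambda>v. \<psi> (Suc i) (\<phi> (Suc i) v)) z = reduce_hom (\<psi> (Suc i)) (reduce_hom (aug_map G (Suc i)) w)"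
    using reduce_hom_compose[OF \<phi>(1) \<psi>(1) zf] w(2) by (simp add: tensor_map_eq)
  also have "\<dots> = reduce_hom (\<lambda>v. \<psi> (Suc i) (aug_map G (Suc i) v)) w"
    by (rule reduce_hom_compose[OF hom_G \<psi>(1) wf, symmetric])
  also have "\<dots> = reduce_hom (\<lambda>v. aug_map F (Suc i) (\<psi> (Suc (Suc i)) v)) w"
    by (rule reduce_hom_cong[OF \<psi>(3)[symmetric] wf])
  also have "\<dots> = tensor_map F i ?w'"
    using reduce_hom_compose[OF \<psi>(1) hom_F wf] by (simp add: tensor_map_eq)
  finally have 1: "reduce_hom (\<lambda>v. \<psi> (Suc i) (\<phi> (Suc i) v)) z = tensor_map F i ?w'" .
  \<comment> \<open>For \<open>i = 0\<close> the summand of the homotopy that passes through \<open>S\<close> is zero as a map; for positive \<open>i\<close> it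
      vanishes at \<open>z\<close> because \<open>z\<close> is a cycle.\<close>
  have 2: "reduce_hom (\<lambda>v. h i (aug_map F i v)) z = 0"
  proof (cases i)
    case 0
    have "reduce_hom (\<lambda>v. h i (aug_map F i v)) z = reduce_hom (\<lambda>v. 0) z"
      using h(2) aug_map_mem[OF F, of _ 0] by (intro reduce_hom_cong[OF _ zf]) (simp add: 0)
    then show ?thesis by (simp add: reduce_hom_def fun_eq_iff)
  next
    case (Suc j)
    have "reduce_hom (\<lambda>v. h i (aug_map F i v)) z = reduce_hom (h i) (reduce_hom (aug_map F i) z)"
      by (rule reduce_hom_compose[OF hom_F h(1) zf])
    also have "reduce_hom (aug_map F i) z = 0"
      using z by (simp add: Suc tensor_cycles_def tensor_map_eq)
    finally show ?thesis by (simp only: reduce_hom_zero[OF h(1)])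
  qed
  have "\<theta> (Suc i) = (\<lambda>v. v - \<psi> (Suc i) (\<phi> (Suc i) v))"
    by (intro ext) (simp add: \<theta>_def)
  then have "z - tensor_map F i ?w' = reduce_hom (\<theta> (Suc i)) z"
    using reduce_hom_minus[of "\<lambda>v. v" "\<lambda>v. \<psi> (Suc i) (\<phi> (Suc i) v)" z]
    by (simp only: reduce_hom_id 1)
  also have "\<dots> = reduce_hom (\<lambda>v. aug_map F (Suc i) (h (Suc i) v) + h i (aug_map F i v)) z"
    by (rule reduce_hom_cong[OF h(3) zf])
  also have "\<dots> = tensor_map F i ?h"
    using reduce_hom_compose[OF h(1) hom_F zf]
    by (simp only: reduce_hom_plus 2 tensor_map_eq aug_map_Suc add_0_right)
  finally have "z = tensor_map F i (?w' + ?h)"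
    by (simp only: tensor_map_add diff_eq_eq add.commute)
  then show False
    using z(2) degree_part_add[OF w' h'] by (auto simp: tensor_boundaries_def tensor_part_eq)
qed

text \<open>For a minimal resolution, where no entry of a matrix is a unit, the maps of \<open>F \<otimes> K\<close> vanish and
  the nonzero Betti numbers can be read off from the degrees of the bases.\<close>

lemma betti_nonzero_iff_minimal:
  assumes G: "graded_free_resolution J G"
    and min: "\<And>i p q. p < frank G i \<Longrightarrow> q < frank G (Suc i) \<Longrightarrow> const_coeff (diff G i p q) = 0"
  shows "betti J i k \<noteq> 0 \<longleftrightarrow> (\<exists>l<frank G i. fshift G i l = k)"
proof -
  obtain F where F: "graded_free_resolution J F"
    "\<And>i k. betti J i k \<noteq> 0 \<longleftrightarrow> \<not> tensor_cycles F i k \<subseteq> tensor_boundaries F i k"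
    using betti_nonzero_iff_some G by metis
  have "betti J i k \<noteq> 0 \<longleftrightarrow> \<not> tensor_cycles G i k \<subseteq> tensor_boundaries G i k"
    unfolding F(2) using nonboundary_transfer[OF F(1) G] nonboundary_transfer[OF G F(1)] by blast
  moreover have tm: "tensor_map G i = (\<lambda>v. 0)" for i
    by (auto simp: tensor_map_def mat_app_def fun_eq_iff min)
  have "tensor_cycles G i k = tensor_part G i k"
    by (cases i) (auto simp: tensor_cycles_def tm)
  moreover have "tensor_boundaries G i k = {0}"
    by (auto simp: tensor_boundaries_def tm tensor_part_def image_iff intro!: exI[of _ 0])
  moreover have "tensor_part G i k \<subseteq> {0} \<longleftrightarrow> \<not> (\<exists>l<frank G i. fshift G i l = k)"
  proof
    assume L: "tensor_part G i k \<subseteq> {0}"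
    show "\<not> (\<exists>l<frank G i. fshift G i l = k)"
    proof
      assume "\<exists>l<frank G i. fshift G i l = k"
      then obtain l where "l < frank G i" "fshift G i l = k" by blast
      then have "unit_vec l \<in> tensor_part G i k"
        by (simp add: tensor_part_def) (simp add: unit_vec_def)
      then have "unit_vec l = (0 :: nat \<Rightarrow> 'a)" using L by blast
      then show False by (metis unit_vec_def zero_fun_apply zero_neq_one)
    qed
  next
    assume R: "\<not> (\<exists>l<frank G i. fshift G i l = k)"
    show "tensor_part G i k \<subseteq> {0}"
      using R by (auto simp: tensor_part_def free_module_def fun_eq_iff) (metis not_le)
  qed
  ultimately show ?thesis by simp
qed

text \<open>The finite length makes the set of differences finite, so its maximum is meaningful.\<close>

lemma regularity_minimal:
  assumes G: "graded_free_resolution J G"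
    and min: "\<And>i p q. p < frank G i \<Longrightarrow> q < frank G (Suc i) \<Longrightarrow> const_coeff (diff G i p q) = 0"
    and len: "\<And>i. i \<ge> n \<Longrightarrow> frank G i = 0"
    and le: "\<And>i l. l < frank G i \<Longrightarrow> fshift G i l - int i \<le> N"
    and eq: "\<exists>i l. l < frank G i \<and> fshift G i l - int i = N"
  shows "regularity J = N"
proof -
  have "betti J i k \<noteq> 0 \<longleftrightarrow> (\<exists>l<frank G i. fshift G i l = k)" for i k
    by (rule betti_nonzero_iff_minimal[OF G min])
  then have set_eq: "{k - int i | i k. betti J i k \<noteq> 0} = {fshift G i l - int i | i l. l < frank G i}"
    by (simp only:) blast
  have "{fshift G i l - int i | i l. l < frank G i} \<subseteq>
      (\<Union>i<n. (\<lambda>l. fshift G i l - int i) ` {..<frank G i})"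
    using len by (fastforce simp: not_less[symmetric])
  then have "finite {fshift G i l - int i | i l. l < frank G i}"
    by (rule finite_subset) auto
  then show ?thesis
    unfolding regularity_def set_eq
    using le eq by (intro Max_eqI) auto
qed


section \<open>The conic and its parametrisation\<close>

abbreviation conic :: "'a::comm_ring_1 poly3"
  where "conic \<equiv> X 1 ^ 2 - X 0 * X 2"

text \<open>The affine cone over the conic is parametrised by \<open>(u, u t, u t\<^sup>2)\<close>. The coordinate ring of the
  parameter plane is \<open>K[t][u]\<close>, so the degree in \<open>u\<close> is the degree in \<open>S\<close>.\<close>

definition cone_point :: "3 \<Rightarrow> 'a::comm_ring_1 poly poly"
  where "cone_point i = (if i = 0 then [:0, 1:] else if i = 1 then [:0, [:0, 1:]:] else [:0, [:0, 0, 1:]:])"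

abbreviation param :: "'a::comm_ring_1 poly3 \<Rightarrow> 'a poly poly"
  where "param \<equiv> subst_poly (\<lambda>a. [:[:a:]:]) cone_point"

interpretation param: substitution "\<lambda>a. [:[:a:]:]" "cone_point :: 3 \<Rightarrow> 'a::comm_ring_1 poly poly"
  by unfold_locales (simp_all flip: one_pCons)

abbreviation param_t :: "'a::comm_ring_1 poly poly"
  where "param_t \<equiv> [:[:0, 1:]:]"

lemma cone_point_simps [simp]:
  "cone_point 0 = [:0, 1:]" "cone_point 1 = [:0, [:0, 1:]:]" "cone_point 2 = [:0, [:0, 0, 1:]:]"
  by (simp_all add: cone_point_def)

lemma param_X_one: "param (X 1 :: 'a::comm_ring_1 poly3) = param_t * param (X 0)"
  and param_X_two: "param (X 2 :: 'a::comm_ring_1 poly3) = param_t * param (X 1)"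
  by (simp_all add: param.subst_X)

lemma param_conic: "param (conic :: 'a::comm_ring_1 poly3) = 0"
  by (simp add: param.subst_simps power2_eq_square)

text \<open>The exponent of \<open>t\<close> in the image of a monomial; the exponent of \<open>u\<close> is the degree.\<close>

definition param_weight :: "(3 \<Rightarrow>\<^sub>0 nat) \<Rightarrow> nat"
  where "param_weight m = Poly_Mapping.lookup m 1 + 2 * Poly_Mapping.lookup m 2"

lemma mon_degree_eq: "mon_degree m = Poly_Mapping.lookup m 0 + Poly_Mapping.lookup m 1 + Poly_Mapping.lookup m 2"
  by (simp only: mon_degree_def sum_UNIV_three)

lemma param_single:
  "param (Poly_Mapping.single m a) = monom (monom a (param_weight m)) (mon_degree m)"
proof -
  have mm: "[:0, monom b k:] ^ n = monom (monom (b ^ n) (k * n)) n" for b :: 'a and k n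
  proof -
    have "[:0, monom b k:] = monom (monom b k) 1" by (simp add: monom_altdef)
    then show ?thesis by (simp add: monom_power)
  qed
  have "cone_point 0 = [:0, monom (1::'a) 0:]" "cone_point 1 = [:0, monom (1::'a) 1:]" "cone_point 2 = [:0, monom (1::'a) 2:]"
    by (simp_all add: monom_altdef numeral_2_eq_2)
  then have pow: "cone_point 0 ^ n = monom (monom (1::'a) 0) n" "cone_point 1 ^ n = monom (monom (1::'a) n) n"
    "cone_point 2 ^ n = monom (monom (1::'a) (2 * n)) n" for n
    by (simp_all only: mm power_one mult_0 mult_1)
  have "param (Poly_Mapping.single m a) = monom (monom a 0) 0 * (monom (monom 1 0) (Poly_Mapping.lookup m 0)
      * monom (monom 1 (Poly_Mapping.lookup m 1)) (Poly_Mapping.lookup m 1)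
      * monom (monom 1 (2 * Poly_Mapping.lookup m 2)) (Poly_Mapping.lookup m 2))"
    by (simp only: param.subst_single prod_UNIV_three pow monom_0)
  also have "\<dots> = monom (monom a (param_weight m)) (mon_degree m)"
    by (simp add: mult_monom param_weight_def mon_degree_eq)
  finally show ?thesis .
qed

lemma coeff_param:
  "coeff (coeff (param f) n) e =
    (\<Sum>m\<in>Poly_Mapping.keys f. if mon_degree m = n \<and> param_weight m = e then Poly_Mapping.lookup f m else 0)"
proof -
  have "param f = (\<Sum>m\<in>Poly_Mapping.keys f. monom (monom (Poly_Mapping.lookup f m) (param_weight m)) (mon_degree m))"
    by (subst poly_mapping_eq_sum_single) (simp add: param.subst_sum param_single)
  then show ?thesis
    by (auto simp: coeff_sum intro!: sum.cong)
qed

text \<open>Replacing \<open>x\<^sub>1\<^sup>2\<close> by \<open>x\<^sub>0x\<^sub>2\<close> repeatedly terminates, as it lowers the exponent of \<open>x\<^sub>1\<close>.\<close>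

lemma conic_normal_form:
  fixes f :: "'a::comm_ring_1 poly3"
  shows "\<exists>g h. f = g + h * conic \<and> (\<forall>m\<in>Poly_Mapping.keys g. Poly_Mapping.lookup m 1 \<le> 1)"
proof (induction f rule: poly_mapping_additive_induct)
  case zero
  then show ?case by (intro exI[of _ 0]) simp
next
  case (add f1 f2)
  then obtain g1 h1 g2 h2 where f: "f1 = g1 + h1 * conic" "f2 = g2 + h2 * conic"
    and *: "\<forall>m\<in>Poly_Mapping.keys g1. Poly_Mapping.lookup m 1 \<le> 1" "\<forall>m\<in>Poly_Mapping.keys g2. Poly_Mapping.lookup m 1 \<le> 1"
    by blast
  have "f1 + f2 = (g1 + g2) + (h1 + h2) * conic" unfolding f by (simp add: algebra_simps)
  then show ?case using * keys_add[of g1 g2] by blast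
next
  case (single m c)
  have "\<exists>g h. Poly_Mapping.single 0 c * (X 0 ^ a * X 1 ^ b * X 2 ^ e :: 'a poly3) = g + h * conic
      \<and> (\<forall>m\<in>Poly_Mapping.keys g. Poly_Mapping.lookup m 1 \<le> 1)" for a b e
  proof (induction b arbitrary: a e rule: less_induct)
    case (less b)
    show ?case
    proof (cases "b \<le> 1")
      case True
      have "Poly_Mapping.single 0 c * (X 0 ^ a * X 1 ^ b * X 2 ^ e :: 'a poly3)
        = Poly_Mapping.single (Poly_Mapping.single 0 a + Poly_Mapping.single 1 b + Poly_Mapping.single 2 e) c"
        unfolding X_power_eq_single mult_single by simp
      then show ?thesis
        using True by (intro exI[of _ "Poly_Mapping.single 0 c * (X 0 ^ a * X 1 ^ b * X 2 ^ e :: 'a poly3)"] exI[of _ 0])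
          (auto simp: lookup_add lookup_single when_def)
    next
      case False
      then obtain b' where b: "b = Suc (Suc b')" by (metis One_nat_def Suc_le_mono le0 nat.exhaust)
      obtain g h where gh: "Poly_Mapping.single 0 c * (X 0 ^ Suc a * X 1 ^ b' * X 2 ^ Suc e :: 'a poly3) = g + h * conic"
        "\<forall>m\<in>Poly_Mapping.keys g. Poly_Mapping.lookup m 1 \<le> 1"
        using less[of b' "Suc a" "Suc e"] b by auto
      have "Poly_Mapping.single 0 c * (X 0 ^ a * X 1 ^ b * X 2 ^ e :: 'a poly3)
        = Poly_Mapping.single 0 c * (X 0 ^ Suc a * X 1 ^ b' * X 2 ^ Suc e)
          + Poly_Mapping.single 0 c * (X 0 ^ a * X 1 ^ b' * X 2 ^ e) * conic"
        by (simp add: b algebra_simps power2_eq_square)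
      also have "\<dots> = g + (h + Poly_Mapping.single 0 c * (X 0 ^ a * X 1 ^ b' * X 2 ^ e)) * conic"
        unfolding gh by (simp add: algebra_simps)
      finally show ?thesis using gh(2) by blast
    qed
  qed
  then show ?case unfolding monomial_single_eq_product[of m c] .
qed

text \<open>The monomials that are at most linear in \<open>x\<^sub>1\<close> have distinct images, so a normal form with image zero is zero.
  Since \<open>K[t][u]\<close> is a domain, it follows that the conic is prime.\<close>

lemma param_eq_zero_iff: "param f = 0 \<longleftrightarrow> conic dvd (f :: 'a::idom poly3)"
proof
  assume "conic dvd f"
  then show "param f = 0"
    by (auto simp: dvd_def param.subst_mult param_conic)
next
  assume f: "param f = 0"
  obtain g h where gh: "f = g + h * conic" "\<forall>m\<in>Poly_Mapping.keys g. Poly_Mapping.lookup m 1 \<le> 1"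
    using conic_normal_form by blast
  have g: "param g = 0"
    using f by (simp add: gh(1) param.subst_add param.subst_mult param_conic)
  have "Poly_Mapping.lookup g m = 0" for m
  proof (cases "m \<in> Poly_Mapping.keys g")
    case True
    have "m' = m" if "m' \<in> Poly_Mapping.keys g" "mon_degree m' = mon_degree m" "param_weight m' = param_weight m" for m'
    proof (rule poly_mapping_eqI)
      fix i
      have "Poly_Mapping.lookup m' 1 \<le> 1" "Poly_Mapping.lookup m 1 \<le> 1" using gh(2) that True by auto
      then have "Poly_Mapping.lookup m' 1 = Poly_Mapping.lookup m 1" "Poly_Mapping.lookup m' 2 = Poly_Mapping.lookup m 2"
        using that(3) unfolding param_weight_def by presburger+
      then show "Poly_Mapping.lookup m' i = Poly_Mapping.lookup m i"
        using that(2) three_cases[of i] unfolding mon_degree_eq by auto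
    qed
    then have "(\<Sum>m'\<in>Poly_Mapping.keys g. if mon_degree m' = mon_degree m \<and> param_weight m' = param_weight m
        then Poly_Mapping.lookup g m' else 0) = (\<Sum>m'\<in>Poly_Mapping.keys g. if m' = m then Poly_Mapping.lookup g m' else 0)"
      by (intro sum.cong) auto
    also have "\<dots> = Poly_Mapping.lookup g m"
      using True by simp
    finally show ?thesis
      using coeff_param[of g "mon_degree m" "param_weight m"] g by simp
  qed (simp add: in_keys_iff)
  then have "g = 0" by (intro poly_mapping_eqI) simp
  then show "conic dvd f" using gh(1) by simp
qed

lemma homogeneous_conic: "homogeneous (conic :: 'a::comm_ring_1 poly3) 2"
  using homogeneous_power[OF homogeneous_X, of 1 2] homogeneous_mult[OF homogeneous_X homogeneous_X, of 0 2]
  by (intro homogeneous_diff) simp_all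

lemma conic_nonzero: "(conic :: 'a::comm_ring_1 poly3) \<noteq> 0"
proof
  assume *: "(conic :: 'a poly3) = 0"
  let ?m = "Poly_Mapping.single 1 2 :: 3 \<Rightarrow>\<^sub>0 nat"
  have "(conic :: 'a poly3) = Poly_Mapping.single ?m 1
      - Poly_Mapping.single (Poly_Mapping.single 0 1 + Poly_Mapping.single 2 1) 1"
    by (simp add: X_def power2_eq_square mult_single numeral_2_eq_2 flip: single_add)
  moreover have "Poly_Mapping.single 0 1 + Poly_Mapping.single 2 1 \<noteq> ?m"
  proof
    assume "Poly_Mapping.single 0 1 + Poly_Mapping.single 2 1 = ?m"
    then have "Poly_Mapping.lookup (Poly_Mapping.single 0 1 + Poly_Mapping.single (2::3) 1) 0 = Poly_Mapping.lookup ?m 0"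
      by simp
    then show False by (simp add: lookup_add lookup_single when_def)
  qed
  ultimately have "Poly_Mapping.lookup (conic :: 'a poly3) ?m = 1"
    by (simp add: lookup_minus lookup_single when_def)
  then show False by (simp add: *)
qed

text \<open>Among the monomials, exactly the powers of \<open>x\<^sub>0\<close> have an image not divisible by \<open>t\<close>, and these
  images are distinct powers of \<open>u\<close>. So divisibility by \<open>t\<close> rules them out.\<close>

lemma mem_ideal_of_origin:
  fixes f :: "'a::comm_ring_1 poly3"
  assumes "\<And>n. coeff (coeff (param f) n) 0 = 0"
  shows "\<exists>a b. f = X 1 * a + X 2 * b"
proof -
  have key: "Poly_Mapping.lookup m 1 \<noteq> 0 \<or> Poly_Mapping.lookup m 2 \<noteq> 0" if m: "m \<in> Poly_Mapping.keys f" for m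
  proof (rule ccontr)
    assume "\<not> ?thesis"
    then have m0: "Poly_Mapping.lookup m 1 = 0" "Poly_Mapping.lookup m 2 = 0" by auto
    have uniq: "m' = m" if "mon_degree m' = mon_degree m" "param_weight m' = 0" for m'
    proof (rule poly_mapping_eqI)
      fix i show "Poly_Mapping.lookup m' i = Poly_Mapping.lookup m i"
        using that m0 three_cases[of i] unfolding mon_degree_eq param_weight_def by auto
    qed
    have "param_weight m = 0" by (simp add: param_weight_def m0)
    then have "(\<Sum>m'\<in>Poly_Mapping.keys f. if mon_degree m' = mon_degree m \<and> param_weight m' = 0
        then Poly_Mapping.lookup f m' else 0) = (\<Sum>m'\<in>Poly_Mapping.keys f. if m' = m then Poly_Mapping.lookup f m' else 0)"
      using uniq by (intro sum.cong) auto
    then show False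
      using assms[of "mon_degree m"] m unfolding coeff_param by (simp add: in_keys_iff)
  qed
  have single: "\<exists>a b. Poly_Mapping.single m c = X 1 * a + X 2 * (b :: 'a poly3)"
    if nz: "Poly_Mapping.lookup m 1 \<noteq> 0 \<or> Poly_Mapping.lookup m 2 \<noteq> 0" for m c
  proof (cases "Poly_Mapping.lookup m 1")
    case (Suc n)
    show ?thesis
      unfolding monomial_single_eq_product[of m c] Suc
      by (rule exI[of _ "Poly_Mapping.single 0 c * (X 0 ^ Poly_Mapping.lookup m 0 * X 1 ^ n * X 2 ^ Poly_Mapping.lookup m 2)"],
          rule exI[of _ 0]) (simp add: algebra_simps)
  next
    case 0
    then obtain n where n: "Poly_Mapping.lookup m 2 = Suc n" using nz not0_implies_Suc by auto
    show ?thesis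
      unfolding monomial_single_eq_product[of m c] n
      by (rule exI[of _ 0],
          rule exI[of _ "Poly_Mapping.single 0 c * (X 0 ^ Poly_Mapping.lookup m 0 * X 1 ^ Poly_Mapping.lookup m 1 * X 2 ^ n)"])
        (simp add: algebra_simps)
  qed
  have "\<exists>a b. (\<Sum>m\<in>M. Poly_Mapping.single m (Poly_Mapping.lookup f m)) = X 1 * a + X 2 * b"
    if "finite M" "M \<subseteq> Poly_Mapping.keys f" for M
    using that
  proof (induction M)
    case empty
    show ?case by (rule exI[of _ 0], rule exI[of _ 0]) simp
  next
    case (insert m M)
    obtain a b a' b' where "(\<Sum>m\<in>M. Poly_Mapping.single m (Poly_Mapping.lookup f m)) = X 1 * a + X 2 * b"
      "Poly_Mapping.single m (Poly_Mapping.lookup f m) = X 1 * a' + X 2 * b'"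
      using insert single[OF key[of m], of "Poly_Mapping.lookup f m"] by auto
    then have "(\<Sum>m\<in>insert m M. Poly_Mapping.single m (Poly_Mapping.lookup f m)) = X 1 * (a' + a) + X 2 * (b' + b)"
      using insert(1,2) by (simp add: algebra_simps)
    then show ?case by blast
  qed
  from this[OF finite_keys order_refl] show ?thesis
    by (simp only: poly_mapping_eq_sum_single[symmetric])
qed

text \<open>Substituting \<open>x\<^sub>2 = 0\<close> kills the right-hand side, and a polynomial is divisible by \<open>x\<^sub>2\<close> when it vanishes
  under this substitution.\<close>

lemma X_two_dvd_of_mult_X_one:
  fixes f :: "'a::idom poly3"
  assumes "X 1 * f = X 2 * g"
  shows "X 2 dvd f"
proof -
  let ?v = "\<lambda>i::3. if i = 2 then 0 else X i :: 'a poly3"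
  interpret kill: substitution "Poly_Mapping.single 0" ?v
    by unfold_locales (simp_all add: single_add mult_single)
  have dvd: "X 2 dvd h - subst_poly (Poly_Mapping.single 0) ?v h" for h :: "'a poly3"
  proof (induction h rule: poly_mapping_additive_induct)
    case (single m c)
    have s: "subst_poly (Poly_Mapping.single 0) ?v (Poly_Mapping.single m c) = Poly_Mapping.single 0 c
        * (X 0 ^ Poly_Mapping.lookup m 0 * X 1 ^ Poly_Mapping.lookup m 1 * 0 ^ Poly_Mapping.lookup m 2)"
      by (simp add: kill.subst_single prod_UNIV_three)
    show ?case
    proof (cases "Poly_Mapping.lookup m 2")
      case 0
      then show ?thesis unfolding s unfolding monomial_single_eq_product[of m c] by simp
    next
      case (Suc n)
      then show ?thesis unfolding s unfolding monomial_single_eq_product[of m c] by simp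
    qed
  next
    case (add h1 h2)
    then have "X 2 dvd (h1 - subst_poly (Poly_Mapping.single 0) ?v h1) + (h2 - subst_poly (Poly_Mapping.single 0) ?v h2)"
      by (rule dvd_add)
    then show ?case by (simp add: kill.subst_add algebra_simps)
  qed (simp add: kill.subst_zero)
  have "subst_poly (Poly_Mapping.single 0) ?v (X 1 * f) = subst_poly (Poly_Mapping.single 0) ?v (X 2 * g)"
    by (simp add: assms)
  then have "X 1 * subst_poly (Poly_Mapping.single 0) ?v f = 0"
    by (simp add: kill.subst_mult kill.subst_X)
  moreover have "(X 1 :: 'a poly3) \<noteq> 0"
    by (simp add: X_def flip: keys_eq_empty)
  ultimately show ?thesis using dvd[of f] by simp
qed


section \<open>Homogenised evaluation\<close>

text \<open>\<open>eval_form g h r a\<close> is the value at \<open>(g, h)\<close> of the form of degree \<open>r\<close> that has the dehomogenisation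
  \<open>a\<close>; it is meant for polynomials of degree at most \<open>r\<close>.\<close>

definition eval_form :: "'r::comm_ring_1 \<Rightarrow> 'r \<Rightarrow> nat \<Rightarrow> 'r poly \<Rightarrow> 'r"
  where "eval_form g h r a = (\<Sum>l\<le>r. coeff a l * g ^ (r - l) * h ^ l)"

definition poly_bounded :: "nat \<Rightarrow> 'r::zero poly \<Rightarrow> bool"
  where "poly_bounded n a \<longleftrightarrow> (\<forall>l\<ge>n. coeff a l = 0)"

lemma poly_bounded_zero [simp]: "poly_bounded n 0"
  by (simp add: poly_bounded_def)

lemma poly_bounded_pCons: "poly_bounded n (pCons c a) \<longleftrightarrow> (n = 0 \<longrightarrow> c = 0) \<and> poly_bounded (n - 1) a"
proof -
  have "(\<forall>l\<ge>n. coeff (pCons c a) l = 0) \<longleftrightarrow> (n \<le> 0 \<longrightarrow> c = 0) \<and> (\<forall>l. n \<le> Suc l \<longrightarrow> coeff a l = 0)"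
    by (auto simp: coeff_pCons split: nat.split)
  then show ?thesis by (auto simp: poly_bounded_def)
qed

lemma poly_bounded_0_iff [simp]: "poly_bounded 0 a \<longleftrightarrow> a = 0"
  by (auto simp: poly_bounded_def poly_eq_iff)

lemma poly_bounded_Suc_0: "poly_bounded (Suc 0) a \<Longrightarrow> \<exists>c. a = [:c:]"
  by (cases a) (auto simp: poly_bounded_pCons)

lemma poly_bounded_add: "poly_bounded n a \<Longrightarrow> poly_bounded n b \<Longrightarrow> poly_bounded n (a + b)"
  by (simp add: poly_bounded_def)

lemma poly_bounded_diff: "poly_bounded n a \<Longrightarrow> poly_bounded n b \<Longrightarrow> poly_bounded n (a - b)"
  for a b :: "'r::comm_ring_1 poly"
  by (simp add: poly_bounded_def)

lemma poly_bounded_smult: "poly_bounded n a \<Longrightarrow> poly_bounded n (smult c a)"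
  for a :: "'r::comm_ring_1 poly"
  by (simp add: poly_bounded_def)

lemma poly_bounded_mono: "poly_bounded n a \<Longrightarrow> n \<le> m \<Longrightarrow> poly_bounded m a"
  by (simp add: poly_bounded_def)

lemma poly_bounded_linear_mult:
  "poly_bounded n b \<Longrightarrow> poly_bounded (Suc n) ([:c0, c1:] * b)" for b :: "'r::comm_ring_1 poly"
proof -
  assume b: "poly_bounded n b"
  have "[:c0, c1:] * b = smult c0 b + pCons 0 (smult c1 b)" by simp
  moreover have "poly_bounded (Suc n) (smult c0 b)"
    using poly_bounded_mono[OF poly_bounded_smult[OF b]] by simp
  moreover have "poly_bounded (Suc n) (pCons 0 (smult c1 b))"
    using poly_bounded_smult[OF b] by (simp add: poly_bounded_pCons)
  ultimately show ?thesis by (simp only: poly_bounded_add)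
qed

lemma eval_form_add: "eval_form g h r (a + b) = eval_form g h r a + eval_form g h r b"
  by (simp add: eval_form_def algebra_simps sum.distrib)

lemma eval_form_smult: "eval_form g h r (smult c a) = c * eval_form g h r a"
  by (simp add: eval_form_def algebra_simps sum_distrib_left)

lemma eval_form_zero [simp]: "eval_form g h r 0 = 0"
  by (simp add: eval_form_def)

lemma eval_form_0 [simp]: "eval_form g h 0 a = coeff a 0"
  by (simp add: eval_form_def)

lemma eval_form_pCons: "eval_form g h (Suc r) (pCons c a) = c * g ^ Suc r + h * eval_form g h r a"
  unfolding eval_form_def
  by (subst sum.atMost_Suc_shift) (simp add: sum_distrib_left algebra_simps)

lemma eval_form_const: "eval_form g h r [:c:] = c * g ^ r"
  by (cases r) (simp_all add: eval_form_pCons)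

lemma eval_form_Suc:
  assumes "poly_bounded (Suc r) a"
  shows "eval_form g h (Suc r) a = g * eval_form g h r a"
proof -
  have "coeff a l * g ^ (Suc r - l) * h ^ l = g * (coeff a l * g ^ (r - l) * h ^ l)" if "l \<le> r" for l
    using that by (simp add: Suc_diff_le algebra_simps)
  then show ?thesis
    using assms by (simp add: eval_form_def poly_bounded_def sum_distrib_left)
qed

text \<open>Evaluation of forms is multiplicative; one factor being linear is the case that is needed for the
  relations between the generators.\<close>

lemma eval_form_linear_mult:
  assumes "poly_bounded (Suc r) b"
  shows "eval_form g h (Suc r) ([:c0, c1:] * b) = (c0 * g + c1 * h) * eval_form g h r b"
proof -
  have "[:c0, c1:] * b = smult c0 b + pCons 0 (smult c1 b)" by simp
  then show ?thesis
    by (simp only: eval_form_add eval_form_smult eval_form_pCons eval_form_Suc[OF assms])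
      (simp add: algebra_simps)
qed

interpretation ideal: module "(*) :: 'r::comm_ring_1 \<Rightarrow> 'r \<Rightarrow> 'r"
  by unfold_locales (simp_all add: algebra_simps)

lemma ideal_span_pairE:
  assumes "a \<in> ideal_span {g, h}"
  obtains c0 c1 where "a = c0 * g + c1 * h"
proof -
  obtain c0 c1 where "a - c0 * g - c1 * h = 0"
    using assms unfolding ideal.span_insert by auto
  then have "a = c0 * g + c1 * h" by (simp add: algebra_simps)
  then show ?thesis by (rule that)
qed

lemma mult_in_ideal_mult: "a \<in> I \<Longrightarrow> b \<in> J \<Longrightarrow> a * b \<in> ideal_mult I J"
  unfolding ideal_mult_def by (rule ideal.span_base) blast

lemma ideal_mult_add: "a \<in> ideal_mult I J \<Longrightarrow> b \<in> ideal_mult I J \<Longrightarrow> a + b \<in> ideal_mult I J"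
  unfolding ideal_mult_def by (rule ideal.span_add)

lemma ideal_mult_subset:
  assumes "ideal.subspace E" "\<And>a b. a \<in> I \<Longrightarrow> b \<in> J \<Longrightarrow> a * b \<in> E"
  shows "ideal_mult I J \<subseteq> E"
  unfolding ideal_mult_def
proof (rule ideal.span_minimal[OF _ assms(1)])
  show "{a * b |a b. a \<in> I \<and> b \<in> J} \<subseteq> E" using assms(2) by blast
qed


section \<open>Polynomials in two auxiliary variables\<close>

text \<open>An element of \<open>S[Y][Z]\<close> stands for the form in \<open>T\<^sub>0, T\<^sub>1, T\<^sub>2\<close> that becomes it for \<open>T\<^sub>0 = Z\<close>, \<open>T\<^sub>1 = 1\<close>,
  \<open>T\<^sub>2 = Y\<close>, so forms of degree \<open>r\<close> correspond to polynomials of total degree less than \<open>r + 1\<close>.\<close>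

definition bipoly_bounded :: "nat \<Rightarrow> 'r::zero poly poly \<Rightarrow> bool"
  where "bipoly_bounded n P \<longleftrightarrow> (\<forall>k l. n \<le> k + l \<longrightarrow> coeff (coeff P k) l = 0)"

lemma bipoly_bounded_zero [simp]: "bipoly_bounded n 0"
  by (simp add: bipoly_bounded_def)

lemma bipoly_bounded_0_iff [simp]: "bipoly_bounded 0 P \<longleftrightarrow> P = 0"
  by (auto simp: bipoly_bounded_def poly_eq_iff)

lemma bipoly_bounded_pCons: "bipoly_bounded n (pCons a P) \<longleftrightarrow> poly_bounded n a \<and> bipoly_bounded (n - 1) P"
proof
  assume *: "bipoly_bounded n (pCons a P)"
  have "coeff a l = 0" if "n \<le> l" for l
    using *[unfolded bipoly_bounded_def, rule_format, of 0 l] that by simp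
  moreover have "coeff (coeff P k) l = 0" if "n - 1 \<le> k + l" for k l
    using *[unfolded bipoly_bounded_def, rule_format, of "Suc k" l] that by simp
  ultimately show "poly_bounded n a \<and> bipoly_bounded (n - 1) P"
    by (simp add: poly_bounded_def bipoly_bounded_def)
next
  assume *: "poly_bounded n a \<and> bipoly_bounded (n - 1) P"
  have "coeff (coeff (pCons a P) k) l = 0" if "n \<le> k + l" for k l
  proof (cases k)
    case 0
    then show ?thesis using * that by (simp add: poly_bounded_def)
  next
    case (Suc k')
    then show ?thesis using * that by (simp add: bipoly_bounded_def)
  qed
  then show "bipoly_bounded n (pCons a P)" by (simp add: bipoly_bounded_def)
qed

lemma bipoly_bounded_coeff: "bipoly_bounded (n + k) P \<Longrightarrow> poly_bounded n (coeff P k)"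
  by (simp add: bipoly_bounded_def poly_bounded_def add.commute)

lemma bipoly_bounded_add: "bipoly_bounded n P \<Longrightarrow> bipoly_bounded n Q \<Longrightarrow> bipoly_bounded n (P + Q)"
  by (simp add: bipoly_bounded_def)

lemma bipoly_bounded_uminus: "bipoly_bounded n P \<Longrightarrow> bipoly_bounded n (- P)"
  for P :: "'r::comm_ring_1 poly poly"
  by (simp add: bipoly_bounded_def)

lemma bipoly_bounded_diff: "bipoly_bounded n P \<Longrightarrow> bipoly_bounded n Q \<Longrightarrow> bipoly_bounded n (P - Q)"
  for P :: "'r::comm_ring_1 poly poly"
  by (simp add: bipoly_bounded_def)

lemma bipoly_bounded_const_smult: "bipoly_bounded n P \<Longrightarrow> bipoly_bounded n (smult [:c:] P)"
  for P :: "'r::comm_ring_1 poly poly"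
  by (simp add: bipoly_bounded_def)

lemma linear_mult_eq: "[:a, b:] * P = smult a P + pCons 0 (smult b P)" for P :: "'r::comm_ring_1 poly"
  by simp

lemma bipoly_bounded_linear_mult:
  fixes P :: "'r::comm_ring_1 poly poly"
  assumes "bipoly_bounded n P"
  shows "bipoly_bounded (Suc n) ([:[:c0, c1:], [:e:]:] * P)"
proof -
  have "coeff ([:c0, c1:] * coeff P k) l = 0" if "Suc n \<le> k + l" for k l
  proof (cases l)
    case 0
    then show ?thesis using assms that by (simp add: linear_mult_eq bipoly_bounded_def)
  next
    case (Suc l')
    then show ?thesis using assms that by (simp add: linear_mult_eq bipoly_bounded_def)
  qed
  then have "bipoly_bounded (Suc n) (smult [:c0, c1:] P)"
    unfolding bipoly_bounded_def coeff_smult by blast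
  moreover have "bipoly_bounded (Suc n) (pCons 0 (smult [:e:] P))"
    using bipoly_bounded_const_smult[OF assms] by (simp add: bipoly_bounded_pCons)
  ultimately show ?thesis unfolding linear_mult_eq by (rule bipoly_bounded_add)
qed

text \<open>The value at \<open>(T\<^sub>1, T\<^sub>2, T\<^sub>0) = (g, h, q)\<close> of the form of degree \<open>r\<close> with the dehomogenisation \<open>P\<close>.\<close>

definition eval_biform :: "'r::comm_ring_1 \<Rightarrow> 'r \<Rightarrow> 'r \<Rightarrow> nat \<Rightarrow> 'r poly poly \<Rightarrow> 'r"
  where "eval_biform g h q r P = (\<Sum>k\<le>r. q ^ k * eval_form g h (r - k) (coeff P k))"

lemma eval_biform_add: "eval_biform g h q r (P + Q) = eval_biform g h q r P + eval_biform g h q r Q"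
  by (simp add: eval_biform_def eval_form_add distrib_left sum.distrib)

lemma eval_biform_const_smult: "eval_biform g h q r (smult [:c:] P) = c * eval_biform g h q r P"
proof -
  have "[:c:] * a = smult c a" for a by simp
  then show ?thesis
    by (simp only: eval_biform_def coeff_smult eval_form_smult sum_distrib_left mult.left_commute)
qed

lemma eval_biform_0 [simp]: "eval_biform g h q 0 P = coeff (coeff P 0) 0"
  by (simp add: eval_biform_def)

lemma eval_biform_zero [simp]: "eval_biform g h q r 0 = 0"
  by (simp add: eval_biform_def)

lemma eval_biform_pCons:
  "eval_biform g h q (Suc r) (pCons a P) = eval_form g h (Suc r) a + q * eval_biform g h q r P"
  unfolding eval_biform_def sum.atMost_Suc_shift
  by (simp only: diff_zero power_0 mult_1_left coeff_pCons_0 diff_Suc_Suc coeff_pCons_Suc power_Suc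
      sum_distrib_left mult.assoc)

lemma eval_biform_const: "eval_biform g h q r [:a:] = eval_form g h r a"
  by (cases r) (simp_all add: eval_biform_pCons)

lemma eval_biform_linear_mult:
  assumes P: "bipoly_bounded (Suc r) P"
  shows "eval_biform g h q (Suc r) ([:[:c0, c1:], [:e:]:] * P) = (c0 * g + c1 * h + e * q) * eval_biform g h q r P"
proof -
  have "q ^ k * eval_form g h (Suc r - k) ([:c0, c1:] * coeff P k)
      = (c0 * g + c1 * h) * (q ^ k * eval_form g h (r - k) (coeff P k))" if "k \<le> r" for k
  proof -
    have "poly_bounded (Suc (r - k)) (coeff P k)"
      using P that by (intro bipoly_bounded_coeff) (simp add: Suc_diff_le[symmetric])
    then have "eval_form g h (Suc (r - k)) ([:c0, c1:] * coeff P k)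
        = (c0 * g + c1 * h) * eval_form g h (r - k) (coeff P k)"
      by (rule eval_form_linear_mult)
    then show ?thesis
      by (simp only: Suc_diff_le[OF that] mult.left_commute)
  qed
  moreover have "coeff P (Suc r) = 0"
    using P by (intro poly_eqI) (simp add: bipoly_bounded_def)
  ultimately have "eval_biform g h q (Suc r) (smult [:c0, c1:] P) = (c0 * g + c1 * h) * eval_biform g h q r P"
    unfolding eval_biform_def coeff_smult sum.atMost_Suc
    by (simp add: sum_distrib_left del: mult_pCons_left)
  moreover have "eval_biform g h q (Suc r) (pCons 0 (smult [:e:] P)) = q * (e * eval_biform g h q r P)"
    by (simp add: eval_biform_pCons eval_biform_const_smult)
  ultimately have "eval_biform g h q (Suc r) ([:[:c0, c1:], [:e:]:] * P)
      = (c0 * g + c1 * h) * eval_biform g h q r P + q * (e * eval_biform g h q r P)"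
    unfolding linear_mult_eq[of "[:c0, c1:]"] eval_biform_add by (simp only:)
  also have "\<dots> = (c0 * g + c1 * h + e * q) * eval_biform g h q r P"
    by (simp only: distrib_right mult.assoc mult.left_commute)
  finally show ?thesis .
qed

lemma ideal_span_tripleE:
  assumes "a \<in> ideal_span {g, h, q}"
  obtains c0 c1 e where "a = c0 * g + c1 * h + e * q"
proof -
  obtain c0 where "a - c0 * g \<in> ideal_span {h, q}"
    using assms unfolding ideal.span_insert[of g] by auto
  then obtain c1 e where "a - c0 * g = c1 * h + e * q" by (rule ideal_span_pairE)
  then have "a = c0 * g + c1 * h + e * q" by (simp add: algebra_simps)
  then show ?thesis by (rule that)
qed

text \<open>Expanding a form along its lowest monomials splits its value into multiples of the three generators by
  values of forms of one degree less; conversely the product of such a value with an element of the ideal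
  is the value of the product with a linear form.\<close>

lemma ideal_power_three_generators:
  fixes g h q :: "'r::comm_ring_1"
  shows "ideal_power (ideal_span {g, h, q}) r = eval_biform g h q r ` {P. bipoly_bounded (Suc r) P}"
proof (induction r)
  case 0
  have "c \<in> eval_biform g h q 0 ` {P. bipoly_bounded (Suc 0) P}" for c
    by (rule image_eqI[of _ _ "[:[:c:]:]"]) (simp_all add: bipoly_bounded_pCons poly_bounded_pCons)
  then show ?case by auto
next
  case (Suc r)
  let ?E = "\<lambda>r. eval_biform g h q r ` {P. bipoly_bounded (Suc r) P}" and ?I = "ideal_span {g, h, q}"
  have gen: "g \<in> ?I" "h \<in> ?I" "q \<in> ?I"
    by (simp_all add: ideal.span_base)
  have E_sub: "ideal.subspace (?E (Suc r))"
    unfolding ideal.subspace_def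
  proof (intro conjI ballI allI)
    show "0 \<in> ?E (Suc r)" by (rule image_eqI[of _ _ 0]) simp_all
  next
    fix x y assume "x \<in> ?E (Suc r)" "y \<in> ?E (Suc r)"
    then show "x + y \<in> ?E (Suc r)"
      by (auto simp: eval_biform_add[symmetric] intro!: imageI bipoly_bounded_add)
  next
    fix c x assume "x \<in> ?E (Suc r)"
    then obtain P where "bipoly_bounded (Suc (Suc r)) P" "x = eval_biform g h q (Suc r) P" by blast
    then show "c * x \<in> ?E (Suc r)"
      by (intro image_eqI[of _ _ "smult [:c:] P"])
        (simp_all only: mem_Collect_eq eval_biform_const_smult bipoly_bounded_const_smult)
  qed
  have "ideal_mult ?I (?E r) \<subseteq> ?E (Suc r)"
  proof (rule ideal_mult_subset[OF E_sub])
    fix a x assume a: "a \<in> ?I" and "x \<in> ?E r"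
    then obtain P where P: "bipoly_bounded (Suc r) P" "x = eval_biform g h q r P" by blast
    obtain c0 c1 e where "a = c0 * g + c1 * h + e * q"
      using a by (rule ideal_span_tripleE)
    then have "a * x = eval_biform g h q (Suc r) ([:[:c0, c1:], [:e:]:] * P)"
      using eval_biform_linear_mult[OF P(1)] P(2) by (simp only:)
    then show "a * x \<in> ?E (Suc r)"
      using bipoly_bounded_linear_mult[OF P(1)] by blast
  qed
  moreover have "?E (Suc r) \<subseteq> ideal_mult ?I (?E r)"
  proof clarify
    fix P :: "'r poly poly" assume P: "bipoly_bounded (Suc (Suc r)) P"
    obtain c a P' where P': "P = pCons (pCons c a) P'" by (metis pCons_cases)
    then have "bipoly_bounded (Suc r) P'" "bipoly_bounded (Suc r) [:a:]" "bipoly_bounded (Suc r) [:[:c:]:]"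
      using P by (simp_all add: bipoly_bounded_pCons poly_bounded_pCons)
    then have "eval_biform g h q r P' \<in> ?E r" "eval_biform g h q r [:a:] \<in> ?E r" "eval_biform g h q r [:[:c:]:] \<in> ?E r"
      by blast+
    then have "g * eval_biform g h q r [:[:c:]:] + h * eval_biform g h q r [:a:] + q * eval_biform g h q r P'
        \<in> ideal_mult ?I (?E r)"
      by (intro ideal_mult_add mult_in_ideal_mult gen)
    moreover have "eval_biform g h q (Suc r) P
        = g * eval_biform g h q r [:[:c:]:] + h * eval_biform g h q r [:a:] + q * eval_biform g h q r P'"
      unfolding P' eval_biform_pCons eval_biform_const eval_form_pCons eval_form_const power_Suc
      by (simp only: mult.left_commute)
    ultimately show "eval_biform g h q (Suc r) P \<in> ideal_mult ?I (?E r)"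
      by (simp only:)
  qed
  ultimately have "ideal_mult ?I (?E r) = ?E (Suc r)" by (rule subset_antisym)
  then show ?case
    by (simp only: ideal_power.simps Suc)
qed


text \<open>The case of three generators with the third one zero.\<close>

lemma ideal_power_two_generators:
  fixes g h :: "'r::comm_ring_1"
  shows "ideal_power (ideal_span {g, h}) r = eval_form g h r ` {a. poly_bounded (Suc r) a}"
proof -
  have "ideal_span (insert 0 {g, h}) = ideal_span {g, h}"
    by (simp only: ideal.span_insert[of 0] mult_zero_right diff_zero) auto
  moreover have "insert 0 {g, h} = {g, h, 0}" by auto
  ultimately have "ideal_power (ideal_span {g, h}) r = eval_biform g h 0 r ` {P. bipoly_bounded (Suc r) P}"
    using ideal_power_three_generators[of g h 0 r] by (simp only:)
  also have "\<dots> = eval_form g h r ` {a. poly_bounded (Suc r) a}"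
  proof -
    have ev: "eval_biform g h 0 r P = eval_form g h r (coeff P 0)" for P
    proof -
      have "eval_biform g h 0 r P = (\<Sum>k\<le>r. if k = 0 then eval_form g h r (coeff P 0) else 0)"
        unfolding eval_biform_def by (intro sum.cong) (simp_all add: power_0_left)
      then show ?thesis by simp
    qed
    have "poly_bounded (Suc r) (coeff P 0)" if "bipoly_bounded (Suc r) P" for P :: "'r poly poly"
      using bipoly_bounded_coeff[of "Suc r" 0 P] that by simp
    moreover have "bipoly_bounded (Suc r) [:a:]" if "poly_bounded (Suc r) a" for a :: "'r poly"
      using that by (simp add: bipoly_bounded_pCons)
    ultimately have "{a. poly_bounded (Suc r) a} = (\<lambda>P. coeff P 0) ` {P :: 'r poly poly. bipoly_bounded (Suc r) P}"
      by (force intro!: image_eqI[where x = "[:_:]"])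
    then show ?thesis by (simp only: image_image) (rule image_cong[OF refl ev])
  qed
  finally show ?thesis .
qed


section \<open>Minimal resolutions of length two\<close>

lemma mat_app_graded_hom:
  assumes f: "graded_hom n s m t f" and v: "v \<in> free_module n"
  shows "mat_app m n (\<lambda>p q. f (unit_vec q) p) v = f v"
proof
  fix p show "mat_app m n (\<lambda>p q. f (unit_vec q) p) v p = f v p"
  proof (cases "p < m")
    case True
    then show ?thesis
      by (simp add: mat_app_def graded_hom_expand[OF f v] mult.commute)
  next
    case False
    then show ?thesis
      using graded_homD(1)[OF f v] by (simp add: mat_app_def free_module_def)
  qed
qed

lemma mat_app_rank_zero: "mat_app 0 n M v = 0" "mat_app m 0 M v = 0"
  by (simp_all add: mat_app_def fun_eq_iff)

lemma free_module_0 [simp]: "free_module 0 = {0}"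
  by (auto simp: free_module_def fun_eq_iff)

text \<open>For free modules that consist of polynomials, homomorphisms are easier to handle than matrices; here
  they are turned into the matrices of a free complex.\<close>

lemma regularity_of_length_two_resolution:
  fixes J :: "'a::field poly3 set"
  assumes aug: "\<And>q. q < n0 \<Longrightarrow> homogeneous (gen q) (s0 q)"
    and d0: "graded_hom n1 s1 n0 s0 d0" and d1: "graded_hom n2 s2 n1 s1 d1"
    and image: "(\<lambda>v. \<Sum>q<n0. gen q * v q) ` free_module n0 = J"
    and exact0: "{v \<in> free_module n0. (\<Sum>q<n0. gen q * v q) = 0} = d0 ` free_module n1"
    and exact1: "{v \<in> free_module n1. d0 v = 0} = d1 ` free_module n2"
    and inj: "\<And>v. v \<in> free_module n2 \<Longrightarrow> d1 v = 0 \<Longrightarrow> v = 0"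
    and min0: "\<And>p q. p < n0 \<Longrightarrow> q < n1 \<Longrightarrow> const_coeff (d0 (unit_vec q) p) = 0"
    and min1: "\<And>p q. p < n1 \<Longrightarrow> q < n2 \<Longrightarrow> const_coeff (d1 (unit_vec q) p) = 0"
    and le: "\<And>l. l < n0 \<Longrightarrow> s0 l \<le> N" "\<And>l. l < n1 \<Longrightarrow> s1 l - 1 \<le> N" "\<And>l. l < n2 \<Longrightarrow> s2 l - 2 \<le> N"
    and attained: "(\<exists>l<n0. s0 l = N) \<or> (\<exists>l<n1. s1 l - 1 = N)"
  shows "regularity J = N"
proof -
  define F where "F = \<lparr>frank = (\<lambda>i. if i = 0 then n0 else if i = 1 then n1 else if i = 2 then n2 else 0),
    fshift = (\<lambda>i. if i = 0 then s0 else if i = 1 then s1 else s2), augm = gen,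
    diff = (\<lambda>i p q. if i = 0 then d0 (unit_vec q) p else d1 (unit_vec q) p)\<rparr>"
  have rank: "frank F 0 = n0" "frank F (Suc 0) = n1" "frank F (Suc (Suc 0)) = n2"
    "frank F (Suc (Suc (Suc i))) = 0" for i
    by (simp_all add: F_def)
  have dm0: "diff_map F 0 v = d0 v" if "v \<in> free_module n1" for v
    using mat_app_graded_hom[OF d0 that] by (simp add: diff_map_def F_def)
  have dm1: "diff_map F (Suc 0) v = d1 v" if "v \<in> free_module n2" for v
    using mat_app_graded_hom[OF d1 that] by (simp add: diff_map_def F_def)
  have dm2: "diff_map F (Suc (Suc i)) v = 0" for i v
    unfolding diff_map_def rank by (rule mat_app_rank_zero)
  have augm: "augm_map F v = (\<Sum>q<n0. gen q * v q)" for v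
    by (simp add: augm_map_def F_def)
  have "graded_free_resolution J F"
    unfolding graded_free_resolution_def
  proof (intro conjI allI impI)
    fix q assume "q < frank F 0"
    then show "homogeneous (augm F q) (fshift F 0 q)" by (simp add: F_def aug)
  next
    fix i p q assume "p < frank F i" "q < frank F (Suc i)"
    then show "homogeneous (diff F i p q) (fshift F (Suc i) q - fshift F i p)"
      using graded_homD(4)[OF d0] graded_homD(4)[OF d1] by (simp add: F_def split: if_splits)
  next
    show "augm_map F ` free_module (frank F 0) = J"
      using image by (simp add: augm rank)
  next
    show "{v \<in> free_module (frank F 0). augm_map F v = 0} = diff_map F 0 ` free_module (frank F 1)"
      using exact0 dm0 by (simp add: augm rank)
  next
    fix i
    consider "i = 0" | "i = Suc 0" | k where "i = Suc (Suc k)" by (metis not0_implies_Suc)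
    then show "{v \<in> free_module (frank F (Suc i)). diff_map F i v = 0}
        = diff_map F (Suc i) ` free_module (frank F (Suc (Suc i)))"
    proof cases
      case 1
      have "{v \<in> free_module n1. diff_map F 0 v = 0} = {v \<in> free_module n1. d0 v = 0}"
        using dm0 by auto
      then show ?thesis using exact1 dm1 by (simp only: 1 rank) simp
    next
      case 2
      have "{v \<in> free_module n2. diff_map F (Suc 0) v = 0} = {0}"
        using dm1 inj graded_hom_zero[OF d1] by force
      then show ?thesis by (simp only: 2 rank free_module_0) (simp add: dm2)
    next
      case (3 k)
      then show ?thesis by (simp only: rank free_module_0) (auto simp: dm2)
    qed
  qed
  then show ?thesis
  proof (rule regularity_minimal[where n = 3])
    fix i p q assume "p < frank F i" "q < frank F (Suc i)"
    then show "const_coeff (diff F i p q) = 0"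
      using min0 min1 by (simp add: F_def split: if_splits)
  next
    fix i :: nat assume "i \<ge> 3"
    then show "frank F i = 0" by (simp add: F_def)
  next
    fix i l assume "l < frank F i"
    then show "fshift F i l - int i \<le> N"
      using le by (simp add: F_def split: if_splits)
  next
    show "\<exists>i l. l < frank F i \<and> fshift F i l - int i = N"
      using attained
    proof
      assume "\<exists>l<n0. s0 l = N"
      then obtain l where "l < n0" "s0 l = N" by blast
      then show ?thesis by (intro exI[of _ 0] exI[of _ l]) (simp add: F_def)
    next
      assume "\<exists>l<n1. s1 l - 1 = N"
      then obtain l where "l < n1" "s1 l - 1 = N" by blast
      then show ?thesis by (intro exI[of _ 1] exI[of _ l]) (simp add: F_def)
    qed
  qed
qed


section \<open>Powers of a complete intersection\<close>

text \<open>Coefficient vectors of polynomials of degree less than \<open>n\<close> are exactly the elements of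
  \<open>free_module n\<close>.\<close>

definition poly_of :: "(nat \<Rightarrow> 'r::zero) \<Rightarrow> 'r poly"
  where "poly_of v = Abs_poly v"

lemma coeff_poly_of: "v \<in> free_module n \<Longrightarrow> coeff (poly_of v) = v"
  unfolding poly_of_def by (rule coeff_Abs_poly[of n]) (simp add: free_module_def)

lemma poly_bounded_iff_coeff: "poly_bounded n a \<longleftrightarrow> coeff a \<in> free_module n"
  by (simp add: poly_bounded_def free_module_def)

lemma poly_of_coeff: "poly_of (coeff a) = a"
  by (simp add: poly_of_def coeff_inverse)

lemma poly_of_zero: "poly_of 0 = 0"
  by (rule poly_eqI) (simp add: coeff_poly_of[of 0 0])

lemma poly_of_add:
  fixes v w :: "nat \<Rightarrow> 'r::comm_ring_1"
  assumes "v \<in> free_module n" "w \<in> free_module n"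
  shows "poly_of (v + w) = poly_of v + poly_of w"
proof (rule poly_eqI)
  fix i show "coeff (poly_of (v + w)) i = coeff (poly_of v + poly_of w) i"
    using coeff_poly_of[OF free_module_add[OF assms]] coeff_poly_of[OF assms(1)] coeff_poly_of[OF assms(2)]
    by (simp only: coeff_add plus_fun_apply)
qed

lemma poly_of_scale:
  fixes v :: "nat \<Rightarrow> 'r::comm_ring_1"
  assumes "v \<in> free_module n"
  shows "poly_of (\<lambda>l. c * v l) = smult c (poly_of v)"
  by (rule poly_eqI) (simp add: coeff_poly_of[OF assms] coeff_poly_of[OF free_module_scale[OF assms]])

lemma poly_of_unit_vec: "poly_of (unit_vec q) = monom 1 q"
proof (rule poly_eqI)
  fix i
  have "(unit_vec q :: nat \<Rightarrow> 'a) \<in> free_module (Suc q)" by (rule unit_vec_in_free_module) simp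
  from coeff_poly_of[OF this] show "coeff (poly_of (unit_vec q)) i = coeff (monom (1 :: 'a) q) i"
    by (simp add: unit_vec_def)
qed

text \<open>Since \<open>g\<close> is a nonzerodivisor modulo \<open>h\<close>, the lowest coefficient of a form that vanishes at \<open>(g, h)\<close> is
  divisible by \<open>h\<close>, and a multiple of \<open>g Y - h\<close> clears it. The rest is divisible by \<open>Y\<close>, and the quotient is
  a form of smaller degree that vanishes at \<open>(g, h)\<close> as well.\<close>

lemma eval_form_eq_zero:
  fixes g h :: "'r::idom"
  assumes reg: "\<And>c k. h dvd c * g ^ k \<Longrightarrow> h dvd c" and h: "h \<noteq> 0"
  shows "poly_bounded (Suc r) a \<Longrightarrow> eval_form g h r a = 0 \<Longrightarrow> \<exists>b. poly_bounded r b \<and> a = [:- h, g:] * b"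
proof (induction r arbitrary: a)
  case 0
  then show ?case using poly_bounded_Suc_0[of a] by auto
next
  case (Suc r)
  obtain c a' where a: "a = pCons c a'" by (cases a)
  have a': "poly_bounded (Suc r) a'" using Suc.prems(1) by (simp add: a poly_bounded_pCons)
  have z: "c * g ^ Suc r + h * eval_form g h r a' = 0"
    using Suc.prems(2) by (simp only: a eval_form_pCons)
  then have "c * g ^ Suc r = h * (- eval_form g h r a')" by (simp only: eq_neg_iff_add_eq_0 mult_minus_right)
  then have "h dvd c * g ^ Suc r" by (rule dvdI)
  then obtain e where e: "c = h * e" using reg by blast
  have "poly_bounded (Suc r) (a' + [:g * e:])"
    using a' by (intro poly_bounded_add) (simp_all add: poly_bounded_pCons)
  moreover have "h * (x + g * e * g ^ r) = c * g ^ Suc r + h * x" for x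
    unfolding e power_Suc by (simp only: distrib_left mult_ac add_ac)
  then have "h * eval_form g h r (a' + [:g * e:]) = 0"
    unfolding eval_form_add eval_form_const using z by (simp only:)
  then have "eval_form g h r (a' + [:g * e:]) = 0" using h by simp
  ultimately obtain b where b: "poly_bounded r b" "a' + [:g * e:] = [:- h, g:] * b"
    using Suc.IH by blast
  have "[:- h, g:] * pCons (- e) b = [:h * e, - (g * e):] + pCons 0 ([:- h, g:] * b)"
    by simp
  also have "\<dots> = a" unfolding b(2)[symmetric] by (simp add: a e)
  finally show ?case
    using b(1) by (intro exI[of _ "pCons (- e) b"]) (simp add: poly_bounded_pCons)
qed

text \<open>Replacing a generator of degree \<open>d\<close> by the conic does not raise the degree of a product of generators.\<close>

lemma shift_bound:
  fixes d r k :: nat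
  assumes "2 \<le> d"
  shows "int d * (int r - int k) + 2 * int k \<le> int r * int d"
proof -
  have "2 * int k \<le> int d * int k" using assms by (intro mult_right_mono) auto
  then show ?thesis by (simp add: algebra_simps)
qed

text \<open>The variable \<open>Y\<close> stands for the conic \<open>q\<close>, and the resolution is \<open>0 \<rightarrow> S[Y]\<^bsub>< r\<^esub> \<rightarrow> S[Y]\<^bsub>\<le> r\<^esub> \<rightarrow> \<langle>f, q\<rangle>\<^sup>r\<close>, where the first map is multiplication by
  \<open>f Y - q\<close>. The regularity is attained by the syzygies.\<close>

lemma regularity_complete_intersection_power:
  fixes f :: "'a::field poly3"
  assumes d: "2 \<le> d" and r: "1 \<le> r" and f: "homogeneous f (int d)" and nz: "param f \<noteq> 0"
  shows "regularity (ideal_power (ideal_span {f, conic}) r) = int (r * d + 1)"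
proof -
  let ?q = "conic :: 'a poly3"
  define gen where "gen q = f ^ (r - q) * ?q ^ q" for q
  define D where "D v = coeff ([:- ?q, f:] * poly_of v)" for v :: "nat \<Rightarrow> 'a poly3"
  define s0 where "s0 q = int d * (int r - int q) + 2 * int q" for q
  define s1 where "s1 q = s0 q + 2" for q
  have q_hom: "homogeneous ?q 2" "homogeneous (- ?q) 2"
    by (rule homogeneous_conic, rule homogeneous_uminus[OF homogeneous_conic])
  have aug: "(\<Sum>q<Suc r. gen q * v q) = eval_form f ?q r (poly_of v)" if "v \<in> free_module (Suc r)" for v
    unfolding eval_form_def coeff_poly_of[OF that] lessThan_Suc_atMost gen_def
    by (rule sum.cong) (simp_all only: mult_ac)
  have D_unit: "D (unit_vec q) p = (if p = q then - ?q else if p = Suc q then f else 0)" for p q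
    by (auto simp: D_def poly_of_unit_vec coeff_pCons split: nat.split)
  have free: "free_module n = coeff ` {a :: 'a poly3 poly. poly_bounded n a}" for n
  proof (intro set_eqI iffI)
    fix v :: "nat \<Rightarrow> 'a poly3" assume v: "v \<in> free_module n"
    then show "v \<in> coeff ` {a. poly_bounded n a}"
      by (intro image_eqI[of _ _ "poly_of v"]) (simp_all add: poly_bounded_iff_coeff coeff_poly_of[OF v])
  qed (auto simp: poly_bounded_iff_coeff)
  have reg: "?q dvd c" if "?q dvd c * f ^ k" for c k
    using that nz by (simp add: param_eq_zero_iff[symmetric] param.subst_mult param.subst_power)
  show ?thesis
  proof (rule regularity_of_length_two_resolution)
    fix q assume "q < Suc r"
    then have "int (r - q) = int r - int q" by simp
    then show "homogeneous (gen q) (s0 q)"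
      using homogeneous_mult[OF homogeneous_power[OF f, of "r - q"] homogeneous_power[OF q_hom(1), of q]]
      by (simp add: gen_def s0_def algebra_simps)
  next
    show "graded_hom r s1 (Suc r) s0 D"
      unfolding graded_hom_def
    proof (intro conjI ballI allI impI)
      fix v :: "nat \<Rightarrow> 'a poly3" assume v: "v \<in> free_module r"
      then have "poly_bounded r (poly_of v)" by (simp add: poly_bounded_iff_coeff coeff_poly_of)
      then show "D v \<in> free_module (Suc r)"
        unfolding D_def poly_bounded_iff_coeff[symmetric] by (rule poly_bounded_linear_mult)
      show "D (\<lambda>l. c * v l) = (\<lambda>l. c * D v l)" for c
        by (rule ext) (simp only: D_def poly_of_scale[OF v] mult_smult_right coeff_smult)
      fix w :: "nat \<Rightarrow> 'a poly3" assume w: "w \<in> free_module r"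
      show "D (v + w) = D v + D w"
        by (rule ext) (simp only: D_def poly_of_add[OF v w] distrib_left coeff_add plus_fun_apply)
    next
      fix p q show "homogeneous (D (unit_vec q) p) (s1 q - s0 p)"
        using f q_hom by (simp add: D_unit s1_def s0_def del: minus_diff_eq) (simp add: algebra_simps)
    qed
  next
    show "graded_hom 0 (\<lambda>l. 0) r s1 (\<lambda>v. 0)" by (rule graded_hom_const_zero)
  next
    have "(\<lambda>v. \<Sum>q<Suc r. gen q * v q) ` free_module (Suc r)
      = (\<lambda>v. eval_form f ?q r (poly_of v)) ` free_module (Suc r)"
      by (rule image_cong[OF refl aug])
    also have "\<dots> = ideal_power (ideal_span {f, ?q}) r"
      by (simp only: free image_image poly_of_coeff ideal_power_two_generators)
    finally show "(\<lambda>v. \<Sum>q<Suc r. gen q * v q) ` free_module (Suc r) = ideal_power (ideal_span {f, ?q}) r" .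
  next
    show "{v \<in> free_module (Suc r). (\<Sum>q<Suc r. gen q * v q) = 0} = D ` free_module r"
    proof (intro set_eqI iffI)
      fix v assume "v \<in> {v \<in> free_module (Suc r). (\<Sum>q<Suc r. gen q * v q) = 0}"
      then have v: "v \<in> free_module (Suc r)" and ev: "eval_form f ?q r (poly_of v) = 0"
        using aug by auto
      have "\<exists>b. poly_bounded r b \<and> poly_of v = [:- ?q, f:] * b"
      proof (rule eval_form_eq_zero[OF _ conic_nonzero _ ev])
        show "poly_bounded (Suc r) (poly_of v)"
          unfolding poly_bounded_iff_coeff coeff_poly_of[OF v] by (rule v)
      qed (rule reg)
      then obtain b where b: "poly_bounded r b" "poly_of v = [:- ?q, f:] * b" by blast
      have "v = D (coeff b)"
        unfolding D_def poly_of_coeff b(2)[symmetric] coeff_poly_of[OF v] ..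
      then show "v \<in> D ` free_module r" using b(1) by (simp add: poly_bounded_iff_coeff)
    next
      fix v assume "v \<in> D ` free_module r"
      then obtain w where w: "w \<in> free_module r" "v = D w" by blast
      have b: "poly_bounded r (poly_of w)" using w by (simp add: poly_bounded_iff_coeff coeff_poly_of)
      have v: "v \<in> free_module (Suc r)"
        unfolding w(2) D_def poly_bounded_iff_coeff[symmetric] by (rule poly_bounded_linear_mult[OF b])
      obtain r' where r': "r = Suc r'" using r by (cases r) auto
      have "eval_form f ?q r (poly_of v) = (- ?q * f + f * ?q) * eval_form f ?q r' (poly_of w)"
        unfolding w(2) D_def poly_of_coeff unfolding r'
        by (rule eval_form_linear_mult) (use b r' in simp)
      also have "- ?q * f + f * ?q = 0" by (simp only: mult.commute[of f] mult_minus_left left_minus)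
      finally have "eval_form f ?q r (poly_of v) = 0" by (simp only: mult_zero_left)
      then show "v \<in> {v \<in> free_module (Suc r). (\<Sum>q<Suc r. gen q * v q) = 0}"
        using v aug[OF v] by (simp only: mem_Collect_eq simp_thms)
    qed
  next
    have "v = 0" if v: "v \<in> free_module r" "D v = 0" for v
    proof -
      have "[:- ?q, f:] * poly_of v = 0"
        using v(2) by (intro poly_eqI) (simp add: D_def fun_eq_iff)
      moreover have "[:- ?q, f:] \<noteq> 0" using conic_nonzero[where ?'a = 'a] by (simp del: minus_diff_eq)
      ultimately have "poly_of v = 0" by (simp only: mult_eq_0_iff simp_thms)
      then show "v = 0" using coeff_poly_of[OF v(1)] by (simp add: fun_eq_iff)
    qed
    moreover have "D 0 = 0"
      by (rule ext) (simp only: D_def poly_of_zero mult_zero_right coeff_0 zero_fun_apply)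
    ultimately show "{v \<in> free_module r. D v = 0} = (\<lambda>v. 0) ` free_module 0"
      by auto
  next
    fix v :: "nat \<Rightarrow> 'a poly3" assume "v \<in> free_module 0"
    then show "v = 0" by simp
  next
    fix p q
    have "const_coeff f = 0" "const_coeff ?q = 0"
      using const_coeff_homogeneous[OF f] const_coeff_homogeneous[OF q_hom(1)] d by auto
    then show "const_coeff (D (unit_vec q) p) = 0"
      using const_coeff_diff[of 0 ?q] by (auto simp: D_unit)
  next
    fix l show "s0 l \<le> int (r * d + 1)" "s1 l - 1 \<le> int (r * d + 1)"
      using shift_bound[OF d, of r l] by (simp_all add: s1_def s0_def)
  next
    show "(\<exists>l<Suc r. s0 l = int (r * d + 1)) \<or> (\<exists>l<r. s1 l - 1 = int (r * d + 1))"
      using r by (intro disjI2 exI[of _ 0]) (simp add: s1_def s0_def mult.commute)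
  qed simp_all
qed


section \<open>The ideal of an odd number of points on the conic\<close>

text \<open>Substitution of \<open>Y = t\<close> in a polynomial over \<open>S\<close> of degree at most \<open>r\<close>, along the parametrised cone.\<close>

definition eval_at_t :: "nat \<Rightarrow> 'a::comm_ring_1 poly3 poly \<Rightarrow> 'a poly poly"
  where "eval_at_t r a = (\<Sum>l\<le>r. param (coeff a l) * param_t ^ l)"

lemma eval_at_t_pCons:
  "eval_at_t (Suc r) (pCons c a) = param c + param_t * eval_at_t r a"
  unfolding eval_at_t_def
  by (subst sum.atMost_Suc_shift) (simp add: sum_distrib_left mult.left_commute)

lemma eval_at_t_add: "eval_at_t r (a + b) = eval_at_t r a + eval_at_t r b"
  by (simp add: eval_at_t_def param.subst_add distrib_right sum.distrib)

lemma eval_at_t_const: "eval_at_t r [:c:] = param c"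
  by (cases r) (simp_all add: eval_at_t_pCons, simp_all add: eval_at_t_def param.subst_zero)

text \<open>The equations \<open>x\<^sub>1 = x\<^sub>0Y\<close> and \<open>x\<^sub>2 = x\<^sub>1Y\<close> hold on the parametrised cone for \<open>Y = t\<close>. They are the
  relations between \<open>f\<^sub>1\<close> and \<open>f\<^sub>2\<close> modulo the conic.\<close>

abbreviation line1 :: "'a::comm_ring_1 poly3 poly"
  where "line1 \<equiv> [:X 1, - X 0:]"

abbreviation line2 :: "'a::comm_ring_1 poly3 poly"
  where "line2 \<equiv> [:X 2, - X 1:]"

lemma line_mult_pCons: "[:c0, c1:] * pCons e b = pCons (c0 * e) ([:c1 * e:] + [:c0, c1:] * b)"
  for b :: "'r::comm_ring_1 poly"
  by simp

text \<open>If \<open>a\<close> vanishes at \<open>Y = t\<close>, then its lowest coefficient is divisible by \<open>t\<close> on the cone, so it lies in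
  \<open>\<langle>x\<^sub>1, x\<^sub>2\<rangle>\<close> and is cleared by a combination of the two linear polynomials; the rest is divisible by \<open>Y\<close>. The
  statement starts with degree one because in degree zero the kernel consists of the multiples of the
  conic.\<close>

lemma eval_at_t_eq_zero:
  fixes a :: "'a::idom poly3 poly"
  shows "poly_bounded (Suc (Suc r)) a \<Longrightarrow> eval_at_t (Suc r) a = 0 \<Longrightarrow>
    \<exists>b1 b2. poly_bounded (Suc r) b1 \<and> poly_bounded (Suc r) b2 \<and> a = line1 * b1 + line2 * b2"
proof (induction r arbitrary: a rule: less_induct)
  case (less r)
  note bd = less.prems(1) and z = less.prems(2)
  obtain c a' where a: "a = pCons c a'" by (cases a)
  have a': "poly_bounded (Suc r) a'" using bd by (simp add: a poly_bounded_pCons)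
  have z': "param c + param_t * eval_at_t r a' = 0"
    using z by (simp only: a eval_at_t_pCons)
  then have "param c = - (param_t * eval_at_t r a')" by (simp only: eq_neg_iff_add_eq_0)
  then have "coeff (coeff (param c) n) 0 = 0" for n by simp
  then obtain c1 c2 where c: "c = X 1 * c1 + X 2 * c2"
    using mem_ideal_of_origin by blast
  define a'' where "a'' = a' + [:X 0 * c1 + X 1 * c2:]"
  have a''_bd: "poly_bounded (Suc r) a''"
    unfolding a''_def using a' by (intro poly_bounded_add) (simp_all add: poly_bounded_pCons)
  have "param_t * eval_at_t r a'' = param_t * eval_at_t r a' + param c"
    unfolding a''_def eval_at_t_add eval_at_t_const c param.subst_add param.subst_mult
      param_X_one param_X_two by (simp only: distrib_left mult_ac)
  then have "param_t * eval_at_t r a'' = 0"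
    using z' by (simp only: add.commute)
  then have a''_z: "eval_at_t r a'' = 0" by simp
  have a_eq: "a = pCons (X 1 * c1 + X 2 * c2) (a'' - [:X 0 * c1 + X 1 * c2:])"
    by (simp only: a c a''_def add_diff_cancel_right')
  have "\<exists>b1 b2. poly_bounded r b1 \<and> poly_bounded r b2 \<and> a'' = line1 * b1 + line2 * b2
    \<or> (\<exists>e. r = 0 \<and> a'' = [:conic * e:])"
  proof (cases r)
    case 0
    then obtain e where e: "a'' = [:e:]" using poly_bounded_Suc_0 a''_bd by auto
    then have "param e = 0" using a''_z by (simp only: eval_at_t_const)
    then have "conic dvd e" by (simp only: param_eq_zero_iff)
    then show ?thesis using 0 e by (auto simp: dvd_def)
  next
    case (Suc r')
    then show ?thesis using less.IH[of r' a''] a''_bd a''_z by auto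
  qed
  \<comment> \<open>In the second case the last coefficient is a multiple of the conic, and
      \<open>(x\<^sub>1\<^sup>2 - x\<^sub>0x\<^sub>2) Y = x\<^sub>2(x\<^sub>1 - x\<^sub>0Y) - x\<^sub>1(x\<^sub>2 - x\<^sub>1Y)\<close>.\<close>
  then consider b1 b2 where "poly_bounded r b1" "poly_bounded r b2" "a'' = line1 * b1 + line2 * b2"
    | e where "r = 0" "a'' = [:conic * e:]" by blast
  then show "\<exists>b1 b2. poly_bounded (Suc r) b1 \<and> poly_bounded (Suc r) b2 \<and> a = line1 * b1 + line2 * b2"
  proof cases
    case 1
    have "a = line1 * pCons c1 b1 + line2 * pCons c2 b2"
    proof -
      have "pCons (p + q) (x + y - [:u + w:]) = pCons p ([:- u:] + x) + pCons q ([:- w:] + y)"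
        for p q u w and x y :: "'a poly3 poly"
        by (rule poly_eqI) (simp add: coeff_pCons algebra_simps split: nat.split)
      then show ?thesis unfolding a_eq line_mult_pCons 1(3) by (simp only: mult_minus_left)
    qed
    then show ?thesis
      using 1 by (intro exI[of _ "pCons c1 b1"] exI[of _ "pCons c2 b2"]) (simp only: poly_bounded_pCons, simp)
  next
    case 2
    have "a = line1 * [:c1 + X 2 * e:] + line2 * [:c2 - X 1 * e:]"
    proof -
      have lin: "[:p, q:] * [:u:] + [:p', q':] * [:w:] = [:p * u + p' * w, q * u + q' * w:]"
        and sub: "pCons p ([:u:] - [:w:]) = [:p, u - w:]" for p q p' q' u w :: "'a poly3"
        by simp_all
      have "x1 * c1 + x2 * c2 = x1 * (c1 + x2 * e) + x2 * (c2 - x1 * e)"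
        and "(x1 ^ 2 - x0 * x2) * e - (x0 * c1 + x1 * c2) = - x0 * (c1 + x2 * e) + - x1 * (c2 - x1 * e)"
        for x0 x1 x2 :: "'a poly3"
        by algebra+
      then show ?thesis unfolding a_eq 2(2) lin sub by (simp only:)
    qed
    then show ?thesis
      using 2(1) by (intro exI[of _ "[:c1 + X 2 * e:]"] exI[of _ "[:c2 - X 1 * e:]"]) (simp only: poly_bounded_pCons, simp)
  qed
qed


lemma X_nonzero: "(X i :: 'a::comm_ring_1 poly3) \<noteq> 0"
  by (simp add: X_def flip: keys_eq_empty)

text \<open>The two linear polynomials have only the trivial syzygies. The lowest coefficients of a syzygy satisfy
  \<open>x\<^sub>1e\<^sub>1 + x\<^sub>2e\<^sub>2 = 0\<close>, so they are \<open>x\<^sub>2c\<close> and \<open>- x\<^sub>1c\<close>; subtract the trivial syzygy with the factor \<open>c\<close> and divide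
  by \<open>Y\<close>.\<close>

lemma line_syzygies:
  fixes b1 b2 :: "'a::idom poly3 poly"
  shows "poly_bounded r b1 \<Longrightarrow> poly_bounded r b2 \<Longrightarrow> line1 * b1 + line2 * b2 = 0 \<Longrightarrow>
    \<exists>c. poly_bounded (r - 1) c \<and> b1 = line2 * c \<and> b2 = - (line1 * c)"
proof (induction r arbitrary: b1 b2 rule: less_induct)
  case (less r)
  show ?case
  proof (cases r)
    case 0
    then show ?thesis using less.prems by (intro exI[of _ 0]) simp
  next
    case (Suc r')
    obtain e1 b1' where b1: "b1 = pCons e1 b1'" by (cases b1)
    obtain e2 b2' where b2: "b2 = pCons e2 b2'" by (cases b2)
    have bd: "poly_bounded r' b1'" "poly_bounded r' b2'"
      using less.prems(1,2) by (simp_all add: Suc b1 b2 poly_bounded_pCons)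
    have rel: "pCons (X 1 * e1 + X 2 * e2) (([:- X 0 * e1:] + line1 * b1') + ([:- X 1 * e2:] + line2 * b2')) = 0"
      using less.prems(3) unfolding b1 b2 line_mult_pCons by (simp only: add_pCons)
    then have rel1: "X 1 * e1 + X 2 * e2 = 0"
      and rel2: "([:- X 0 * e1:] + line1 * b1') + ([:- X 1 * e2:] + line2 * b2') = 0"
      unfolding pCons_eq_0_iff by blast+
    have "X 1 * e1 = X 2 * (- e2)" using rel1 by (simp only: eq_neg_iff_add_eq_0 mult_minus_right)
    then have "X 2 dvd e1" by (rule X_two_dvd_of_mult_X_one)
    then obtain c where e1: "e1 = X 2 * c" by (rule dvdE)
    have "X 2 * (X 1 * c + e2) = 0" using rel1 unfolding e1 by (simp only: distrib_left mult_ac)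
    moreover have "(X 2 :: 'a poly3) \<noteq> 0" by (rule X_nonzero)
    ultimately have "X 1 * c + e2 = 0" by (simp only: mult_eq_0_iff simp_thms)
    then have e2: "e2 = - (X 1 * c)" by (simp only: add.commute eq_neg_iff_add_eq_0)
    have sum: "line1 * b1' + line2 * b2' + [:conic * c:] = 0"
    proof -
      have "[:- X 0 * e1:] + [:- X 1 * e2:] = [:conic * c:]"
      proof -
        have "- X 0 * (X 2 * c) + - X 1 * (- (X 1 * c)) = conic * c" by algebra
        moreover have "[:x:] + [:y:] = [:x + y:]" for x y :: "'a poly3" by simp
        ultimately show ?thesis unfolding e1 e2 by (simp only:)
      qed
      moreover have "line1 * b1' + line2 * b2' + ([:- X 0 * e1:] + [:- X 1 * e2:]) = 0"
        using rel2 by (simp only: add_ac)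
      ultimately show ?thesis by (simp only:)
    qed
    show ?thesis
    \<comment> \<open>For constant \<open>b\<^sub>1\<close>, \<open>b\<^sub>2\<close> the trivial syzygy with the factor \<open>c\<close> has too large a degree to be subtracted,
        but then the coefficient of \<open>Y\<close> shows that \<open>c\<close> times the conic is zero.\<close>
    proof (cases r')
      case 0
      then have "[:conic * c:] = 0" using sum bd by simp
      then have "conic * c = 0" by (simp only: pCons_eq_0_iff simp_thms)
      moreover have "(conic :: 'a poly3) \<noteq> 0" by (rule conic_nonzero)
      ultimately have "c = 0" by (simp only: mult_eq_0_iff simp_thms)
      then have "b1 = 0" "b2 = 0" using bd by (simp_all add: 0 b1 b2 e1 e2)
      then show ?thesis by (intro exI[of _ 0]) simp
    next
      case (Suc r'')
      define b1'' where "b1'' = b1' + [:X 1 * c:]"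
      define b2'' where "b2'' = b2' - [:X 0 * c:]"
      have "poly_bounded r' b1''" "poly_bounded r' b2''"
        unfolding b1''_def b2''_def using bd Suc
        by (auto intro!: poly_bounded_add poly_bounded_diff simp: poly_bounded_pCons)
      moreover have "line1 * b1'' + line2 * b2'' = 0"
      proof -
        have "line1 * [:X 1 * c:] - line2 * [:X 0 * c:] = [:conic * c:]"
        proof -
          have "X 1 * (X 1 * c) - X 2 * (X 0 * c) = conic * c" "- X 0 * (X 1 * c) - - X 1 * (X 0 * c) = 0"
            by algebra+
          moreover have "[:x, y:] * [:u:] - [:x', y':] * [:w:] = [:x * u - x' * w, y * u - y' * w:]"
            for x y x' y' u w :: "'a poly3" by simp
          moreover have "[:x, 0:] = [:x:]" for x :: "'a poly3" by simp
          ultimately show ?thesis by (simp only:)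
        qed
        moreover have "line1 * b1'' + line2 * b2'' = line1 * b1' + line2 * b2' + (line1 * [:X 1 * c:] - line2 * [:X 0 * c:])"
          unfolding b1''_def b2''_def by (simp only: diff_conv_add_uminus distrib_left mult_minus_right add_ac)
        ultimately show ?thesis using sum by (simp only:)
      qed
      ultimately obtain c'' where c'': "poly_bounded (r' - 1) c''" "b1'' = line2 * c''" "b2'' = - (line1 * c'')"
        using less.IH[of r' b1'' b2''] \<open>r = Suc r'\<close> by auto
      have "b1 = line2 * pCons c c''"
        unfolding line_mult_pCons c''(2)[symmetric] b1 e1 b1''_def by simp
      moreover have "b2 = - (line1 * pCons c c'')"
      proof -
        have e: "line1 * c'' = - b2''" using c''(3) by (simp only: minus_minus)
        have "- ([:- X 0 * c:] + - b2'') = b2'"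
        proof -
          have "- [:- X 0 * c:] = [:X 0 * c:]" by simp
          then show ?thesis unfolding b2''_def
            by (simp only: minus_add_distrib minus_minus add_diff_eq add_diff_cancel_left')
        qed
        then show ?thesis unfolding line_mult_pCons e b2 e2 minus_pCons by (simp only:)
      qed
      moreover have "poly_bounded (r - 1) (pCons c c'')"
        using c''(1) by (simp add: poly_bounded_pCons Suc \<open>r = Suc r'\<close>)
      ultimately show ?thesis by blast
    qed
  qed
qed

text \<open>The ideal is \<open>\<langle>f\<^sub>1, f\<^sub>2, q\<rangle>\<close>; \<open>rel1\<close> and \<open>rel2\<close> are the relations between the generators, where \<open>Z\<close> stands for the
  conic \<open>q\<close>, \<open>1\<close> for \<open>f\<^sub>1\<close> and \<open>Y\<close> for \<open>f\<^sub>2\<close>.\<close>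

locale odd_conic_ideal =
  fixes A B :: "'a::field poly3"
  assumes param_nonzero: "param (X 0 * A + X 1 * B) \<noteq> 0"
begin

abbreviation "f1 \<equiv> X 0 * A + X 1 * B"
abbreviation "f2 \<equiv> X 1 * A + X 2 * B"
abbreviation "rel1 \<equiv> [:line1, [:- B:]:]"
abbreviation "rel2 \<equiv> [:line2, [:A:]:]"

lemma relations: "X 1 * f1 + - X 0 * f2 = conic * B" "X 2 * f1 + - X 1 * f2 = - (conic * A)"
  by algebra+

text \<open>On the cone \<open>f\<^sub>2 = t f\<^sub>1\<close>.\<close>

lemma param_eval_form: "param (eval_form f1 f2 r a) = param f1 ^ r * eval_at_t r a"
proof -
  have f2: "param f2 = param_t * param f1"
    by (simp only: param.subst_add param.subst_mult param_X_two param_X_one distrib_left mult_ac)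
  have "param (coeff a l * f1 ^ (r - l) * f2 ^ l) = param f1 ^ r * (param (coeff a l) * param_t ^ l)" if "l \<le> r" for l
  proof -
    have "param f1 ^ r = param f1 ^ (r - l) * param f1 ^ l"
      using that by (simp flip: power_add)
    then show ?thesis
      unfolding param.subst_mult[of _ "f2 ^ l"] param.subst_mult[of _ "f1 ^ (r - l)"] param.subst_power f2 power_mult_distrib
      by (simp only: mult_ac)
  qed
  then show ?thesis
    unfolding eval_form_def eval_at_t_def param.subst_sum sum_distrib_left
    by (intro sum.cong) (simp_all only: atMost_iff)
qed

text \<open>Let \<open>a\<close> be the part of \<open>P\<close> without \<open>Z\<close>. Its value is a multiple of the conic, so \<open>a\<close> vanishes at \<open>Y = t\<close> on the
  cone and is a combination of the two linear polynomials. Subtracting the same combination of the relations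
  leaves a multiple of \<open>Z\<close>, whose value is the conic times the value of the quotient; the conic cancels and
  the quotient has smaller degree.\<close>

lemma biform_eq_zero:
  "bipoly_bounded (Suc r) P \<Longrightarrow> eval_biform f1 f2 conic r P = 0 \<Longrightarrow>
    \<exists>b1 b2. bipoly_bounded r b1 \<and> bipoly_bounded r b2 \<and> P = rel1 * b1 + rel2 * b2"
proof (induction r arbitrary: P)
  case 0
  obtain c a P' where P: "P = pCons (pCons c a) P'" by (metis pCons_cases)
  then have "P = 0" using 0 by (simp add: bipoly_bounded_pCons poly_bounded_pCons)
  then show ?case by (intro exI[of _ 0]) simp
next
  case (Suc r)
  obtain a P' where P: "P = pCons a P'" by (cases P)
  have bd: "poly_bounded (Suc (Suc r)) a" "bipoly_bounded (Suc r) P'"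
    using Suc.prems(1) by (simp_all add: P bipoly_bounded_pCons)
  have z: "eval_form f1 f2 (Suc r) a + conic * eval_biform f1 f2 conic r P' = 0"
    using Suc.prems(2) by (simp only: P eval_biform_pCons)
  have "param (eval_form f1 f2 (Suc r) a) + 0 * param (eval_biform f1 f2 conic r P') = 0"
    using arg_cong[OF z, of param] by (simp only: param.subst_add[of "eval_form _ _ _ _"] param.subst_mult[of conic] param_conic param.subst_zero)
  then have "param f1 ^ Suc r * eval_at_t (Suc r) a = 0"
    by (simp only: param_eval_form mult_zero_left add_0_right)
  then have "eval_at_t (Suc r) a = 0"
    using param_nonzero by (simp only: mult_eq_0_iff power_eq_0_iff simp_thms)
  then obtain c1 c2 where c: "poly_bounded (Suc r) c1" "poly_bounded (Suc r) c2" and a: "a = line1 * c1 + line2 * c2"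
    using eval_at_t_eq_zero[OF bd(1)] by blast
  define P'' where "P'' = P' + ([:smult B c1:] - [:smult A c2:])"
  have P''_bd: "bipoly_bounded (Suc r) P''"
    unfolding P''_def using bd c
    by (intro bipoly_bounded_add bipoly_bounded_diff) (simp_all add: bipoly_bounded_pCons poly_bounded_smult)
  have a_eval: "eval_form f1 f2 (Suc r) a
      = conic * B * eval_form f1 f2 r c1 + - (conic * A) * eval_form f1 f2 r c2"
    unfolding a eval_form_add eval_form_linear_mult[OF c(1)] eval_form_linear_mult[OF c(2)] relations ..
  have ev_diff: "eval_biform f1 f2 conic r (Q - Q') = eval_biform f1 f2 conic r Q - eval_biform f1 f2 conic r Q'" for Q Q'
    using eval_biform_add[of f1 f2 conic r "Q - Q'" Q'] by (simp only: diff_add_cancel eq_diff_eq)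
  have "conic * eval_biform f1 f2 conic r P''
      = eval_form f1 f2 (Suc r) a + conic * eval_biform f1 f2 conic r P'"
    unfolding a_eval P''_def eval_biform_add ev_diff eval_biform_const eval_form_smult
    by (simp only: distrib_left right_diff_distrib mult_minus_left mult_minus_right mult.assoc diff_conv_add_uminus add_ac)
  then have "eval_biform f1 f2 conic r P'' = 0"
  proof -
    have "(conic :: 'a poly3) \<noteq> 0" by (rule conic_nonzero)
    then show ?thesis
      using z \<open>conic * eval_biform f1 f2 conic r P'' = _\<close> by (simp only: mult_eq_0_iff simp_thms)
  qed
  then obtain b1 b2 where b: "bipoly_bounded r b1" "bipoly_bounded r b2" "P'' = rel1 * b1 + rel2 * b2"
    using Suc.IH[OF P''_bd] by blast
  have "P = rel1 * pCons c1 b1 + rel2 * pCons c2 b2"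
  proof -
    have "P' = ([:[:- B:] * c1:] + rel1 * b1) + ([:[:A:] * c2:] + rel2 * b2)"
    proof -
      have "P' = P'' - ([:smult B c1:] - [:smult A c2:])" by (simp only: P''_def add_diff_cancel_right')
      moreover have "[:[:- B:] * c1:] = - [:smult B c1:]" "[:[:A:] * c2:] = [:smult A c2:]" by simp_all
      ultimately show ?thesis unfolding b(3) by (simp only: diff_conv_add_uminus minus_add_distrib minus_minus add_ac)
    qed
    then show ?thesis unfolding P a line_mult_pCons add_pCons by (simp only:)
  qed
  then show ?case
    using b c by (intro exI[of _ "pCons c1 b1"] exI[of _ "pCons c2 b2"]) (simp add: bipoly_bounded_pCons)
qed

text \<open>Modulo \<open>Z\<close> this is the corresponding statement for the linear polynomials; after subtraction of a trivial
  syzygy everything is divisible by \<open>Z\<close>.\<close>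

lemma relation_syzygies:
  "bipoly_bounded r b1 \<Longrightarrow> bipoly_bounded r b2 \<Longrightarrow> rel1 * b1 + rel2 * b2 = 0 \<Longrightarrow>
    \<exists>c. bipoly_bounded (r - 1) c \<and> b1 = rel2 * c \<and> b2 = - (rel1 * c)"
proof (induction r arbitrary: b1 b2)
  case 0
  then show ?case by (intro exI[of _ 0]) simp
next
  case (Suc r)
  obtain c1 b1' where b1: "b1 = pCons c1 b1'" by (cases b1)
  obtain c2 b2' where b2: "b2 = pCons c2 b2'" by (cases b2)
  have bd: "poly_bounded (Suc r) c1" "bipoly_bounded r b1'" "poly_bounded (Suc r) c2" "bipoly_bounded r b2'"
    using Suc.prems(1,2) by (simp_all add: b1 b2 bipoly_bounded_pCons)
  have "pCons (line1 * c1 + line2 * c2)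
      (([:[:- B:] * c1:] + rel1 * b1') + ([:[:A:] * c2:] + rel2 * b2')) = 0"
    using Suc.prems(3) unfolding b1 b2 line_mult_pCons by (simp only: add_pCons)
  then have row: "line1 * c1 + line2 * c2 = 0"
    and tail: "([:[:- B:] * c1:] + rel1 * b1') + ([:[:A:] * c2:] + rel2 * b2') = 0"
    unfolding pCons_eq_0_iff by blast+
  obtain c where c: "poly_bounded r c" "c1 = line2 * c" "c2 = - (line1 * c)"
    using line_syzygies[OF bd(1,3) row] by auto
  define b1'' where "b1'' = b1' - [:[:A:] * c:]"
  define b2'' where "b2'' = b2' - [:[:B:] * c:]"
  have b''_bd: "bipoly_bounded r b1''" "bipoly_bounded r b2''"
    unfolding b1''_def b2''_def using bd c(1)
    by (auto intro!: bipoly_bounded_diff simp: bipoly_bounded_pCons poly_bounded_smult)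
  have const: "rel1 * [:[:A:] * c:] + rel2 * [:[:B:] * c:] = - [:[:- B:] * c1:] - [:[:A:] * c2:]"
  proof -
    have "[:l, m:] * [:x:] + [:l', m':] * [:y:] = [:l * x + l' * y, m * x + m' * y:]" for l m l' m' x y :: "'a poly3 poly"
      by simp
    moreover have "- [:x:] - [:y:] = [:- x - y, 0:]" for x y :: "'a poly3 poly"
      by simp
    moreover have "[:- B:] * ([:A:] * c) + [:A:] * ([:B:] * c) = 0"
      by (simp add: mult.commute)
    moreover have "line1 * ([:A:] * c) + line2 * ([:B:] * c) = - ([:- B:] * c1) - ([:A:] * c2)"
    proof -
      have "[:- B:] = - [:B:]" by simp
      then show ?thesis unfolding c(2,3)
        by (simp only: mult_minus_left mult_minus_right minus_minus diff_conv_add_uminus mult_ac add_ac)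
    qed
    ultimately show ?thesis by (simp only:)
  qed
  have "rel1 * b1'' + rel2 * b2'' = 0"
  proof -
    have "rel1 * b1'' + rel2 * b2'' = rel1 * b1' + rel2 * b2' - (rel1 * [:[:A:] * c:] + rel2 * [:[:B:] * c:])"
      unfolding b1''_def b2''_def by (simp only: diff_conv_add_uminus distrib_left mult_minus_right minus_add_distrib add_ac)
    also have "\<dots> = ([:[:- B:] * c1:] + rel1 * b1') + ([:[:A:] * c2:] + rel2 * b2')"
      unfolding const by (simp only: diff_conv_add_uminus minus_add_distrib minus_minus add_ac)
    finally show ?thesis unfolding tail .
  qed
  then obtain c' where c': "bipoly_bounded (r - 1) c'" "b1'' = rel2 * c'" "b2'' = - (rel1 * c')"
    using Suc.IH[OF b''_bd] by blast
  have "b1 = rel2 * pCons c c'"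
    unfolding line_mult_pCons c'(2)[symmetric] b1 c(2) b1''_def
    by (simp only: add_diff_eq add_diff_cancel_left')
  moreover have "b2 = - (rel1 * pCons c c')"
  proof -
    have e: "rel1 * c' = - b2''" using c'(3) by (simp only: minus_minus)
    have "- [:[:- B:] * c:] = [:[:B:] * c:]" by simp
    then have "- ([:[:- B:] * c:] + rel1 * c') = b2'"
      unfolding e b2''_def by (simp only: minus_add_distrib minus_minus add_diff_eq add_diff_cancel_left')
    then show ?thesis unfolding line_mult_pCons b2 c(3) minus_pCons by (simp only:)
  qed
  moreover have "bipoly_bounded (Suc r - 1) (pCons c c')"
    using c(1) c'(1) by (simp add: bipoly_bounded_pCons)
  ultimately show ?case by blast
qed

end


section \<open>Powers of the ideal of an odd number of points\<close>

lemma triangle_mono: "m \<le> n \<Longrightarrow> triangle m \<le> triangle n"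
  by (rule lift_Suc_mono_le[of triangle]) simp_all

text \<open>The pairing function enumerates the pairs along the diagonals, so the pairs of sum less than \<open>n\<close>
  correspond to an initial segment.\<close>

lemma prod_encode_less_triangle_iff: "prod_encode (k, l) < triangle n \<longleftrightarrow> k + l < n"
proof
  assume *: "prod_encode (k, l) < triangle n"
  show "k + l < n"
  proof (rule ccontr)
    assume "\<not> k + l < n"
    then have "triangle n \<le> triangle (k + l)" by (intro triangle_mono) simp
    then show False using * by (simp add: prod_encode_def)
  qed
next
  assume "k + l < n"
  then have "triangle (Suc (k + l)) \<le> triangle n" by (intro triangle_mono) simp
  then show "prod_encode (k, l) < triangle n" by (simp add: prod_encode_def)
qed

lemma less_triangle_iff: "i < triangle n \<longleftrightarrow> fst (prod_decode i) + snd (prod_decode i) < n"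
  using prod_encode_less_triangle_iff[of "fst (prod_decode i)" "snd (prod_decode i)" n] by simp

text \<open>Together with \<open>bipoly_of\<close> this identifies the polynomials of total degree less than \<open>n\<close> with
  \<open>free_module (triangle n)\<close>.\<close>

definition coords :: "'r::comm_ring_1 poly poly \<Rightarrow> nat \<Rightarrow> 'r"
  where "coords P i = coeff (coeff P (fst (prod_decode i))) (snd (prod_decode i))"

definition bipoly_of :: "(nat \<Rightarrow> 'r::comm_ring_1) \<Rightarrow> 'r poly poly"
  where "bipoly_of v = poly_of (\<lambda>k. poly_of (\<lambda>l. v (prod_encode (k, l))))"

lemma coeff_bipoly_of:
  assumes "v \<in> free_module (triangle n)"
  shows "coeff (coeff (bipoly_of v) k) l = v (prod_encode (k, l))"
proof -
  have z: "v (prod_encode (k, l)) = 0" if "n \<le> k + l" for k l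
    using assms prod_encode_less_triangle_iff[of k l n] that by (simp add: free_module_def not_less[symmetric])
  have inner: "(\<lambda>l. v (prod_encode (k, l))) \<in> free_module n" for k
    using z by (simp add: free_module_def)
  have "(\<lambda>k. poly_of (\<lambda>l. v (prod_encode (k, l)))) \<in> free_module n"
    unfolding free_module_def
  proof (intro CollectI allI impI)
    fix k assume "n \<le> k"
    then have "(\<lambda>l. v (prod_encode (k, l))) = 0" using z by (intro ext) simp
    then show "poly_of (\<lambda>l. v (prod_encode (k, l))) = 0" by (simp only: poly_of_zero)
  qed
  then show ?thesis
    unfolding bipoly_of_def by (simp only: coeff_poly_of coeff_poly_of[OF inner])
qed

lemma coords_bipoly_of: "v \<in> free_module (triangle n) \<Longrightarrow> coords (bipoly_of v) = v"
  by (rule ext) (simp add: coords_def coeff_bipoly_of)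

lemma bipoly_bounded_iff_coords: "bipoly_bounded n P \<longleftrightarrow> coords P \<in> free_module (triangle n)"
proof
  assume "bipoly_bounded n P"
  then show "coords P \<in> free_module (triangle n)"
    by (simp add: free_module_def coords_def bipoly_bounded_def not_less[symmetric] less_triangle_iff)
next
  assume *: "coords P \<in> free_module (triangle n)"
  have "coeff (coeff P k) l = 0" if "n \<le> k + l" for k l
  proof -
    have "triangle n \<le> prod_encode (k, l)"
      using that by (simp add: not_less[symmetric] prod_encode_less_triangle_iff)
    then have "coords P (prod_encode (k, l)) = 0" using * by (simp add: free_module_def)
    then show ?thesis by (simp add: coords_def)
  qed
  then show "bipoly_bounded n P" by (simp add: bipoly_bounded_def)
qed

lemma bipoly_bounded_bipoly_of: "v \<in> free_module (triangle n) \<Longrightarrow> bipoly_bounded n (bipoly_of v)"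
  unfolding bipoly_bounded_iff_coords by (simp only: coords_bipoly_of)

lemma bipoly_of_coords:
  assumes "bipoly_bounded n P" shows "bipoly_of (coords P) = P"
proof -
  have "coords P \<in> free_module (triangle n)" using assms by (simp only: bipoly_bounded_iff_coords)
  then show ?thesis by (intro poly_eqI) (simp add: coeff_bipoly_of, simp add: coords_def)
qed

lemma bipoly_of_add:
  assumes "v \<in> free_module (triangle n)" "w \<in> free_module (triangle n)"
  shows "bipoly_of (v + w) = bipoly_of v + bipoly_of w"
  by (intro poly_eqI)
    (simp only: coeff_add coeff_bipoly_of[OF assms(1)] coeff_bipoly_of[OF assms(2)]
      coeff_bipoly_of[OF free_module_add[OF assms]] plus_fun_apply)

lemma bipoly_of_scale:
  assumes "v \<in> free_module (triangle n)"
  shows "bipoly_of (\<lambda>i. c * v i) = smult [:c:] (bipoly_of v)"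
proof (intro poly_eqI)
  fix k l
  have "coeff (smult [:c:] (bipoly_of v)) k = smult c (coeff (bipoly_of v) k)" by simp
  then show "coeff (coeff (bipoly_of (\<lambda>i. c * v i)) k) l = coeff (coeff (smult [:c:] (bipoly_of v)) k) l"
    by (simp only: coeff_smult coeff_bipoly_of[OF assms] coeff_bipoly_of[OF free_module_scale[OF assms]])
qed

lemma bipoly_of_zero: "bipoly_of 0 = 0"
  by (intro poly_eqI) (simp add: coeff_bipoly_of[of 0 0])

lemma bipoly_of_unit_vec:
  "bipoly_of (unit_vec i) = monom (monom 1 (snd (prod_decode i))) (fst (prod_decode i))"
proof (intro poly_eqI)
  fix k l
  have "i < triangle (Suc (fst (prod_decode i) + snd (prod_decode i)))"
    unfolding less_triangle_iff by simp
  then have u: "(unit_vec i :: nat \<Rightarrow> 'a) \<in> free_module (triangle (Suc (fst (prod_decode i) + snd (prod_decode i))))"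
    by (rule unit_vec_in_free_module)
  have "prod_encode (k, l) = i \<longleftrightarrow> (k, l) = prod_decode i"
    by (metis prod_decode_inverse prod_encode_inverse)
  then have "prod_encode (k, l) = i \<longleftrightarrow> k = fst (prod_decode i) \<and> l = snd (prod_decode i)"
    by (auto simp: prod_eq_iff)
  then show "coeff (coeff (bipoly_of (unit_vec i)) k) l
      = coeff (coeff (monom (monom (1 :: 'a) (snd (prod_decode i))) (fst (prod_decode i))) k) l"
    unfolding coeff_bipoly_of[OF u] by (auto simp: unit_vec_def)
qed

lemma coords_add: "coords (P + Q) = coords P + coords Q"
  by (rule ext) (simp add: coords_def)

lemma coords_uminus: "coords (- P) = (\<lambda>i. - coords P i)"
  by (rule ext) (simp add: coords_def)

lemma coords_const_smult: "coords (smult [:c:] P) = (\<lambda>i. c * coords P i)"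
  by (rule ext) (simp add: coords_def)

lemma coords_eq_zero_iff: "coords P = 0 \<longleftrightarrow> P = 0"
proof
  assume *: "coords P = 0"
  have "coeff (coeff P k) l = 0" for k l
    using fun_cong[OF *, of "prod_encode (k, l)"] by (simp add: coords_def)
  then show "P = 0" by (intro poly_eqI) simp
qed (auto simp: coords_def)

lemma coords_zero: "coords 0 = 0"
  by (simp only: coords_eq_zero_iff)

lemma coords_linear_mult_unit_vec:
  "coords ([:[:c0, c1:], [:e:]:] * bipoly_of (unit_vec i)) p =
    (if fst (prod_decode p) = fst (prod_decode i) then
       (if snd (prod_decode p) = snd (prod_decode i) then c0
        else if snd (prod_decode p) = Suc (snd (prod_decode i)) then c1 else 0)
     else if fst (prod_decode p) = Suc (fst (prod_decode i)) \<and> snd (prod_decode p) = snd (prod_decode i) then e else 0)"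
proof -
  obtain k l where i: "prod_decode i = (k, l)" by fastforce
  obtain k' l' where p: "prod_decode p = (k', l')" by fastforce
  have "[:c0, c1:] * monom 1 l = monom c0 l + monom c1 (Suc l)"
    by (simp add: smult_monom flip: monom_Suc)
  moreover have "[:e:] * monom 1 l = monom e l" by (simp add: smult_monom)
  moreover have "[:[:c0, c1:], [:e:]:] * monom (monom 1 l) k
      = monom ([:c0, c1:] * monom 1 l) k + monom ([:e:] * monom 1 l) (Suc k)"
    unfolding linear_mult_eq[of "[:c0, c1:]" "[:e:]"] smult_monom monom_Suc by (rule refl)
  ultimately have "[:[:c0, c1:], [:e:]:] * monom (monom 1 l) k
      = monom (monom c0 l + monom c1 (Suc l)) k + monom (monom e l) (Suc k)"
    by (simp only:)
  then have "coords ([:[:c0, c1:], [:e:]:] * bipoly_of (unit_vec i)) p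
      = coeff (coeff (monom (monom c0 l + monom c1 (Suc l)) k + monom (monom e l) (Suc k)) k') l'"
    unfolding coords_def bipoly_of_unit_vec i p by (simp only: fst_conv snd_conv)
  then show ?thesis by (simp add: i p)
qed


text \<open>A pair of vectors is stored as a single vector by interleaving.\<close>

definition evens :: "(nat \<Rightarrow> 'r) \<Rightarrow> nat \<Rightarrow> 'r" where "evens v i = v (2 * i)"

definition odds :: "(nat \<Rightarrow> 'r) \<Rightarrow> nat \<Rightarrow> 'r" where "odds v i = v (2 * i + 1)"

definition interleave :: "(nat \<Rightarrow> 'r) \<Rightarrow> (nat \<Rightarrow> 'r) \<Rightarrow> nat \<Rightarrow> 'r"
  where "interleave v w i = (if even i then v (i div 2) else w (i div 2))"

lemma evens_interleave: "evens (interleave v w) = v" and odds_interleave: "odds (interleave v w) = w"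
  by (simp_all add: fun_eq_iff evens_def odds_def interleave_def)

lemma interleave_evens_odds: "interleave (evens v) (odds v) = v"
  by (simp add: fun_eq_iff evens_def odds_def interleave_def)

lemma evens_in_free_module: "v \<in> free_module (2 * n) \<Longrightarrow> evens v \<in> free_module n"
  and odds_in_free_module: "v \<in> free_module (2 * n) \<Longrightarrow> odds v \<in> free_module n"
  by (simp_all add: free_module_def evens_def odds_def)

lemma interleave_in_free_module:
  assumes "v \<in> free_module n" "w \<in> free_module n"
  shows "interleave v w \<in> free_module (2 * n)"
proof -
  have "n \<le> i div 2" if "2 * n \<le> i" for i using that by linarith
  then show ?thesis using assms by (simp add: free_module_def interleave_def)
qed

lemma evens_add: "evens (v + w) = evens v + evens (w :: nat \<Rightarrow> 'r::comm_ring_1)"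
  and odds_add: "odds (v + w) = odds v + odds w"
  by (simp_all add: fun_eq_iff evens_def odds_def)

lemma evens_scale: "evens (\<lambda>l. c * v l) = (\<lambda>l. c * evens v l)"
  and odds_scale: "odds (\<lambda>l. c * v l) = (\<lambda>l. c * odds v l)" for v :: "nat \<Rightarrow> 'r::comm_ring_1"
  by (simp_all add: fun_eq_iff evens_def odds_def)

lemma evens_unit_vec: "evens (unit_vec q) = (if even q then unit_vec (q div 2) else (0 :: nat \<Rightarrow> 'r::comm_ring_1))"
  and odds_unit_vec: "odds (unit_vec q) = (if even q then 0 else (unit_vec (q div 2) :: nat \<Rightarrow> 'r::comm_ring_1))"
proof -
  have "2 * i = q \<longleftrightarrow> even q \<and> i = q div 2" "2 * i + 1 = q \<longleftrightarrow> odd q \<and> i = q div 2" for i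
    by presburger+
  then show "evens (unit_vec q) = (if even q then unit_vec (q div 2) else (0 :: nat \<Rightarrow> 'r))"
    "odds (unit_vec q) = (if even q then 0 else (unit_vec (q div 2) :: nat \<Rightarrow> 'r))"
    by (auto simp only: fun_eq_iff evens_def odds_def unit_vec_def if_True if_False zero_fun_apply split: if_splits)
qed

lemma interleave_zero: "interleave (0 :: nat \<Rightarrow> 'r::comm_ring_1) 0 = 0"
  by (simp add: fun_eq_iff interleave_def)

lemma interleave_eq_zero_iff: "interleave v w = 0 \<longleftrightarrow> v = 0 \<and> w = (0 :: nat \<Rightarrow> 'r::comm_ring_1)"
proof
  assume *: "interleave v w = 0"
  have "v = evens (interleave v w)" "w = odds (interleave v w)"
    by (simp_all only: evens_interleave odds_interleave)
  then show "v = 0 \<and> w = 0"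
    unfolding * by (simp add: fun_eq_iff evens_def odds_def)
qed (simp only: interleave_zero)

lemma sum_triangle:
  fixes F :: "nat \<Rightarrow> nat \<Rightarrow> 'b::comm_monoid_add"
  shows "(\<Sum>i<triangle (Suc r). F (fst (prod_decode i)) (snd (prod_decode i))) = (\<Sum>k\<le>r. \<Sum>l\<le>r - k. F k l)"
proof -
  have "(\<Sum>k\<le>r. \<Sum>l\<le>r - k. F k l) = (\<Sum>(k, l)\<in>(SIGMA k:{..r}. {..r - k}). F k l)"
    by (rule sum.Sigma) auto
  also have "\<dots> = (\<Sum>i<triangle (Suc r). F (fst (prod_decode i)) (snd (prod_decode i)))"
  proof (rule sum.reindex_bij_witness[of _ prod_decode prod_encode])
    fix x assume "x \<in> (SIGMA k:{..r}. {..r - k})"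
    then obtain k l where x: "x = (k, l)" "k \<le> r" "l \<le> r - k" by blast
    then have "prod_encode (k, l) < triangle (Suc r)" unfolding prod_encode_less_triangle_iff by simp
    then show "prod_encode x \<in> {..<triangle (Suc r)}" by (simp only: x lessThan_iff)
  next
    fix i assume "i \<in> {..<triangle (Suc r)}"
    then have "fst (prod_decode i) + snd (prod_decode i) < Suc r" by (simp only: lessThan_iff less_triangle_iff)
    then have "(fst (prod_decode i), snd (prod_decode i)) \<in> (SIGMA k:{..r}. {..r - k})"
      by (intro SigmaI) (unfold atMost_iff, linarith+)
    then show "prod_decode i \<in> (SIGMA k:{..r}. {..r - k})" by (simp only: prod.collapse)
  qed (simp_all add: case_prod_beta)
  finally show ?thesis ..
qed

locale odd_conic_ideal_power = odd_conic_ideal A B for A B :: "'a::field poly3" +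
  fixes d r :: nat
  assumes d: "2 \<le> d" and r: "1 \<le> r"
    and A: "homogeneous A (int d - 1)" and B: "homogeneous B (int d - 1)"
begin

text \<open>The degree of the product of generators that corresponds to the monomial \<open>Z\<^sup>kY\<^sup>l\<close> with index \<open>i\<close>: \<open>k\<close> factors are
  the conic and \<open>r - k\<close> factors have degree \<open>d\<close>. The relations have degree \<open>d + 1\<close>, one more than \<open>f\<^sub>1\<close> and \<open>f\<^sub>2\<close>, so the basis
  elements in homological degrees one and two have degrees \<open>weight + 1\<close> and \<open>weight + 2\<close>.\<close>

definition weight :: "nat \<Rightarrow> int"
  where "weight i = int d * (int r - int (fst (prod_decode i))) + 2 * int (fst (prod_decode i))"

definition gen :: "nat \<Rightarrow> 'a poly3"
  where "gen i = conic ^ fst (prod_decode i) * (f1 ^ (r - fst (prod_decode i) - snd (prod_decode i)) * f2 ^ snd (prod_decode i))"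

text \<open>The differentials of the Koszul complex, \<open>(b\<^sub>1, b\<^sub>2) \<mapsto> \<rho>\<^sub>1b\<^sub>1 + \<rho>\<^sub>2b\<^sub>2\<close> and \<open>c \<mapsto> (\<rho>\<^sub>2c, - \<rho>\<^sub>1c)\<close>, in coordinates.\<close>

definition D0 :: "(nat \<Rightarrow> 'a poly3) \<Rightarrow> nat \<Rightarrow> 'a poly3"
  where "D0 v = coords (rel1 * bipoly_of (evens v) + rel2 * bipoly_of (odds v))"

definition D1 :: "(nat \<Rightarrow> 'a poly3) \<Rightarrow> nat \<Rightarrow> 'a poly3"
  where "D1 v = interleave (coords (rel2 * bipoly_of v)) (coords (- (rel1 * bipoly_of v)))"

lemma homogeneous_generators: "homogeneous f1 (int d)" "homogeneous f2 (int d)"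
proof -
  have "homogeneous (X i * A) (int d)" "homogeneous (X i * B) (int d)" for i
    using homogeneous_mult[OF homogeneous_X A, of i] homogeneous_mult[OF homogeneous_X B, of i] by simp_all
  then show "homogeneous f1 (int d)" "homogeneous f2 (int d)" by (auto intro: homogeneous_add)
qed

lemma gen_homogeneous:
  assumes "i < triangle (Suc r)"
  shows "homogeneous (gen i) (weight i)"
proof -
  obtain k l where i: "prod_decode i = (k, l)" by fastforce
  have kl: "k + l \<le> r" using assms by (simp add: less_triangle_iff i del: triangle_Suc)
  have "homogeneous (conic ^ k * (f1 ^ (r - k - l) * f2 ^ l)) (int k * 2 + (int (r - k - l) * int d + int l * int d))"
    by (intro homogeneous_mult homogeneous_power homogeneous_generators homogeneous_conic)
  moreover have "int k * 2 + (int (r - k - l) * int d + int l * int d) = weight i"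
  proof -
    have "int (r - k - l) = int r - int k - int l" using kl by simp
    then show ?thesis unfolding weight_def i fst_conv by algebra
  qed
  ultimately show ?thesis
    unfolding gen_def i fst_conv snd_conv by (simp only:)
qed

lemma gen_sum:
  assumes "v \<in> free_module (triangle (Suc r))"
  shows "(\<Sum>i<triangle (Suc r). gen i * v i) = eval_biform f1 f2 conic r (bipoly_of v)"
proof -
  let ?F = "\<lambda>k l. conic ^ k * (f1 ^ (r - k - l) * f2 ^ l) * v (prod_encode (k, l))"
  have "(\<Sum>i<triangle (Suc r). gen i * v i)
      = (\<Sum>i<triangle (Suc r). ?F (fst (prod_decode i)) (snd (prod_decode i)))"
    by (simp only: gen_def prod.collapse prod_decode_inverse)
  also have "\<dots> = (\<Sum>k\<le>r. \<Sum>l\<le>r - k. ?F k l)" by (rule sum_triangle)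
  also have "\<dots> = eval_biform f1 f2 conic r (bipoly_of v)"
    unfolding eval_biform_def eval_form_def coeff_bipoly_of[OF assms] sum_distrib_left
    by (simp only: mult_ac)
  finally show ?thesis .
qed

lemma entry_homogeneous:
  assumes "homogeneous c0 1" "homogeneous c1 1" "homogeneous e (int d - 1)"
  shows "homogeneous (coords ([:[:c0, c1:], [:e:]:] * bipoly_of (unit_vec i)) p) (weight i + 1 - weight p)"
  unfolding coords_linear_mult_unit_vec
  using assms by (auto simp: weight_def algebra_simps)

lemma entry_const_coeff:
  assumes "const_coeff c0 = 0" "const_coeff c1 = 0" "const_coeff e = 0"
  shows "const_coeff (coords ([:[:c0, c1:], [:e:]:] * bipoly_of (unit_vec i)) p) = 0"
  unfolding coords_linear_mult_unit_vec using assms by simp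

lemma homogeneous_entries:
  "homogeneous (X i :: 'a poly3) 1" "homogeneous (- X i :: 'a poly3) 1"
  "homogeneous A (int d - 1)" "homogeneous (- A) (int d - 1)" "homogeneous B (int d - 1)" "homogeneous (- B) (int d - 1)"
  using A B by (auto intro: homogeneous_X homogeneous_uminus)

lemma const_coeff_entries:
  "const_coeff (X i :: 'a poly3) = 0" "const_coeff (- X i :: 'a poly3) = 0"
  "const_coeff A = 0" "const_coeff (- A) = 0" "const_coeff B = 0" "const_coeff (- B) = 0"
  using homogeneous_entries[THEN const_coeff_homogeneous] d by force+

lemma uminus_rel1: "- (rel1 * P) = [:[:- X 1, X 0:], [:B:]:] * P"
proof -
  have "- rel1 = [:[:- X 1, X 0:], [:B:]:]" by simp
  then show ?thesis using mult_minus_left[of rel1 P] by (simp only:)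
qed

lemma D0_unit_vec:
  "D0 (unit_vec q) = coords ((if even q then rel1 else rel2) * bipoly_of (unit_vec (q div 2)))"
  unfolding D0_def evens_unit_vec odds_unit_vec
  by (cases "even q") (simp_all only: if_True if_False bipoly_of_zero mult_zero_right add_0_left add_0_right)

lemma graded_hom_D0:
  "graded_hom (2 * triangle r) (\<lambda>q. weight (q div 2) + 1) (triangle (Suc r)) weight D0"
  unfolding graded_hom_def
proof (intro conjI ballI allI impI)
  fix v :: "nat \<Rightarrow> 'a poly3" assume v: "v \<in> free_module (2 * triangle r)"
  note ev = evens_in_free_module[OF v] and od = odds_in_free_module[OF v]
  show "D0 v \<in> free_module (triangle (Suc r))"
    unfolding D0_def bipoly_bounded_iff_coords[symmetric]
    by (intro bipoly_bounded_add bipoly_bounded_linear_mult bipoly_bounded_bipoly_of ev od)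
  show "D0 (\<lambda>l. c * v l) = (\<lambda>l. c * D0 v l)" for c
    unfolding D0_def evens_scale odds_scale bipoly_of_scale[OF ev] bipoly_of_scale[OF od]
      mult_smult_right smult_add_right[symmetric] coords_const_smult ..
  fix w :: "nat \<Rightarrow> 'a poly3" assume w: "w \<in> free_module (2 * triangle r)"
  note ew = evens_in_free_module[OF w] and ow = odds_in_free_module[OF w]
  show "D0 (v + w) = D0 v + D0 w"
    unfolding D0_def evens_add odds_add bipoly_of_add[OF ev ew] bipoly_of_add[OF od ow]
      coords_add[symmetric] distrib_left by (simp only: add_ac)
next
  fix p q
  show "homogeneous (D0 (unit_vec q) p) (weight (q div 2) + 1 - weight p)"
    unfolding D0_unit_vec
    by (cases "even q") (simp_all only: if_True if_False entry_homogeneous homogeneous_entries)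
qed

lemma graded_hom_D1:
  "graded_hom (triangle (r - 1)) (\<lambda>q. weight q + 2) (2 * triangle r) (\<lambda>q. weight (q div 2) + 1) D1"
  unfolding graded_hom_def
proof (intro conjI ballI allI impI)
  fix v :: "nat \<Rightarrow> 'a poly3" assume v: "v \<in> free_module (triangle (r - 1))"
  have bd: "bipoly_bounded r ([:[:c0, c1:], [:e:]:] * bipoly_of v)" for c0 c1 e
  proof (cases r)
    case 0
    then have "bipoly_of v = 0" using v by (simp add: bipoly_of_zero)
    then show ?thesis by (simp only: mult_zero_right bipoly_bounded_zero)
  next
    case (Suc r')
    then show ?thesis
      using bipoly_bounded_linear_mult[OF bipoly_bounded_bipoly_of[OF v]] by simp
  qed
  show "D1 v \<in> free_module (2 * triangle r)"
    unfolding D1_def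
    by (intro interleave_in_free_module) (simp_all only: bipoly_bounded_iff_coords[symmetric] bd bipoly_bounded_uminus)
  show "D1 (\<lambda>l. c * v l) = (\<lambda>l. c * D1 v l)" for c
    unfolding D1_def bipoly_of_scale[OF v] mult_smult_right coords_uminus coords_const_smult
    by (simp add: fun_eq_iff interleave_def)
  fix w :: "nat \<Rightarrow> 'a poly3" assume w: "w \<in> free_module (triangle (r - 1))"
  show "D1 (v + w) = D1 v + D1 w"
    unfolding D1_def bipoly_of_add[OF v w] distrib_left coords_uminus coords_add
    by (simp add: fun_eq_iff interleave_def)
next
  fix p q
  show "homogeneous (D1 (unit_vec q) p) (weight q + 2 - (weight (p div 2) + 1))"
  proof -
    have "weight q + 2 - (weight (p div 2) + 1) = weight q + 1 - weight (p div 2)" by simp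
    then show ?thesis
      unfolding D1_def uminus_rel1 interleave_def
      by (cases "even p") (simp_all only: if_True if_False entry_homogeneous homogeneous_entries)
  qed
qed

lemma free_module_eq_coords: "free_module (triangle n) = coords ` {P :: 'a poly3 poly poly. bipoly_bounded n P}"
proof (intro set_eqI iffI)
  fix v :: "nat \<Rightarrow> 'a poly3" assume "v \<in> free_module (triangle n)"
  then show "v \<in> coords ` {P. bipoly_bounded n P}"
    by (intro image_eqI[of _ _ "bipoly_of v"]) (simp_all only: coords_bipoly_of bipoly_bounded_bipoly_of mem_Collect_eq)
qed (auto simp: bipoly_bounded_iff_coords)

lemma exact_D0:
  "{v \<in> free_module (triangle (Suc r)). (\<Sum>i<triangle (Suc r). gen i * v i) = 0} = D0 ` free_module (2 * triangle r)"
proof (intro set_eqI iffI)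
  fix v assume "v \<in> {v \<in> free_module (triangle (Suc r)). (\<Sum>i<triangle (Suc r). gen i * v i) = 0}"
  then have v: "v \<in> free_module (triangle (Suc r))" and "(\<Sum>i<triangle (Suc r). gen i * v i) = 0" by blast+
  then have "eval_biform f1 f2 conic r (bipoly_of v) = 0" by (simp only: gen_sum)
  then obtain b1 b2 where b: "bipoly_bounded r b1" "bipoly_bounded r b2" "bipoly_of v = rel1 * b1 + rel2 * b2"
    using biform_eq_zero[OF bipoly_bounded_bipoly_of[OF v]] by blast
  have "v = D0 (interleave (coords b1) (coords b2))"
    unfolding D0_def evens_interleave odds_interleave bipoly_of_coords[OF b(1)] bipoly_of_coords[OF b(2)] b(3)[symmetric]
    by (rule coords_bipoly_of[OF v, symmetric])
  moreover have "interleave (coords b1) (coords b2) \<in> free_module (2 * triangle r)"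
    using b by (intro interleave_in_free_module) (simp_all only: bipoly_bounded_iff_coords)
  ultimately show "v \<in> D0 ` free_module (2 * triangle r)" by blast
next
  fix v assume "v \<in> D0 ` free_module (2 * triangle r)"
  then obtain w where w: "w \<in> free_module (2 * triangle r)" and v: "v = D0 w" by blast
  have v_mem: "v \<in> free_module (triangle (Suc r))"
    unfolding v by (rule graded_homD(1)[OF graded_hom_D0 w])
  obtain r' where r': "r = Suc r'" using r by (cases r) auto
  have bd: "bipoly_bounded (Suc r') (bipoly_of (evens w))" "bipoly_bounded (Suc r') (bipoly_of (odds w))"
    using bipoly_bounded_bipoly_of[OF evens_in_free_module[OF w]] bipoly_bounded_bipoly_of[OF odds_in_free_module[OF w]]
    by (simp_all only: r')
  have "bipoly_of v = rel1 * bipoly_of (evens w) + rel2 * bipoly_of (odds w)"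
    unfolding v D0_def
    by (rule bipoly_of_coords[of "Suc r"], unfold r') (intro bipoly_bounded_add bipoly_bounded_linear_mult bd)
  then have "eval_biform f1 f2 conic r (bipoly_of v)
      = (X 1 * f1 + - X 0 * f2 + - B * conic) * eval_biform f1 f2 conic r' (bipoly_of (evens w))
        + (X 2 * f1 + - X 1 * f2 + A * conic) * eval_biform f1 f2 conic r' (bipoly_of (odds w))"
    unfolding r' by (simp only: eval_biform_add eval_biform_linear_mult[OF bd(1)] eval_biform_linear_mult[OF bd(2)])
  moreover have "X 1 * f1 + - X 0 * f2 + - B * conic = 0" "X 2 * f1 + - X 1 * f2 + A * conic = 0"
    by algebra+
  ultimately have "eval_biform f1 f2 conic r (bipoly_of v) = 0" by (simp only: mult_zero_left add_0_left)
  then show "v \<in> {v \<in> free_module (triangle (Suc r)). (\<Sum>i<triangle (Suc r). gen i * v i) = 0}"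
    using v_mem by (simp only: mem_Collect_eq gen_sum simp_thms)
qed

lemma exact_D1: "{v \<in> free_module (2 * triangle r). D0 v = 0} = D1 ` free_module (triangle (r - 1))"
proof (intro set_eqI iffI)
  fix v assume "v \<in> {v \<in> free_module (2 * triangle r). D0 v = 0}"
  then have v: "v \<in> free_module (2 * triangle r)" and "D0 v = 0" by blast+
  then have "rel1 * bipoly_of (evens v) + rel2 * bipoly_of (odds v) = 0"
    by (simp only: D0_def coords_eq_zero_iff)
  then obtain c where c: "bipoly_bounded (r - 1) c" "bipoly_of (evens v) = rel2 * c" "bipoly_of (odds v) = - (rel1 * c)"
    using relation_syzygies[OF bipoly_bounded_bipoly_of[OF evens_in_free_module[OF v]]
      bipoly_bounded_bipoly_of[OF odds_in_free_module[OF v]]] by blast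
  have "D1 (coords c) = interleave (evens v) (odds v)"
    unfolding D1_def bipoly_of_coords[OF c(1)] c(2,3)[symmetric]
      coords_bipoly_of[OF evens_in_free_module[OF v]] coords_bipoly_of[OF odds_in_free_module[OF v]] ..
  then have "v = D1 (coords c)" by (simp only: interleave_evens_odds)
  then show "v \<in> D1 ` free_module (triangle (r - 1))"
    using c(1) unfolding bipoly_bounded_iff_coords by blast
next
  fix v assume "v \<in> D1 ` free_module (triangle (r - 1))"
  then obtain w where w: "w \<in> free_module (triangle (r - 1))" and v: "v = D1 w" by blast
  have v_mem: "v \<in> free_module (2 * triangle r)"
    unfolding v by (rule graded_homD(1)[OF graded_hom_D1 w])
  have bd: "bipoly_bounded (Suc (r - 1)) ([:[:c0, c1:], [:e:]:] * bipoly_of w)" for c0 c1 e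
    by (intro bipoly_bounded_linear_mult bipoly_bounded_bipoly_of w)
  have "D0 v = coords (rel1 * (rel2 * bipoly_of w) + rel2 * - (rel1 * bipoly_of w))"
    unfolding D0_def v D1_def evens_interleave odds_interleave bipoly_of_coords[OF bd]
      bipoly_of_coords[OF bipoly_bounded_uminus[OF bd]] ..
  also have "\<dots> = 0"
    unfolding mult_minus_right mult.left_commute[of rel1 rel2] right_minus coords_zero ..
  finally show "v \<in> {v \<in> free_module (2 * triangle r). D0 v = 0}" using v_mem by blast
qed

lemma D1_injective:
  assumes "v \<in> free_module (triangle (r - 1))" "D1 v = 0"
  shows "v = 0"
proof -
  have "rel2 * bipoly_of v = 0"
    using assms(2) by (simp only: D1_def interleave_eq_zero_iff coords_eq_zero_iff)
  moreover have "rel2 \<noteq> 0" using X_nonzero[of 2, where ?'a = 'a] by simp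
  ultimately have "bipoly_of v = 0" by (simp only: mult_eq_0_iff simp_thms)
  then have "coords (bipoly_of v) = 0" by (simp only: coords_zero)
  then show ?thesis by (simp only: coords_bipoly_of[OF assms(1)])
qed

theorem regularity_ideal_power:
  "regularity (ideal_power (ideal_span {f1, f2, conic}) r) = int (r * d)"
proof (rule regularity_of_length_two_resolution[where gen = gen and ?d0.0 = D0 and ?d1.0 = D1])
  fix q assume "q < triangle (Suc r)"
  then show "homogeneous (gen q) (weight q)" by (rule gen_homogeneous)
next
  show "graded_hom (2 * triangle r) (\<lambda>q. weight (q div 2) + 1) (triangle (Suc r)) weight D0"
    by (rule graded_hom_D0)
next
  show "graded_hom (triangle (r - 1)) (\<lambda>q. weight q + 2) (2 * triangle r) (\<lambda>q. weight (q div 2) + 1) D1"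
    by (rule graded_hom_D1)
next
  have "(\<lambda>v. \<Sum>q<triangle (Suc r). gen q * v q) ` free_module (triangle (Suc r))
      = (\<lambda>v. eval_biform f1 f2 conic r (bipoly_of v)) ` free_module (triangle (Suc r))"
    by (rule image_cong[OF refl gen_sum])
  also have "\<dots> = eval_biform f1 f2 conic r ` {P. bipoly_bounded (Suc r) P}"
    unfolding free_module_eq_coords image_image
    by (rule image_cong[OF refl]) (simp only: mem_Collect_eq bipoly_of_coords)
  also have "\<dots> = ideal_power (ideal_span {f1, f2, conic}) r"
    by (rule ideal_power_three_generators[symmetric])
  finally show "(\<lambda>v. \<Sum>q<triangle (Suc r). gen q * v q) ` free_module (triangle (Suc r))
      = ideal_power (ideal_span {f1, f2, conic}) r" .
next
  show "{v \<in> free_module (triangle (Suc r)). (\<Sum>q<triangle (Suc r). gen q * v q) = 0} = D0 ` free_module (2 * triangle r)"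
    by (rule exact_D0)
next
  show "{v \<in> free_module (2 * triangle r). D0 v = 0} = D1 ` free_module (triangle (r - 1))"
    by (rule exact_D1)
next
  fix v assume "v \<in> free_module (triangle (r - 1))" "D1 v = 0"
  then show "v = 0" by (rule D1_injective)
next
  fix p q
  show "const_coeff (D0 (unit_vec q) p) = 0"
    unfolding D0_unit_vec
    by (cases "even q") (simp_all only: if_True if_False entry_const_coeff const_coeff_entries)
  show "const_coeff (D1 (unit_vec q) p) = 0"
    unfolding D1_def uminus_rel1 interleave_def
    by (cases "even p") (simp_all only: if_True if_False entry_const_coeff const_coeff_entries)
next
  fix l
  have "weight i \<le> int (r * d)" for i
    using shift_bound[OF d] by (simp add: weight_def)
  then show "weight l \<le> int (r * d)" "weight (l div 2) + 1 - 1 \<le> int (r * d)" "weight l + 2 - 2 \<le> int (r * d)"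
    by simp_all
next
  have "prod_decode 0 = (0, 0)" using prod_encode_inverse[of "(0, 0)"] by (simp add: prod_encode_def)
  then show "(\<exists>l<triangle (Suc r). weight l = int (r * d)) \<or> (\<exists>l<2 * triangle r. weight (l div 2) + 1 - 1 = int (r * d))"
    by (intro disjI1 exI[of _ 0]) (simp add: weight_def mult.commute)
qed

end


section \<open>Restricting forms to the conic\<close>

lemma param_homogeneous:
  assumes "homogeneous F (int n)"
  shows "param F = monom (coeff (param F) n) n"
proof (rule poly_eqI, rule poly_eqI)
  fix k e
  have "coeff (coeff (param F) k) e = 0" if "k \<noteq> n"
    unfolding coeff_param using assms that by (intro sum.neutral) (auto simp: homogeneous_def)
  then show "coeff (coeff (param F) k) e = coeff (coeff (monom (coeff (param F) n) n) k) e"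
    by auto
qed

lemma param_weight_le: "param_weight m \<le> 2 * mon_degree m"
  by (simp add: param_weight_def mon_degree_eq)

text \<open>A form of degree \<open>n\<close> restricts to a binary form of degree \<open>2n\<close> in \<open>s, t\<close>, dehomogenised here by \<open>s = 1\<close>.\<close>

lemma degree_coeff_param: "degree (coeff (param F) n) \<le> 2 * n"
proof (rule degree_le, intro allI impI)
  fix e assume e: "2 * n < e"
  have "\<not> (mon_degree m = n \<and> param_weight m = e)" for m
    using param_weight_le[of m] e by auto
  then show "coeff (coeff (param F) n) e = 0"
    unfolding coeff_param by (intro sum.neutral) auto
qed

text \<open>The monomials \<open>x\<^sub>0\<^sup>ax\<^sub>1\<^sup>bx\<^sub>2\<^sup>c\<close> of degree \<open>n\<close> with \<open>b \<le> 1\<close> restrict to all powers of \<open>t\<close> up to \<open>2n\<close>.\<close>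

lemma param_surjective:
  fixes g :: "'a::comm_ring_1 poly"
  assumes "degree g \<le> 2 * n"
  shows "\<exists>F. homogeneous F (int n) \<and> param F = monom g n"
proof (intro exI conjI)
  define m :: "nat \<Rightarrow> 3 \<Rightarrow>\<^sub>0 nat" where "m e = Poly_Mapping.single 0 (n - e mod 2 - e div 2) + Poly_Mapping.single 1 (e mod 2)
    + Poly_Mapping.single 2 (e div 2)" for e
  let ?F = "\<Sum>e\<le>2 * n. Poly_Mapping.single (m e) (coeff g e)"
  have m: "mon_degree (m e) = n" "param_weight (m e) = e" if "e \<le> 2 * n" for e
  proof -
    have "e mod 2 + e div 2 \<le> n" using that by presburger
    then show "mon_degree (m e) = n" by (simp add: m_def)
    show "param_weight (m e) = e"
      by (simp add: m_def param_weight_def lookup_add lookup_single when_def)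
  qed
  show "homogeneous ?F (int n)"
  proof (rule homogeneous_sum)
    fix e assume "e \<in> {..2 * n}"
    then show "homogeneous (Poly_Mapping.single (m e) (coeff g e)) (int n)"
      using homogeneous_single[of "m e" "coeff g e"] m(1) by simp
  qed
  have "param ?F = (\<Sum>e\<le>2 * n. monom (monom (coeff g e) e) n)"
    unfolding param.subst_sum by (intro sum.cong) (simp_all add: param_single m)
  also have "\<dots> = monom (\<Sum>e\<le>2 * n. monom (coeff g e) e) n"
    by (rule poly_eqI) (simp add: coeff_sum)
  also have "(\<Sum>e\<le>2 * n. monom (coeff g e) e) = g"
    by (rule poly_as_sum_of_monoms'[OF assms])
  finally show "param ?F = monom g n" .
qed

text \<open>A binary form of odd degree is not the restriction of a plane form, but it is \<open>s a + t b\<close> for two binary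
  forms of even degree. The term of top degree in \<open>t\<close> goes into \<open>b\<close>.\<close>

lemma param_surjective_odd:
  fixes g :: "'a::comm_ring_1 poly"
  assumes "degree g \<le> 2 * n + 1"
  shows "\<exists>A B. homogeneous A (int n) \<and> homogeneous B (int n) \<and> param A + param_t * param B = monom g n"
proof -
  let ?c = "coeff g (2 * n + 1)"
  have "degree (g - monom ?c (2 * n + 1)) \<le> 2 * n"
  proof (rule degree_le, intro allI impI)
    fix e assume "2 * n < e"
    then show "coeff (g - monom ?c (2 * n + 1)) e = 0"
      using assms by (cases "e = 2 * n + 1") (simp_all add: coeff_eq_0)
  qed
  then obtain A where A: "homogeneous A (int n)" "param A = monom (g - monom ?c (2 * n + 1)) n"
    using param_surjective by blast
  obtain B where B: "homogeneous B (int n)" "param B = monom (monom ?c (2 * n)) n"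
    using param_surjective[OF degree_monom_le] by blast
  have "param_t * param B = monom (monom ?c (2 * n + 1)) n"
    unfolding B(2) by (simp add: smult_monom monom_Suc)
  then have "param A + param_t * param B = monom g n"
    unfolding A(2) by (simp add: add_monom)
  then show ?thesis using A(1) B(1) by blast
qed

section \<open>Points on the conic\<close>

abbreviation vanishes_on :: "'a::field poly3 \<Rightarrow> ('a ^ 3) set set \<Rightarrow> bool"
  where "vanishes_on F D \<equiv> \<forall>p\<in>D. \<forall>v\<in>p. eval_poly F v = 0"

text \<open>\<open>None\<close> is the point at infinity of the parameter line.\<close>

definition conic_vec :: "'a::field option \<Rightarrow> 'a ^ 3"
  where "conic_vec x = (case x of Some t \<Rightarrow> (\<chi> i. if i = 0 then 1 else if i = 1 then t else t\<^sup>2)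
    | None \<Rightarrow> (\<chi> i. if i = 2 then 1 else 0))"

lemma conic_vec_nth:
  "conic_vec (Some t) $ 0 = 1" "conic_vec (Some t) $ 1 = t" "conic_vec (Some t) $ 2 = t\<^sup>2"
  "conic_vec None $ 0 = (0 :: 'a::field)" "conic_vec None $ 1 = (0 :: 'a)" "conic_vec None $ 2 = (1 :: 'a)"
  by (simp_all add: conic_vec_def)

lemma conic_vec_nonzero: "conic_vec x \<noteq> (0 :: 'a::field ^ 3)"
proof
  assume *: "conic_vec x = 0"
  show False
  proof (cases x)
    case None
    then show False using conic_vec_nth(6)[where ?'a = 'a] * by simp
  next
    case (Some t)
    then show False using conic_vec_nth(1)[of t] * by simp
  qed
qed

lemma proportional_Image_scale:
  fixes v :: "'a::field ^ 3"
  assumes "c \<noteq> 0"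
  shows "proportional `` {c *s v} = proportional `` {v}"
proof -
  have "c *s v = 0 \<longleftrightarrow> v = 0" using assms by (simp add: vec_eq_iff)
  moreover have "(\<exists>a. w = a *s (c *s v)) \<longleftrightarrow> (\<exists>a. w = a *s v)" for w
  proof
    assume "\<exists>a. w = a *s v"
    then obtain a where "w = a *s v" ..
    then have "w = (a / c) *s (c *s v)" using assms by (simp add: vector_smult_assoc)
    then show "\<exists>a. w = a *s (c *s v)" ..
  qed (auto simp: vector_smult_assoc)
  ultimately show ?thesis by (auto simp: proportional_def)
qed

lemma eval_conic: "eval_poly (X 1 ^ 2 - X 0 * X 2) v = (v $ 1)\<^sup>2 - v $ 0 * v $ 2"
  by (simp add: eval_poly_eq_subst eval.subst_simps)

text \<open>A point with \<open>x\<^sub>0 \<noteq> 0\<close> has the parameter \<open>x\<^sub>1 / x\<^sub>0\<close>, and \<open>(0 : 0 : 1)\<close> is the only point with \<open>x\<^sub>0 = 0\<close>.\<close>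

lemma plane_conic_subset: "plane_conic \<subseteq> (\<lambda>x. proportional `` {conic_vec x}) ` (UNIV :: 'a::field option set)"
proof
  fix p :: "('a ^ 3) set" assume "p \<in> plane_conic"
  then have p: "p \<in> proj_plane" "\<And>v. v \<in> p \<Longrightarrow> (v $ 1)\<^sup>2 = v $ 0 * v $ 2"
    by (auto simp: plane_conic_def eval_conic)
  then obtain v where v: "v \<noteq> 0" "p = proportional `` {v}"
    by (auto simp: proj_plane_def quotient_def)
  have "v = 1 *s v" by simp
  then have "v \<in> p" using v unfolding proportional_def by blast
  then have eq: "(v $ 1)\<^sup>2 = v $ 0 * v $ 2" by (rule p(2))
  have vec_eqI: "w = w'" if "w $ 0 = w' $ 0" "w $ 1 = w' $ 1" "w $ 2 = w' $ 2" for w w' :: "'a ^ 3"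
  proof -
    have "w $ i = w' $ i" for i using that three_cases[of i] by auto
    then show ?thesis by (simp add: vec_eq_iff)
  qed
  have "\<exists>c x. c \<noteq> 0 \<and> v = c *s conic_vec x"
  proof (cases "v $ 0 = 0")
    case True
    then have "v $ 1 = 0" using eq by simp
    then have "v = v $ 2 *s conic_vec None"
      using True by (intro vec_eqI) (simp_all add: conic_vec_nth)
    moreover from this have "v $ 2 \<noteq> 0" using v(1) by (metis vector_smult_lzero)
    ultimately show ?thesis by blast
  next
    case False
    then have "v = v $ 0 *s conic_vec (Some (v $ 1 / v $ 0))"
      using eq by (intro vec_eqI) (simp_all add: conic_vec_nth power2_eq_square)
    then show ?thesis using False by blast
  qed
  then obtain c x where "c \<noteq> 0" "v = c *s conic_vec x" by blast
  then have "p = proportional `` {conic_vec x}"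
    by (simp add: v(2) proportional_Image_scale)
  then show "p \<in> (\<lambda>x. proportional `` {conic_vec x}) ` UNIV" by blast
qed

lemma eval_poly_scale:
  assumes "homogeneous F (int n)"
  shows "eval_poly F (c *s v) = c ^ n * eval_poly F v"
proof -
  have "(\<Prod>i\<in>UNIV. ((c *s v) $ i) ^ Poly_Mapping.lookup m i) = c ^ n * (\<Prod>i\<in>UNIV. (v $ i) ^ Poly_Mapping.lookup m i)"
    if "m \<in> Poly_Mapping.keys F" for m
  proof -
    have "mon_degree m = n" using assms that by (auto simp: homogeneous_def)
    moreover have "c ^ mon_degree m = (\<Prod>i\<in>UNIV. c ^ Poly_Mapping.lookup m i)"
      unfolding mon_degree_def by (rule power_sum)
    ultimately have "c ^ n = (\<Prod>i\<in>UNIV. c ^ Poly_Mapping.lookup m i)" by (simp only:)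
    then show ?thesis by (simp add: power_mult_distrib prod.distrib)
  qed
  then show ?thesis
    unfolding eval_poly_def sum_distrib_left by (intro sum.cong) (simp_all add: mult.left_commute)
qed

lemma vanishes_on_point_iff:
  fixes v :: "'a::field ^ 3"
  assumes "homogeneous F (int n)" "v \<noteq> 0"
  shows "(\<forall>w\<in>proportional `` {v}. eval_poly F w = 0) \<longleftrightarrow> eval_poly F v = 0"
proof
  assume *: "\<forall>w\<in>proportional `` {v}. eval_poly F w = 0"
  have "v = 1 *s v" by simp
  then have "v \<in> proportional `` {v}" using assms(2) unfolding proportional_def by blast
  then show "eval_poly F v = 0" using * by blast
qed (auto simp: proportional_def eval_poly_scale[OF assms(1)])

lemma eval_conic_vec_Some:
  assumes "homogeneous F (int n)"
  shows "eval_poly F (conic_vec (Some t)) = poly (coeff (param F) n) t"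
proof -
  have "eval_poly F (conic_vec (Some t)) = poly (poly (param F) 1) t"
  proof (induction F rule: poly_mapping_additive_induct)
    case (single m a)
    have "eval_poly (Poly_Mapping.single m a) (conic_vec (Some t))
        = a * (1 ^ Poly_Mapping.lookup m 0 * t ^ Poly_Mapping.lookup m 1 * t\<^sup>2 ^ Poly_Mapping.lookup m 2)"
      by (simp only: eval_poly_eq_subst eval.subst_single prod_UNIV_three conic_vec_nth)
    also have "\<dots> = poly (poly (param (Poly_Mapping.single m a)) 1) t"
      by (simp add: param_single poly_monom param_weight_def power_add power_mult)
    finally show ?case .
  qed (simp_all add: eval_poly_eq_subst eval.subst_simps param.subst_simps)
  also have "\<dots> = poly (coeff (param F) n) t"
    by (subst param_homogeneous[OF assms]) (simp add: poly_monom)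
  finally show ?thesis .
qed

lemma eval_conic_vec_None:
  assumes "homogeneous F (int n)"
  shows "eval_poly F (conic_vec None) = coeff (coeff (param F) n) (2 * n)"
  unfolding eval_poly_def coeff_param
proof (rule sum.cong[OF refl])
  fix m assume "m \<in> Poly_Mapping.keys F"
  then have n: "mon_degree m = n" using assms by (auto simp: homogeneous_def)
  have "(\<Prod>i\<in>UNIV. (conic_vec None $ i :: 'a) ^ Poly_Mapping.lookup m i)
      = 0 ^ Poly_Mapping.lookup m 0 * 0 ^ Poly_Mapping.lookup m 1 * 1 ^ Poly_Mapping.lookup m 2"
    by (simp only: prod_UNIV_three conic_vec_nth)
  also have "\<dots> = (if param_weight m = 2 * n then 1 else 0)"
    unfolding n[symmetric] mon_degree_eq param_weight_def by (auto simp: zero_power)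
  finally show "Poly_Mapping.lookup F m * (\<Prod>i\<in>UNIV. (conic_vec None $ i) ^ Poly_Mapping.lookup m i)
      = (if mon_degree m = n \<and> param_weight m = 2 * n then Poly_Mapping.lookup F m else 0)"
    using n by simp
qed

lemma prod_linear_dvd:
  fixes g :: "'a::idom poly"
  assumes "finite T" "\<And>t. t \<in> T \<Longrightarrow> poly g t = 0"
  shows "(\<Prod>t\<in>T. [:- t, 1:]) dvd g"
  using assms
proof (induction T)
  case (insert s T)
  then obtain h where h: "g = (\<Prod>t\<in>T. [:- t, 1:]) * h" by (auto simp: dvd_def)
  have "poly (\<Prod>t\<in>T. [:- t, 1:]) s \<noteq> 0"
    using insert(1,2) by (auto simp: poly_prod)
  moreover have "poly (\<Prod>t\<in>T. [:- t, 1:]) s * poly h s = 0"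
    using insert.prems[of s] by (simp add: h)
  ultimately have "poly h s = 0" by simp
  then have "[:- s, 1:] dvd h" by (simp add: poly_eq_0_iff_dvd)
  then show ?case
    using mult_dvd_mono[OF _ dvd_refl] unfolding h prod.insert[OF insert(1,2)] by (simp only: mult.commute)
qed simp

text \<open>Take for \<open>w\<close> the product of the linear factors of the finite parameters. Vanishing at the point at
  infinity means that the restriction has degree less than \<open>2n\<close> as a polynomial in \<open>t\<close>, and this is
  accounted for by the bound on the degree of the cofactor.\<close>

lemma vanishing_on_conic_points:
  fixes D :: "('a::field ^ 3) set set"
  assumes "D \<subseteq> plane_conic" "finite D"
  shows "\<exists>w. w \<noteq> 0 \<and> degree w \<le> card D \<and> (\<forall>n F. homogeneous F (int n) \<longrightarrow>
    (vanishes_on F D \<longleftrightarrow>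
      (\<exists>h. coeff (param F) n = w * h \<and> (h = 0 \<or> degree h + card D \<le> 2 * n))))"
proof -
  have "D \<subseteq> (\<lambda>x. proportional `` {conic_vec x}) ` UNIV" using assms(1) plane_conic_subset by blast
  then obtain U where U: "inj_on (\<lambda>x. proportional `` {conic_vec x}) U" "D = (\<lambda>x. proportional `` {conic_vec x}) ` U"
    unfolding subset_image_inj by blast
  have finU: "finite U" using assms(2) U by (simp add: finite_image_iff)
  have cardU: "card U = card D" using U by (simp add: card_image)
  define T where "T = {t. Some t \<in> U}"
  have finT: "finite T"
    unfolding T_def using finite_vimageI[OF finU, of Some] by (simp add: vimage_def)
  have U_eq: "U = (if None \<in> U then insert None (Some ` T) else Some ` T)"
  proof (intro set_eqI)
    fix x show "x \<in> U \<longleftrightarrow> x \<in> (if None \<in> U then insert None (Some ` T) else Some ` T)"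
      by (cases x) (auto simp: T_def)
  qed
  have cardT: "card D = (if None \<in> U then Suc (card T) else card T)"
    unfolding cardU[symmetric] by (subst U_eq) (simp add: finT card_image)
  define w where "w = (\<Prod>t\<in>T. [:- t, 1:])"
  have w0: "w \<noteq> 0" using finT by (simp add: w_def)
  have degw: "degree w = card T"
    unfolding w_def by (subst degree_prod_eq_sum_degree) simp_all
  have iff: "vanishes_on F D \<longleftrightarrow>
      (\<exists>h. coeff (param F) n = w * h \<and> (h = 0 \<or> degree h + card D \<le> 2 * n))"
    if F: "homogeneous F (int n)" for F n
  proof -
    let ?g = "coeff (param F) n"
    have "vanishes_on F D \<longleftrightarrow> (\<forall>x\<in>U. eval_poly F (conic_vec x) = 0)"
      unfolding U(2) by (simp add: vanishes_on_point_iff[OF F conic_vec_nonzero])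
    also have "\<dots> \<longleftrightarrow> (\<forall>t\<in>T. poly ?g t = 0) \<and> (None \<in> U \<longrightarrow> coeff ?g (2 * n) = 0)"
      by (subst U_eq) (auto simp: eval_conic_vec_Some[OF F] eval_conic_vec_None[OF F])
    also have "\<dots> \<longleftrightarrow> (\<exists>h. ?g = w * h \<and> (h = 0 \<or> degree h + card D \<le> 2 * n))"
    proof
      assume *: "(\<forall>t\<in>T. poly ?g t = 0) \<and> (None \<in> U \<longrightarrow> coeff ?g (2 * n) = 0)"
      then have "w dvd ?g" unfolding w_def using finT by (intro prod_linear_dvd) auto
      then obtain h where h: "?g = w * h" by (rule dvdE)
      have "degree h + card D \<le> 2 * n" if "h \<noteq> 0"
      proof -
        have deg: "degree ?g = card T + degree h"
          using h w0 that degw by (simp add: degree_mult_eq)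
        have "?g \<noteq> 0" using h w0 that by simp
        then have "coeff ?g (degree ?g) \<noteq> 0" by (rule leading_coeff_neq_0)
        then have "degree ?g \<noteq> 2 * n" if "None \<in> U" using * that by metis
        then show ?thesis
          using degree_coeff_param[of F n] cardT deg by (auto split: if_splits)
      qed
      then show "\<exists>h. ?g = w * h \<and> (h = 0 \<or> degree h + card D \<le> 2 * n)" using h by blast
    next
      assume "\<exists>h. ?g = w * h \<and> (h = 0 \<or> degree h + card D \<le> 2 * n)"
      then obtain h where h: "?g = w * h" "h = 0 \<or> degree h + card D \<le> 2 * n" by blast
      have "poly ?g t = 0" if "t \<in> T" for t
        using that finT by (auto simp: h(1) w_def poly_prod)
      moreover have "coeff ?g (2 * n) = 0" if "None \<in> U"
      proof (cases "h = 0")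
        case False
        have "degree ?g \<le> degree w + degree h" unfolding h(1) by (rule degree_mult_le)
        then have "degree ?g < 2 * n" using False h(2) that cardT degw by simp
        then show ?thesis by (rule coeff_eq_0)
      qed (simp add: h(1))
      ultimately show "(\<forall>t\<in>T. poly ?g t = 0) \<and> (None \<in> U \<longrightarrow> coeff ?g (2 * n) = 0)" by blast
    qed
    finally show ?thesis .
  qed
  have "degree w \<le> card D" using degw cardT by simp
  then show ?thesis using w0 iff by blast
qed

lemma vanishing_ideal_eqI:
  assumes "\<And>g. g \<in> G \<Longrightarrow> (\<exists>k. homogeneous g k) \<and> vanishes_on g D"
    and "\<And>n F. homogeneous F (int n) \<Longrightarrow> vanishes_on F D \<Longrightarrow> F \<in> ideal_span G"
  shows "vanishing_ideal D = ideal_span G"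
  unfolding vanishing_ideal_def
proof (rule subset_antisym)
  let ?V = "{f. (\<exists>k. homogeneous f k) \<and> vanishes_on f D}"
  show "ideal_span G \<subseteq> ideal_span ?V" by (rule ideal.span_mono) (use assms(1) in blast)
  have "?V \<subseteq> ideal_span G"
  proof clarify
    fix F k assume F: "homogeneous F k" "vanishes_on F D"
    show "F \<in> ideal_span G"
    proof (cases "k < 0")
      case True
      then have "Poly_Mapping.keys F = {}" using F(1) by (force simp: homogeneous_def)
      then have "F = 0" by simp
      then show ?thesis by (simp only: ideal.span_zero)
    next
      case False
      then show ?thesis using assms(2)[of F "nat k"] F by simp
    qed
  qed
  then show "ideal_span ?V \<subseteq> ideal_span G" by (rule ideal.span_minimal) (rule ideal.subspace_span)
qed

lemma conic_vanishes:
  assumes "D \<subseteq> plane_conic"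
  shows "(\<exists>k. homogeneous (conic :: 'a::field poly3) k) \<and> (vanishes_on (conic :: 'a poly3) D)"
proof
  show "\<exists>k. homogeneous (conic :: 'a poly3) k"
    using homogeneous_conic by blast
  show "vanishes_on (conic :: 'a poly3) D"
    using assms by (auto simp: plane_conic_def)
qed

text \<open>The binary form \<open>w\<close> of the points is the restriction of \<open>f\<close>, and the cofactor of any other restriction is
  itself the restriction of a form, so that modulo the conic every vanishing form is a multiple of \<open>f\<close>.\<close>

lemma vanishing_ideal_even:
  fixes D :: "('a::field ^ 3) set set"
  assumes D: "D \<subseteq> plane_conic" "card D = 2 * d" and d: "1 \<le> d"
  shows "\<exists>f. homogeneous f (int d) \<and> param f \<noteq> 0 \<and> vanishing_ideal D = ideal_span {f, conic}"
proof -
  have fin: "finite D" using D(2) d by (intro card_ge_0_finite) simp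
  obtain w :: "'a poly" where w: "w \<noteq> 0" "degree w \<le> card D"
    "\<And>n F. homogeneous F (int n) \<Longrightarrow> vanishes_on F D \<longleftrightarrow>
      (\<exists>h. coeff (param F) n = w * h \<and> (h = 0 \<or> degree h + card D \<le> 2 * n))"
    using vanishing_on_conic_points[OF D(1) fin] by blast
  obtain f where f: "homogeneous f (int d)" "param f = monom w d"
    using param_surjective[of w d] w(2) D(2) by auto
  have "vanishing_ideal D = ideal_span {f, conic}"
  proof (rule vanishing_ideal_eqI)
    fix g assume "g \<in> {f, conic}"
    moreover have "vanishes_on f D"
      unfolding w(3)[OF f(1)] f(2) by (intro exI[of _ 1]) (simp add: D(2))
    ultimately show "(\<exists>k. homogeneous g k) \<and> vanishes_on g D"
      using f(1) conic_vanishes[OF D(1)] by blast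
  next
    fix n F assume F: "homogeneous F (int n)" "vanishes_on F D"
    then obtain h where h: "coeff (param F) n = w * h" "h = 0 \<or> degree h + card D \<le> 2 * n"
      using w(3)[OF F(1)] by blast
    have "\<exists>H. param F = param (H * f)"
    proof (cases "h = 0")
      case True
      then show ?thesis
        using param_homogeneous[OF F(1)] h(1) by (intro exI[of _ 0]) (simp add: param.subst_zero)
    next
      case False
      then have n: "degree h \<le> 2 * (n - d)" "n = d + (n - d)" using h(2) D(2) by auto
      obtain H where H: "param H = monom h (n - d)" using param_surjective[OF n(1)] by blast
      have "param F = monom (w * h) n" using param_homogeneous[OF F(1)] h(1) by simp
      also have "\<dots> = param (H * f)"
        by (subst n(2)) (simp add: param.subst_mult H f(2) mult_monom mult.commute add.commute)
      finally show ?thesis ..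
    qed
    then obtain H where "param F = param (H * f)" ..
    then have "param (F - H * f) = 0" by (simp only: param.subst_diff right_minus_eq)
    then obtain e where "F - H * f = conic * e" unfolding param_eq_zero_iff by (rule dvdE)
    then have "F = H * f + e * conic" by (simp only: diff_eq_eq add.commute mult.commute)
    then show "F \<in> ideal_span {f, conic}"
      by (simp only:) (intro ideal.span_add ideal.span_scale ideal.span_base, simp_all)
  qed
  moreover have "param f \<noteq> 0" using w(1) by (simp add: f(2))
  ultimately show ?thesis using f(1) by blast
qed

text \<open>Now \<open>w\<close> has odd degree, and it becomes the restriction of a form only after multiplication by \<open>s\<close> or \<open>t\<close>;
  these products are the restrictions of \<open>f\<^sub>1\<close> and \<open>f\<^sub>2\<close>. A cofactor \<open>h\<close> also has odd degree, and splitting it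
  as \<open>s h\<^sub>1 + t h\<^sub>2\<close> gives the combination of \<open>f\<^sub>1\<close> and \<open>f\<^sub>2\<close>.\<close>

lemma vanishing_ideal_odd:
  fixes D :: "('a::field ^ 3) set set"
  assumes D: "D \<subseteq> plane_conic" "card D = 2 * d - 1" and d: "1 \<le> d"
  shows "\<exists>A B. homogeneous A (int d - 1) \<and> homogeneous B (int d - 1) \<and> param (X 0 * A + X 1 * B) \<noteq> 0 \<and>
    vanishing_ideal D = ideal_span {X 0 * A + X 1 * B, X 1 * A + X 2 * B, conic}"
proof -
  have fin: "finite D" using D(2) d by (intro card_ge_0_finite) simp
  obtain w :: "'a poly" where w: "w \<noteq> 0" "degree w \<le> card D"
    "\<And>n F. homogeneous F (int n) \<Longrightarrow> vanishes_on F D \<longleftrightarrow>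
      (\<exists>h. coeff (param F) n = w * h \<and> (h = 0 \<or> degree h + card D \<le> 2 * n))"
    using vanishing_on_conic_points[OF D(1) fin] by blast
  have "degree w \<le> 2 * (d - 1) + 1" using w(2) D(2) d by simp
  then obtain A B where AB: "homogeneous A (int (d - 1))" "homogeneous B (int (d - 1))"
    "param A + param_t * param B = monom w (d - 1)"
    using param_surjective_odd by blast
  let ?f1 = "X 0 * A + X 1 * B" and ?f2 = "X 1 * A + X 2 * B"
  have f1: "param ?f1 = monom w d"
  proof -
    have "param ?f1 = param (X 0) * (param A + param_t * param B)"
      by (simp only: param.subst_add param.subst_mult param_X_one distrib_left mult_ac)
    also have "\<dots> = monom 1 1 * monom w (d - 1)"
      unfolding AB(3) by (simp add: param.subst_X monom_altdef)
    also have "\<dots> = monom w d" using d by (simp add: mult_monom)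
    finally show ?thesis .
  qed
  have f2: "param ?f2 = param_t * param ?f1"
    by (simp only: param.subst_add param.subst_mult param_X_two param_X_one distrib_left mult_ac)
  have hom: "homogeneous (X i * A) (int d)" "homogeneous (X i * B) (int d)" for i
    using homogeneous_mult[OF homogeneous_X AB(1), of i] homogeneous_mult[OF homogeneous_X AB(2), of i] d
    by (simp_all add: of_nat_diff)
  have hom_f: "homogeneous ?f1 (int d)" "homogeneous ?f2 (int d)"
    by (auto intro: homogeneous_add hom)
  have "vanishing_ideal D = ideal_span {?f1, ?f2, conic}"
  proof (rule vanishing_ideal_eqI)
    fix g assume "g \<in> {?f1, ?f2, conic}"
    moreover have "vanishes_on ?f1 D"
      unfolding w(3)[OF hom_f(1)] f1 using d by (intro exI[of _ 1]) (simp add: D(2))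
    moreover have "vanishes_on ?f2 D"
      unfolding w(3)[OF hom_f(2)] f2 f1 using d by (intro exI[of _ "[:0, 1:]"]) (simp add: D(2) smult_monom)
    ultimately show "(\<exists>k. homogeneous g k) \<and> vanishes_on g D"
      using hom_f conic_vanishes[OF D(1)] by blast
  next
    fix n F assume F: "homogeneous F (int n)" "vanishes_on F D"
    then obtain h where h: "coeff (param F) n = w * h" "h = 0 \<or> degree h + card D \<le> 2 * n"
      using w(3)[OF F(1)] by blast
    have "\<exists>H1 H2. param F = param (H1 * ?f1 + H2 * ?f2)"
    proof (cases "h = 0")
      case True
      then show ?thesis
        using param_homogeneous[OF F(1)] h(1) by (intro exI[of _ 0]) (simp add: param.subst_zero)
    next
      case False
      then have n: "degree h \<le> 2 * (n - d) + 1" "n = d + (n - d)" using h(2) D(2) d by auto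
      obtain H1 H2 where H: "param H1 + param_t * param H2 = monom h (n - d)"
        using param_surjective_odd[OF n(1)] by blast
      have "param (H1 * ?f1 + H2 * ?f2) = (param H1 + param_t * param H2) * param ?f1"
        unfolding param.subst_add[of "H1 * ?f1"] param.subst_mult[of H1] param.subst_mult[of H2] f2
        by (simp only: distrib_right mult.assoc mult.left_commute)
      also have "\<dots> = monom (h * w) (n - d + d)" unfolding H f1 by (simp add: mult_monom)
      also have "\<dots> = param F"
        using param_homogeneous[OF F(1)] h(1) n(2) by (simp only: add.commute mult.commute)
      finally show ?thesis by metis
    qed
    then obtain H1 H2 where "param F = param (H1 * ?f1 + H2 * ?f2)" by blast
    then have "param (F - (H1 * ?f1 + H2 * ?f2)) = 0" by (simp only: param.subst_diff right_minus_eq)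
    then obtain e where "F - (H1 * ?f1 + H2 * ?f2) = conic * e" unfolding param_eq_zero_iff by (rule dvdE)
    then have "F = H1 * ?f1 + H2 * ?f2 + e * conic" by (simp only: diff_eq_eq add.commute mult.commute)
    then show "F \<in> ideal_span {?f1, ?f2, conic}"
      by (simp only:) (intro ideal.span_add ideal.span_scale ideal.span_base, simp_all)
  qed
  moreover have "param ?f1 \<noteq> 0" using w(1) by (simp add: f1)
  moreover have "int (d - 1) = int d - 1" using d by simp
  ultimately show ?thesis using AB(1,2) by (intro exI[of _ A] exI[of _ B]) (simp only: simp_thms)
qed

section \<open>Regularity of the powers\<close>

lemma ideal_span_plus: "ideal_span S + ideal_span T = ideal_span (S \<union> T)"
  unfolding ideal.span_Un set_plus_def by auto

lemma param_power_difference_nonzero: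
  assumes "1 \<le> n"
  shows "param (X 0 ^ n - X 2 ^ n :: 'a::comm_ring_1 poly3) \<noteq> 0"
proof
  assume *: "param (X 0 ^ n - X 2 ^ n :: 'a poly3) = 0"
  have "cone_point 0 ^ n = monom (1 :: 'a poly) n"
    by (simp add: monom_altdef)
  moreover have "cone_point 2 ^ n = monom (monom (1 :: 'a) (2 * n)) n"
  proof -
    have "cone_point 2 = monom (monom (1 :: 'a) 2) 1" by (simp add: monom_altdef numeral_2_eq_2)
    then show ?thesis by (simp only: monom_power power_one mult_1)
  qed
  ultimately have "monom (1 :: 'a poly) n - monom (monom 1 (2 * n)) n = 0"
    using * by (simp only: param.subst_diff param.subst_power param.subst_X)
  then have "coeff (coeff (monom (1 :: 'a poly) n - monom (monom 1 (2 * n)) n) n) 0 = 0" by simp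
  then show False using assms by simp
qed

theorem theorem3p4:
  fixes d r :: nat
    and I0 I1 :: "'a::alg_closed_field poly3 set"
  assumes "d \<ge> 2" and "r \<ge> 2"
    and I0: "(\<exists>D0. D0 \<subseteq> plane_conic \<and> card D0 = 2 * d \<and> I0 = vanishing_ideal D0) \<or>
      I0 = ideal_span {X 1 ^ 2 - X 0 * X 2}
         + ideal_span {X 1 * (X 0 ^ (d - 1) - X 2 ^ (d - 1))}"
    and I1: "(\<exists>D1. D1 \<subseteq> plane_conic \<and> card D1 = 2 * d - 1 \<and> I1 = vanishing_ideal D1) \<or>
      I1 = ideal_span {X 1 ^ 2 - X 0 * X 2}
         + ideal_span {X 1 * (X 0 ^ (d - 1) - X 2 ^ (d - 1)),
                       X 0 * (X 0 ^ (d - 1) - X 2 ^ (d - 1))}"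
  shows "regularity (ideal_power I0 r) = int (r * d + 1) \<and>
         regularity (ideal_power I1 r) = int (r * d)"
proof
  let ?h = "X 0 ^ (d - 1) - X 2 ^ (d - 1) :: 'a poly3"
  have h_hom: "homogeneous ?h (int d - 1)"
    using homogeneous_power[OF homogeneous_X, of 0 "d - 1"] homogeneous_power[OF homogeneous_X, of 2 "d - 1"] \<open>d \<ge> 2\<close>
    by (intro homogeneous_diff) (simp_all add: of_nat_diff)
  have h_nz: "param ?h \<noteq> 0" using \<open>d \<ge> 2\<close> by (intro param_power_difference_nonzero) simp
  have Xh_nz: "param (X 0 * ?h) \<noteq> 0" "param (X 1 * ?h) \<noteq> 0"
    unfolding param.subst_mult using h_nz by (simp_all add: param.subst_X)
  have "\<exists>f. homogeneous f (int d) \<and> param f \<noteq> 0 \<and> I0 = ideal_span {f, conic}"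
    using I0
  proof
    assume "\<exists>D0. D0 \<subseteq> plane_conic \<and> card D0 = 2 * d \<and> I0 = vanishing_ideal D0"
    then obtain D where D: "D \<subseteq> plane_conic" "card D = 2 * d" "I0 = vanishing_ideal D" by blast
    show ?thesis
      using vanishing_ideal_even[OF D(1,2)] \<open>d \<ge> 2\<close> D(3) by auto
  next
    assume "I0 = ideal_span {conic} + ideal_span {X 1 * ?h}"
    then have "I0 = ideal_span {X 1 * ?h, conic}"
      unfolding ideal_span_plus by (simp add: insert_commute)
    moreover have "homogeneous (X 1 * ?h) (int d)"
      using homogeneous_mult[OF homogeneous_X h_hom, of 1] by simp
    ultimately show ?thesis using Xh_nz(2) by blast
  qed
  then obtain f where f: "homogeneous f (int d)" "param f \<noteq> 0" "I0 = ideal_span {f, conic}" by blast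
  have r: "1 \<le> r" using \<open>r \<ge> 2\<close> by simp
  show "regularity (ideal_power I0 r) = int (r * d + 1)"
    unfolding f(3) by (rule regularity_complete_intersection_power[OF \<open>d \<ge> 2\<close> r f(1,2)])
  have "\<exists>A B. homogeneous A (int d - 1) \<and> homogeneous B (int d - 1) \<and> param (X 0 * A + X 1 * B) \<noteq> 0 \<and>
      I1 = ideal_span {X 0 * A + X 1 * B, X 1 * A + X 2 * B, conic}"
    using I1
  proof
    assume "\<exists>D1. D1 \<subseteq> plane_conic \<and> card D1 = 2 * d - 1 \<and> I1 = vanishing_ideal D1"
    then obtain D where D: "D \<subseteq> plane_conic" "card D = 2 * d - 1" "I1 = vanishing_ideal D" by blast
    show ?thesis
      using vanishing_ideal_odd[OF D(1,2)] \<open>d \<ge> 2\<close> D(3) by auto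
  next
    assume "I1 = ideal_span {conic} + ideal_span {X 1 * ?h, X 0 * ?h}"
    then have "I1 = ideal_span {X 0 * ?h, X 1 * ?h, conic}"
      unfolding ideal_span_plus by (simp add: insert_commute)
    then show ?thesis
      using h_hom Xh_nz(1) by (intro exI[of _ ?h] exI[of _ 0]) simp
  qed
  then obtain A B where AB: "homogeneous A (int d - 1)" "homogeneous B (int d - 1)" "param (X 0 * A + X 1 * B) \<noteq> 0"
    "I1 = ideal_span {X 0 * A + X 1 * B, X 1 * A + X 2 * B, conic}" by blast
  interpret odd_conic_ideal_power A B d r
    by unfold_locales (use AB r \<open>d \<ge> 2\<close> in simp_all)
  show "regularity (ideal_power I1 r) = int (r * d)"
    unfolding AB(4) by (rule regularity_ideal_power)
qed

end
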